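(* Let $\alpha>0$ and $1\le q<p<\infty$. Let $\Omega\subset\mathbb{R}^N$ be an open connected set. Assume that $u,v\in X^{q,p}(\Omega)$ are two positive functions such that $u$ is a weak subsolution and $v$ is a weak supersolution of \[ -\Delta_p w=\alpha\,|w|^{q-2}\,w\qquad\text{in }\Omega . \] If $(u-v)_+\in X^{q,p}_0(\Omega)$, then $v\ge u$ almost everywhere in $\Omega$.
   Context: $\Delta_p w=\mathrm{div}(|\nabla w|^{p-2}\nabla w)$. For $1\le q<\infty$, $1<p<\infty$, $X^{q,p}(\Omega)=\{\psi\in L^q(\Omega):\nabla\psi\in L^p(\Omega;\mathbb{R}^N)\}$ (weak gradient) with norm $\|\psi\|_{L^q(\Omega)}+\|\nabla\psi\|_{L^p(\Omega)}$, and $X^{q,p}_0(\Omega)$ is the closure of $C^\infty_0(\Omega)$ in $X^{q,p}(\Omega)$. A function $v\in X^{q,p}(\Omega)$ is a weak supersolution (resp. subsolution) of $-\Delta_p w=\alpha|w|^{q-2}w$ if $\int_\Omega\langle|\nabla v|^{p-2}\nabla v,\nabla\psi\rangle\,dx\ge\alpha\int_\Omega|v|^{q-2}v\,\psi\,dx$ (resp. $\le$) for every non-negative $\psi\in C^\infty_0(\Omega)$. When $q=1$ and $v\ge0$, the convention $|v|^{q-2}v=1$ is used. $w_+=\max\{w,0\}$. *)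

theory Defs
  imports "HOL-Analysis.Analysis"
begin

coinductive smooth_fun :: "('a::euclidean_space \<Rightarrow> real) \<Rightarrow> bool" where
  "(\<forall>x. f differentiable (at x)) \<Longrightarrow>
   (\<forall>b\<in>Basis. smooth_fun (\<lambda>x. frechet_derivative f (at x) b)) \<Longrightarrow> smooth_fun f"

definition test_fun :: "'a::euclidean_space set \<Rightarrow> ('a \<Rightarrow> real) \<Rightarrow> bool" where
  "test_fun \<Omega> \<phi> \<longleftrightarrow> smooth_fun \<phi> \<and> compact (closure {x. \<phi> x \<noteq> 0})
      \<and> closure {x. \<phi> x \<noteq> 0} \<subseteq> \<Omega>"

definition grad :: "('a::euclidean_space \<Rightarrow> real) \<Rightarrow> 'a \<Rightarrow> 'a" where
  "grad \<phi> x = (\<Sum>b\<in>Basis. frechet_derivative \<phi> (at x) b *\<^sub>R b)"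

definition in_Lp :: "real \<Rightarrow> 'a::euclidean_space set \<Rightarrow> ('a \<Rightarrow> 'b::euclidean_space) \<Rightarrow> bool" where
  "in_Lp r \<Omega> f \<longleftrightarrow> set_borel_measurable lebesgue \<Omega> f
      \<and> set_integrable lebesgue \<Omega> (\<lambda>x. norm (f x) powr r)"

definition Lp_norm :: "real \<Rightarrow> 'a::euclidean_space set \<Rightarrow> ('a \<Rightarrow> 'b::euclidean_space) \<Rightarrow> real" where
  "Lp_norm r \<Omega> f = (LINT x:\<Omega>|lebesgue. norm (f x) powr r) powr (1 / r)"

definition weak_grad :: "'a::euclidean_space set \<Rightarrow> ('a \<Rightarrow> real) \<Rightarrow> ('a \<Rightarrow> 'a) \<Rightarrow> bool" where
  "weak_grad \<Omega> u G \<longleftrightarrow> set_borel_measurable lebesgue \<Omega> G \<and>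
     (\<forall>\<phi>. test_fun \<Omega> \<phi> \<longrightarrow> (\<forall>b\<in>Basis.
        (LINT x:\<Omega>|lebesgue. u x * frechet_derivative \<phi> (at x) b)
        = - (LINT x:\<Omega>|lebesgue. (G x \<bullet> b) * \<phi> x)))"

definition X_grad :: "real \<Rightarrow> real \<Rightarrow> 'a::euclidean_space set \<Rightarrow> ('a \<Rightarrow> real) \<Rightarrow> ('a \<Rightarrow> 'a) \<Rightarrow> bool" where
  "X_grad q p \<Omega> u G \<longleftrightarrow> in_Lp q \<Omega> u \<and> weak_grad \<Omega> u G \<and> in_Lp p \<Omega> G"

definition Xqp :: "real \<Rightarrow> real \<Rightarrow> 'a::euclidean_space set \<Rightarrow> ('a \<Rightarrow> real) \<Rightarrow> bool" where
  "Xqp q p \<Omega> u \<longleftrightarrow> (\<exists>G. X_grad q p \<Omega> u G)"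

definition Xqp0 :: "real \<Rightarrow> real \<Rightarrow> 'a::euclidean_space set \<Rightarrow> ('a \<Rightarrow> real) \<Rightarrow> bool" where
  "Xqp0 q p \<Omega> u \<longleftrightarrow> (\<exists>G. X_grad q p \<Omega> u G \<and>
     (\<exists>\<phi>::nat \<Rightarrow> 'a \<Rightarrow> real. (\<forall>n. test_fun \<Omega> (\<phi> n)) \<and>
        (\<lambda>n. Lp_norm q \<Omega> (\<lambda>x. \<phi> n x - u x) + Lp_norm p \<Omega> (\<lambda>x. grad (\<phi> n) x - G x))
          \<longlonglongrightarrow> 0))"

(* |t|^{q-2} t; for q = 1 and t > 0 this equals 1, matching the paper's convention *)
definition qpow :: "real \<Rightarrow> real \<Rightarrow> real" where
  "qpow q t = sgn t * \<bar>t\<bar> powr (q - 1)"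

definition weak_supersol :: "real \<Rightarrow> real \<Rightarrow> real \<Rightarrow> 'a::euclidean_space set \<Rightarrow> ('a \<Rightarrow> real) \<Rightarrow> bool" where
  "weak_supersol \<alpha> q p \<Omega> v \<longleftrightarrow> (\<exists>G. X_grad q p \<Omega> v G \<and>
     (\<forall>\<psi>. test_fun \<Omega> \<psi> \<and> (\<forall>x. \<psi> x \<ge> 0) \<longrightarrow>
        (LINT x:\<Omega>|lebesgue. (norm (G x) powr (p - 2) *\<^sub>R G x) \<bullet> grad \<psi> x)
        \<ge> \<alpha> * (LINT x:\<Omega>|lebesgue. qpow q (v x) * \<psi> x)))"

definition weak_subsol :: "real \<Rightarrow> real \<Rightarrow> real \<Rightarrow> 'a::euclidean_space set \<Rightarrow> ('a \<Rightarrow> real) \<Rightarrow> bool" where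
  "weak_subsol \<alpha> q p \<Omega> v \<longleftrightarrow> (\<exists>G. X_grad q p \<Omega> v G \<and>
     (\<forall>\<psi>. test_fun \<Omega> \<psi> \<and> (\<forall>x. \<psi> x \<ge> 0) \<longrightarrow>
        (LINT x:\<Omega>|lebesgue. (norm (G x) powr (p - 2) *\<^sub>R G x) \<bullet> grad \<psi> x)
        \<le> \<alpha> * (LINT x:\<Omega>|lebesgue. qpow q (v x) * \<psi> x)))"

end

(*
  Put U = u + eps, V = v + eps, T = K U / (K + U) <= min U K and d = (T - V)_+ / T, and test the
  subsolution with U^(1-p) T^p d^2 and the supersolution with V^(1-p) T^p d^2. A pointwise
  Picone-type inequality shows that the difference of the left-hand sides is at least
  - p (1 - K / (K + U)) |grad u|^p, an error that vanishes for eps -> 0, K -> infinity. By dominated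
  convergence and Fatou's lemma the limit of the right-hand sides gives
  int v^(q-p) (u - v)_+^2 u^(p-2) <= int u^(q-p) (u - v)_+^2 u^(p-2), which forces u <= v since q < p.
  The test functions are admissible because they are C^1 functions Psi(v, s) of v and s = (u - v)_+
  with Psi(v, 0) = 0: replace s by test functions approximating (u - v)_+ in X_0, mollify v near the
  (compact) support of s, and mollify the resulting compactly supported C^1 function.
*)
theory Submission
  imports Defs
begin

text \<open>The powers with exponent 1 - p blow up where v is small, and u may be unbounded: eps
  keeps all denominators away from 0 and K keeps T bounded, so the test functions have globally
  bounded partial derivatives. The truncation U |-> K U / (K + U) is smooth, unlike min U K, and it
  is strict: since T < U, d vanishes in a neighbourhood of {s <= 0}, where the corner of s |-> max s
  0 would otherwise be felt. The square on d makes the test functions C^1 across T = V. The price of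
  truncating is the factor theta = T / U, which is also U T'(U) / T(U). For theta = 1 the two Young
  inequalities applied to the mixed terms cancel exactly; otherwise 1 - theta measures the error. A
  second obstacle is that the gradient which comes with (u - v)_+ in X_0 is anonymous: it has to be
  identified with grad u - grad v on {u > v} before the pointwise inequality can be used.\<close>

section \<open>Mollifiers\<close>

text \<open>The extra index \<open>k\<close> makes the family closed under differentiation: the
  derivative of member \<open>k\<close> is a combination of members \<open>k + 2\<close> and
  \<open>k + 1\<close>. For \<open>k = 0\<close> it is the classical exp (- 1 / t), extended by
  0.\<close>

definition bump_kernel :: "nat \<Rightarrow> real \<Rightarrow> real" where
  "bump_kernel k t = (if t > 0 then exp (- (1 / t)) / t ^ k else 0)"

text \<open>exp (1 / t) dominates the single term (1 / t)^(k + 2) / (k + 2)! of its series. The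
  quadratic rate leaves one power of t to spare in the difference quotient at 0.\<close>

lemma bump_kernel_le: "bump_kernel k t \<le> fact (k + 2) * t\<^sup>2"
proof (cases "t > 0")
  case True
  define c :: real where "c = fact (k + 2)"
  have "c > 0" by (simp add: c_def)
  have "(1 / t) ^ (k + 2) / c \<le> (\<Sum>n. (1 / t) ^ n / fact n)"
    using sum_le_suminf[of "\<lambda>n. (1 / t) ^ n / fact n" "{k + 2}"] True summable_exp[of "1 / t"]
    by (simp add: c_def field_simps)
  also have "\<dots> = exp (1 / t)"
    by (simp add: exp_def field_simps)
  finally have "1 \<le> c * (t ^ k * (t\<^sup>2 * exp (1 / t)))"
    using True \<open>c > 0\<close> by (simp add: power_add divide_simps mult_ac power2_eq_square)
  then show ?thesis using True unfolding c_def[symmetric]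
    by (simp add: bump_kernel_def exp_minus divide_simps mult_ac power2_eq_square)
next
  case False
  then show ?thesis by (simp add: bump_kernel_def)
qed

lemma has_field_derivative_bump_kernel:
  "(bump_kernel k has_field_derivative bump_kernel (k + 2) t - real k * bump_kernel (k + 1) t) (at t)"
proof -
  consider "t < 0" | "t = 0" | "t > 0" by linarith
  then show ?thesis
  proof cases
    case 1
    have "((\<lambda>_. 0) has_field_derivative 0) (at t)" by simp
    then have "(bump_kernel k has_field_derivative 0) (at t)"
      by (rule has_field_derivative_transform_within_open[where S = "{..<0}"]) (use 1 in \<open>auto simp: bump_kernel_def\<close>)
    then show ?thesis using 1 by (simp add: bump_kernel_def)
  next
    case 2
    have "((\<lambda>h. bump_kernel k h / h) \<longlongrightarrow> 0) (at 0)"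
    proof (rule Lim_null_comparison)
      show "\<forall>\<^sub>F h in at 0. norm (bump_kernel k h / h) \<le> fact (k + 2) * \<bar>h\<bar>"
        unfolding eventually_at
      proof (intro exI[of _ 1] conjI ballI impI)
        fix h :: real assume "h \<noteq> 0 \<and> dist h 0 < 1"
        moreover have "0 \<le> bump_kernel k h" by (auto simp: bump_kernel_def)
        ultimately show "norm (bump_kernel k h / h) \<le> fact (k + 2) * \<bar>h\<bar>"
          using bump_kernel_le[of k h] by (simp add: divide_simps power2_eq_square mult.assoc)
      qed auto
      show "((\<lambda>h::real. fact (k + 2) * \<bar>h\<bar>) \<longlongrightarrow> 0) (at 0)"
        by (auto intro!: tendsto_eq_intros)
    qed
    then show ?thesis using 2 by (simp add: has_field_derivative_iff bump_kernel_def)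
  next
    case 3
    have "((\<lambda>t. exp (- (1 / t)) / t ^ k) has_field_derivative
        bump_kernel (k + 2) t - real k * bump_kernel (k + 1) t) (at t)"
      using 3 by (cases k)
        (auto intro!: derivative_eq_intros simp: bump_kernel_def divide_simps power2_eq_square, auto simp: algebra_simps power_eq_if)
    then show ?thesis
      by (rule has_field_derivative_transform_within_open[where S = "{0<..}"]) (use 3 in \<open>auto simp: bump_kernel_def\<close>)
  qed
qed

lemma smooth_funD:
  assumes "smooth_fun f"
  shows "f differentiable (at x)" "b \<in> Basis \<Longrightarrow> smooth_fun (\<lambda>x. frechet_derivative f (at x) b)"
  using assms by (auto elim: smooth_fun.cases)

text \<open>Coinduction with the invariant given as a set. It serves twice: for
  \<open>bump_algebra\<close> and for the convolutions of one fixed function with all smooth kernels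
  supported in a fixed set.\<close>

lemma smooth_fun_coinduct_set:
  assumes "f \<in> S" 
    and "\<And>g x. g \<in> S \<Longrightarrow> g differentiable (at x)"
    and "\<And>g b. g \<in> S \<Longrightarrow> b \<in> Basis \<Longrightarrow> (\<lambda>x. frechet_derivative g (at x) b) \<in> S"
  shows "smooth_fun f"
  using assms(1)
  by (coinduction arbitrary: f) (use assms(2,3) in auto)

text \<open>Closed under partial derivatives, hence a coinduction invariant for \<^const>\<open>smooth_fun\<close>.\<close>

inductive_set bump_algebra :: "('a::euclidean_space \<Rightarrow> real) set" where
  const: "(\<lambda>x. c) \<in> bump_algebra"
| coord: "(\<lambda>x. x \<bullet> b) \<in> bump_algebra"
| kernel: "(\<lambda>x. bump_kernel k (r - (x - z) \<bullet> (x - z))) \<in> bump_algebra"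
| add: "f \<in> bump_algebra \<Longrightarrow> g \<in> bump_algebra \<Longrightarrow> (\<lambda>x. f x + g x) \<in> bump_algebra"
| mult: "f \<in> bump_algebra \<Longrightarrow> g \<in> bump_algebra \<Longrightarrow> (\<lambda>x. f x * g x) \<in> bump_algebra"

lemma bump_algebra_derivative:
  assumes "f \<in> bump_algebra"
  shows "\<exists>D. \<forall>b. D b \<in> bump_algebra \<and> (\<forall>x. (f has_derivative (\<lambda>b. D b x)) (at x))"
  using assms
proof induction
  case (const c)
  show ?case
    by (intro exI[of _ "\<lambda>_ _. 0"]) (auto intro: bump_algebra.const)
next
  case (coord b)
  show ?case
    by (intro exI[of _ "\<lambda>h _. h \<bullet> b"]) (auto intro!: bump_algebra.const derivative_eq_intros)
next
  case (kernel k r z)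
  let ?K = "\<lambda>k x. bump_kernel k (r - (x - z) \<bullet> (x - z))"
  \<comment> \<open>Sums with unary minus instead of differences, so that the introduction rules of
    \<open>bump_algebra\<close> match; the last factor is the derivative of r - |x - z|^2 in
    direction b.\<close>
  let ?D = "\<lambda>b x. (?K (k + 2) x + - real k * ?K (k + 1) x) * (- 2 * (x \<bullet> b + - (z \<bullet> b)))"
  have "?D b \<in> bump_algebra" for b
    by (intro bump_algebra.intros)
  moreover have "(?K k has_derivative (\<lambda>b. ?D b x)) (at x)" for x
  proof -
    have "((\<lambda>x. r - (x - z) \<bullet> (x - z)) has_derivative (\<lambda>h. - 2 * (x \<bullet> h + - (z \<bullet> h)))) (at x)"
      by (auto intro!: derivative_eq_intros simp: inner_diff_left inner_diff_right inner_commute)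
    from has_derivative_compose[OF this has_field_derivative_bump_kernel[unfolded has_field_derivative_def]]
    show ?thesis by (simp add: algebra_simps)
  qed
  ultimately show ?case by (intro exI[of _ ?D]) blast
next
  case (add f g)
  from add.IH(1) obtain D where D: "\<forall>b. D b \<in> bump_algebra \<and> (\<forall>x. (f has_derivative (\<lambda>b. D b x)) (at x))" ..
  from add.IH(2) obtain E where E: "\<forall>b. E b \<in> bump_algebra \<and> (\<forall>x. (g has_derivative (\<lambda>b. E b x)) (at x))" ..
  have "(\<lambda>x. D b x + E b x) \<in> bump_algebra" for b
    using D E by (simp add: bump_algebra.add)
  moreover have "((\<lambda>x. f x + g x) has_derivative (\<lambda>b. D b x + E b x)) (at x)" for x
    using D E by (intro has_derivative_add) auto
  ultimately show ?case by (intro exI[of _ "\<lambda>b x. D b x + E b x"]) simp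
next
  case (mult f g)
  from mult.IH(1) obtain D where D: "\<forall>b. D b \<in> bump_algebra \<and> (\<forall>x. (f has_derivative (\<lambda>b. D b x)) (at x))" ..
  from mult.IH(2) obtain E where E: "\<forall>b. E b \<in> bump_algebra \<and> (\<forall>x. (g has_derivative (\<lambda>b. E b x)) (at x))" ..
  have "(\<lambda>x. f x * E b x + D b x * g x) \<in> bump_algebra" for b
    using mult.hyps D E by (simp add: bump_algebra.add bump_algebra.mult)
  moreover have "((\<lambda>x. f x * g x) has_derivative (\<lambda>b. f x * E b x + D b x * g x)) (at x)" for x
    using D E by (intro has_derivative_mult) auto
  ultimately show ?case by (intro exI[of _ "\<lambda>b x. f x * E b x + D b x * g x"]) simp
qed

lemma bump_algebra_smooth: "f \<in> bump_algebra \<Longrightarrow> smooth_fun f"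
proof (erule smooth_fun_coinduct_set)
  fix g :: "'a \<Rightarrow> real" and x b assume g: "g \<in> bump_algebra"
  from bump_algebra_derivative[OF g] obtain D
    where D: "\<forall>b. D b \<in> bump_algebra \<and> (\<forall>x. (g has_derivative (\<lambda>b. D b x)) (at x))" ..
  have D2: "(g has_derivative (\<lambda>b. D b x)) (at x)" for x using D by simp
  show "g differentiable (at x)" using D2 by (auto simp: differentiable_def)
  have "(\<lambda>x. frechet_derivative g (at x) b) = D b"
    by (simp add: frechet_derivative_at[OF D2, symmetric])
  then show "(\<lambda>x. frechet_derivative g (at x) b) \<in> bump_algebra" using D by simp
qed

lemma smooth_fun_has_derivative:
  assumes "smooth_fun f"
  shows "(f has_derivative (\<lambda>h. grad f x \<bullet> h)) (at x)"
proof -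
  have d: "(f has_derivative frechet_derivative f (at x)) (at x)"
    using smooth_funD(1)[OF assms] frechet_derivative_works by blast
  have "frechet_derivative f (at x) h = grad f x \<bullet> h" for h
  proof -
    interpret linear "frechet_derivative f (at x)"
      using d has_derivative_linear by blast
    have "frechet_derivative f (at x) h = frechet_derivative f (at x) (\<Sum>b\<in>Basis. (h \<bullet> b) *\<^sub>R b)"
      by (simp add: euclidean_representation)
    also have "\<dots> = grad f x \<bullet> h"
      by (simp add: sum scaleR grad_def inner_sum_left inner_sum_right) (simp add: inner_commute mult.commute)
    finally show ?thesis .
  qed
  then have "frechet_derivative f (at x) = (\<lambda>h. grad f x \<bullet> h)" by (rule ext)
  then show ?thesis using d by simp
qed

lemma frechet_derivative_eq_grad:
  assumes "smooth_fun f"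
  shows "frechet_derivative f (at x) h = grad f x \<bullet> h"
  by (simp add: frechet_derivative_at[OF smooth_fun_has_derivative[OF assms], symmetric])

lemma smooth_fun_continuous_on: "smooth_fun f \<Longrightarrow> continuous_on S f"
  by (meson continuous_at_imp_continuous_on differentiable_imp_continuous_within smooth_funD(1))

lemma smooth_fun_continuous_on_grad: "smooth_fun f \<Longrightarrow> continuous_on S (grad f)"
  unfolding grad_def
  by (intro continuous_intros smooth_fun_continuous_on smooth_funD)

section \<open>Continuity of translations\<close>

lemma powr_superadditive:
  fixes x y p :: real
  assumes "1 \<le> p" "0 \<le> x" "0 \<le> y"
  shows "x powr p + y powr p \<le> (x + y) powr p"
proof (cases "x + y = 0")
  case False
  \<comment> \<open>Split off one factor z; what remains, z powr (p - 1), is monotone because p >=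
    1.\<close>
  have *: "z powr p = z * z powr (p - 1)" if "0 \<le> z" for z :: real
    using that by (cases "z = 0") (auto simp: powr_diff)
  have "x powr p + y powr p \<le> x * (x + y) powr (p - 1) + y * (x + y) powr (p - 1)"
    unfolding *[OF assms(2)] *[OF assms(3)]
    using assms by (intro add_mono mult_left_mono powr_mono2) auto
  also have "\<dots> = (x + y) powr p"
    using assms by (simp add: * distrib_right)
  finally show ?thesis .
next
  case True
  then have "x = 0" "y = 0" using assms by auto
  then show ?thesis by simp
qed

text \<open>From x + y <= 2 max x y, whence the constant 2^p.\<close>

lemma powr_sum_le:
  fixes x y p :: real
  assumes "0 \<le> p" "0 \<le> x" "0 \<le> y"
  shows "(x + y) powr p \<le> 2 powr p * (x powr p + y powr p)"
proof -
  have "(x + y) powr p \<le> (2 * max x y) powr p"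
    using assms by (intro powr_mono2) auto
  also have "\<dots> = 2 powr p * max x y powr p"
    using assms by (simp add: powr_mult)
  also have "\<dots> \<le> 2 powr p * (x powr p + y powr p)"
    by (intro mult_left_mono) (auto simp: max_def)
  finally show ?thesis .
qed

text \<open>For equal signs superadditivity applies, for opposite signs \<open>powr_sum_le\<close>,
  which is where 2^p comes from. The L^p distance of two functions is thus controlled by the L^1
  distance of their signed powers.\<close>

lemma powr_dist_le:
  fixes a b p :: real
  assumes "1 \<le> p"
  shows "\<bar>a - b\<bar> powr p \<le> 2 powr p * \<bar>sgn a * \<bar>a\<bar> powr p - sgn b * \<bar>b\<bar> powr p\<bar>"
proof -
  have same: "\<bar>x - y\<bar> powr p \<le> 2 powr p * \<bar>x powr p - y powr p\<bar>" if "0 \<le> y" "y \<le> x" for x y :: real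
  proof -
    have "(x - y) powr p \<le> 1 * (x powr p - y powr p)"
      using powr_superadditive[of p "x - y" y] assms that by auto
    also have "\<dots> \<le> 2 powr p * (x powr p - y powr p)"
      using that assms by (intro mult_right_mono) (auto intro!: powr_mono2 ge_one_powr_ge_zero)
    finally show ?thesis using that assms by (simp add: powr_mono2)
  qed
  have opp: "\<bar>x + y\<bar> powr p \<le> 2 powr p * \<bar>x powr p + y powr p\<bar>" if "0 \<le> y" "0 \<le> x" for x y :: real
    using powr_sum_le[of p x y] assms that by auto
  consider "0 \<le> b" "b \<le> a" | "0 \<le> a" "a \<le> b" | "b \<le> a" "a \<le> 0" | "a \<le> b" "b \<le> 0"
    | "0 \<le> a" "b \<le> 0" | "a \<le> 0" "0 \<le> b" by linarith
  then show ?thesis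
  proof cases
    case 1 then show ?thesis using same[of b a] assms by (cases "b = 0"; cases "a = 0") (auto simp: sgn_if)
  next
    case 2 then show ?thesis using same[of a b] assms by (cases "b = 0"; cases "a = 0") (auto simp: sgn_if abs_minus_commute)
  next
    case 3 then show ?thesis using same[of "-a" "-b"] assms
      by (cases "b = 0"; cases "a = 0") (auto simp: sgn_if abs_minus_commute)
  next
    case 4 then show ?thesis using same[of "-b" "-a"] assms
      by (cases "b = 0"; cases "a = 0") (auto simp: sgn_if abs_minus_commute)
  next
    case 5 then show ?thesis using opp[of a "-b"] opp[of "-b" a] assms by (cases "b = 0"; cases "a = 0") (auto simp: sgn_if abs_minus_commute)
  next
    case 6 then show ?thesis using opp[of "-a" b] opp[of b "-a"] assms by (cases "b = 0"; cases "a = 0") (auto simp: sgn_if abs_minus_commute)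
  qed
qed

text \<open>Weighted arithmetic-geometric mean inequality for a^p and b^p. The conjugate exponent
  never appears, so p = 1 is included.\<close>

lemma Youngs_powr:
  fixes a b p :: real
  assumes "1 \<le> p" "0 \<le> a" "0 \<le> b"
  shows "a powr (p - 1) * b \<le> (1 - 1 / p) * a powr p + b powr p / p"
proof (cases "a = 0 \<or> b = 0")
  case True
  then show ?thesis using assms by auto
next
  case False
  have e: "p * (1 - 1 / p) = p - 1" using assms by (simp add: field_simps)
  have "(a powr p) powr (1 - 1 / p) * (b powr p) powr (1 / p) \<le> (1 - 1 / p) * a powr p + 1 / p * b powr p"
    using assms False by (intro Youngs_inequality_0) (auto simp: field_simps)
  then show ?thesis
    using assms False unfolding powr_powr e by simp
qed

section \<open>Translation invariance, inner regularity and the L^1 case\<close>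

lemma
  fixes f :: "'a::euclidean_space \<Rightarrow> 'b::{banach, second_countable_topology}"
  shows lborel_integral_translate: "(LINT x|lborel. f (x + h)) = (LINT x|lborel. f x)"
    and lborel_integrable_translate: "integrable lborel f \<Longrightarrow> integrable lborel (\<lambda>x. f (x + h))"
proof -
  have T: "(+) h \<in> lborel \<rightarrow>\<^sub>M lborel" by simp
  have eq: "distr lborel lborel ((+) h) = lborel" for h :: 'a
    using lborel_distr_plus[of h] by (simp cong: distr_cong)
  show int: "integrable lborel f \<Longrightarrow> integrable lborel (\<lambda>x. f (x + h))"
    for f :: "'a \<Rightarrow> 'b" and h
    using integrable_distr[of "(+) h" lborel lborel f] by (simp add: eq add.commute)
  show "(LINT x|lborel. f (x + h)) = (LINT x|lborel. f x)"
  proof (cases "integrable lborel f")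
    case True
    then show ?thesis
      using integral_distr[OF T, of f] by (simp add: eq add.commute borel_measurable_integrable)
  next
    case False
    \<comment> \<open>Translating back by - h shows that non-integrability is preserved. Both
      integrals are then 0 by convention, which makes the equation unconditional.\<close>
    then have "\<not> integrable lborel (\<lambda>x. f (x + h))"
      using int[of "\<lambda>x. f (x + h)" "- h"] by (auto simp: algebra_simps)
    with False show ?thesis by (simp add: not_integrable_integral_eq)
  qed
qed

lemma lborel_nn_integral_translate:
  fixes f :: "'a::euclidean_space \<Rightarrow> ennreal"
  assumes [measurable]: "f \<in> borel_measurable borel"
  shows "(\<integral>\<^sup>+ x. f (x + h) \<partial>lborel) = (\<integral>\<^sup>+ x. f x \<partial>lborel)"
proof -
  have "(\<integral>\<^sup>+ x. f x \<partial>lborel) = (\<integral>\<^sup>+ x. f x \<partial>distr lborel borel ((+) h))"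
    by (simp add: lborel_distr_plus)
  also have "\<dots> = (\<integral>\<^sup>+ x. f (x + h) \<partial>lborel)"
    by (subst nn_integral_distr) (auto simp: add.commute)
  finally show ?thesis by simp
qed

text \<open>Inner regularity is applied to the finite measure \<open>M\<close>, the restriction of
  Lebesgue measure to \<open>A\<close>, since Lebesgue measure itself is infinite.\<close>

lemma lborel_inner_compact:
  fixes A :: "'a::euclidean_space set"
  assumes A: "A \<in> sets borel" "emeasure lborel A < \<infinity>" and e: "e > 0"
  obtains K where "compact K" "K \<subseteq> A" "emeasure lborel (A - K) < ennreal e"
proof (cases "emeasure lborel A = 0")
  case True
  then show thesis using that[of "{}"] e by simp
next
  case False
  define M where "M = density lborel (indicator A :: 'a \<Rightarrow> ennreal)"
  have M: "emeasure M X = emeasure lborel (A \<inter> X)" if "X \<in> sets borel" for X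
    using A that by (simp add: M_def emeasure_density nn_integral_indicator flip: indicator_inter_arith)
  define a where "a = measure lborel A"
  have a: "emeasure lborel A = ennreal a"
    using A unfolding a_def by (intro emeasure_eq_ennreal_measure) auto
  have "a > 0" using False a by (metis ennreal_eq_0_iff not_le)
  have "emeasure M A = Sup (emeasure M ` {K. K \<subseteq> A \<and> compact K})"
  proof (rule inner_regular)
    show "sets M = sets borel" by (simp add: M_def)
    show "emeasure M (space M) \<noteq> \<infinity>" using M[of UNIV] A by (simp add: M_def)
  qed (rule A)
  \<comment> \<open>Strict even for e > a, because then \<open>ennreal (a - e)\<close> is 0 and a >
    0.\<close>
  moreover have "ennreal (a - e) < emeasure M A"
    using M[OF A(1)] a e \<open>a > 0\<close> by (simp add: ennreal_lessI)
  ultimately obtain K where K: "K \<subseteq> A" "compact K" "ennreal (a - e) < emeasure M K"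
    by (auto simp: less_SUP_iff)
  have Kb: "K \<in> sets borel" using K(2) by (rule borel_compact)
  have K_less: "ennreal (a - e) < emeasure lborel K"
    using K M[OF Kb] by (simp add: Int_absorb1)
  have Kf: "emeasure lborel K < \<infinity>"
    using emeasure_mono[of K A lborel] K(1) A by (simp add: order.strict_trans1)
  then have k: "emeasure lborel K = ennreal (measure lborel K)"
    by (intro emeasure_eq_ennreal_measure) auto
  have "a - e < measure lborel K"
    using K_less unfolding k by (meson ennreal_leI not_le)
  moreover have "emeasure lborel (A - K) = ennreal (a - measure lborel K)"
    using emeasure_Diff[of lborel K A] Kf Kb A K(1) by (simp add: a k flip: ennreal_minus)
  ultimately have "emeasure lborel (A - K) < ennreal e"
    using e by (simp add: ennreal_lessI)
  then show thesis using that K by blast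
qed

text \<open>Density of simple functions, in the form of the induction rule for integrable functions.
  An indicator of A is handled by a compact K and an open U with K <= A <= U: if |h| is below the
  distance from K to the complement of U, the indicators at x and x + h can differ only when one of
  the two points lies in the small set U - K.\<close>

lemma L1_translation_continuous:
  fixes f :: "'a::euclidean_space \<Rightarrow> real"
  assumes "integrable lborel f"
  shows "\<forall>e>0. \<exists>d>0. \<forall>h. norm h \<le> d \<longrightarrow> (LINT x|lborel. \<bar>f (x + h) - f x\<bar>) \<le> e"
  using assms
proof (induction rule: integrable_induct)
  case (base A c)
  show ?case
  proof (intro allI impI)
    fix e :: real assume "e > 0"
    \<comment> \<open>Chosen so that 2 |c| e' <= e; the + 1 covers c = 0.\<close>
    define e' where "e' = e / (2 * (\<bar>c\<bar> + 1))"
    have e': "e' > 0" using \<open>e > 0\<close> by (simp add: e'_def)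
    have A: "A \<in> sets borel" "emeasure lborel A < \<infinity>"
      using base by auto
    obtain U where U: "open U" "A \<subseteq> U" "emeasure lborel (U - A) < ennreal (e' / 2)"
      using outer_regular_lborel[OF A(1), of "e' / 2"] e' by auto
    obtain K where K: "compact K" "K \<subseteq> A" "emeasure lborel (A - K) < ennreal (e' / 2)"
      using lborel_inner_compact[OF A, of "e' / 2"] e' by auto
    have KU: "U - K \<in> sets borel" using U(1) K(1) by (simp add: borel_compact borel_open sets.Diff)
    have "emeasure lborel (U - K) = emeasure lborel ((U - A) \<union> (A - K))"
      using U(2) K(2) by (intro arg_cong[where f = "emeasure lborel"]) auto
    also have "\<dots> \<le> emeasure lborel (U - A) + emeasure lborel (A - K)"
      using A U K by (intro emeasure_subadditive) (auto simp: borel_compact borel_open sets.Diff)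
    also have "\<dots> \<le> ennreal (e' / 2) + ennreal (e' / 2)"
      using U K by (intro add_mono) auto
    also have "\<dots> = ennreal e'"
      using e' by (simp flip: ennreal_plus)
    finally have small: "emeasure lborel (U - K) \<le> ennreal e'" .
    then have fin: "emeasure lborel (U - K) < \<infinity>"
      using ennreal_less_top le_less_trans by (metis infinity_ennreal_def)
    have m: "measure lborel (U - K) \<le> e'"
      using small e' by (simp add: measure_def enn2real_leI)
    obtain d where d: "d > 0" "(\<Union>x\<in>K. ball x d) \<subseteq> U"
      using compact_subset_open_imp_ball_epsilon_subset[OF K(1) U(1)] K(2) U(2) by blast
    have intI: "integrable lborel (indicat_real (U - K))"
      using KU fin by (intro integrable_real_indicator) auto
    have intI': "integrable lborel (\<lambda>x. indicat_real (U - K) (x + h))" for h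
      by (rule lborel_integrable_translate[OF intI])
    show "\<exists>d>0. \<forall>h. norm h \<le> d \<longrightarrow>
        (LINT x|lborel. \<bar>indicat_real A (x + h) *\<^sub>R c - indicat_real A x *\<^sub>R c\<bar>) \<le> e"
    proof (intro exI[of _ "d / 2"] conjI allI impI)
      fix h :: 'a assume h: "norm h \<le> d / 2"
      have hK: "y + h \<in> U \<and> y - h \<in> U" if "y \<in> K" for y
      proof -
        have "y + h \<in> ball y d" "y - h \<in> ball y d" using h d(1) by (auto simp: dist_norm)
        then show ?thesis using d(2) that by blast
      qed
      have "(LINT x|lborel. \<bar>indicat_real A (x + h) *\<^sub>R c - indicat_real A x *\<^sub>R c\<bar>)
          \<le> (LINT x|lborel. \<bar>c\<bar> * (indicat_real (U - K) (x + h) + indicat_real (U - K) x))"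
      proof (rule integral_mono')
        show "integrable lborel (\<lambda>x. \<bar>c\<bar> * (indicat_real (U - K) (x + h) + indicat_real (U - K) x))"
          using intI intI' by auto
        fix x
        have "x + h \<in> K \<Longrightarrow> x \<in> U" "x \<in> K \<Longrightarrow> x + h \<in> U"
          using hK[of "x + h"] hK[of x] by auto
        then have "\<bar>indicat_real A (x + h) - indicat_real A x\<bar> \<le> indicat_real (U - K) (x + h) + indicat_real (U - K) x"
          using U(2) K(2) by (auto simp: indicator_def)
        then have "\<bar>indicat_real A (x + h) - indicat_real A x\<bar> * \<bar>c\<bar>
            \<le> (indicat_real (U - K) (x + h) + indicat_real (U - K) x) * \<bar>c\<bar>"
          by (rule mult_right_mono) simp
        moreover have "\<bar>indicat_real A (x + h) *\<^sub>R c - indicat_real A x *\<^sub>R c\<bar>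
            = \<bar>indicat_real A (x + h) - indicat_real A x\<bar> * \<bar>c\<bar>"
          unfolding real_scaleR_def left_diff_distrib[symmetric] abs_mult ..
        ultimately show "\<bar>indicat_real A (x + h) *\<^sub>R c - indicat_real A x *\<^sub>R c\<bar>
            \<le> \<bar>c\<bar> * (indicat_real (U - K) (x + h) + indicat_real (U - K) x)"
          by (simp only: mult.commute)
      qed auto
      also have "\<dots> = \<bar>c\<bar> * (2 * measure lborel (U - K))"
        using intI intI' KU fin by (simp add: lborel_integral_translate)
      also have "\<dots> \<le> \<bar>c\<bar> * (2 * e')"
        using m by (intro mult_left_mono) auto
      also have "\<dots> \<le> e" using \<open>e > 0\<close> by (simp add: e'_def field_simps)
      finally show "(LINT x|lborel. \<bar>indicat_real A (x + h) *\<^sub>R c - indicat_real A x *\<^sub>R c\<bar>) \<le> e" .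
    qed (use d in auto)
  qed
next
  case (add f g)
  show ?case
  proof (intro allI impI)
    fix e :: real assume "e > 0"
    then have "e / 2 > 0" by simp
    from add.IH(1)[rule_format, OF this] obtain d1 where d1: "d1 > 0"
      and 1: "\<And>h. norm h \<le> d1 \<Longrightarrow> (LINT x|lborel. \<bar>f (x + h) - f x\<bar>) \<le> e / 2" by auto
    from add.IH(2)[rule_format, OF \<open>e / 2 > 0\<close>] obtain d2 where d2: "d2 > 0"
      and 2: "\<And>h. norm h \<le> d2 \<Longrightarrow> (LINT x|lborel. \<bar>g (x + h) - g x\<bar>) \<le> e / 2" by auto
    show "\<exists>d>0. \<forall>h. norm h \<le> d \<longrightarrow> (LINT x|lborel. \<bar>f (x + h) + g (x + h) - (f x + g x)\<bar>) \<le> e"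
    proof (intro exI[of _ "min d1 d2"] conjI allI impI)
      fix h :: 'a assume h: "norm h \<le> min d1 d2"
      note int = lborel_integrable_translate[OF add.hyps(1), of h] lborel_integrable_translate[OF add.hyps(2), of h] add.hyps
      have "(LINT x|lborel. \<bar>f (x + h) + g (x + h) - (f x + g x)\<bar>)
          \<le> (LINT x|lborel. \<bar>f (x + h) - f x\<bar> + \<bar>g (x + h) - g x\<bar>)"
        using int by (intro integral_mono) auto
      also have "\<dots> = (LINT x|lborel. \<bar>f (x + h) - f x\<bar>) + (LINT x|lborel. \<bar>g (x + h) - g x\<bar>)"
        using int by (intro Bochner_Integration.integral_add) auto
      also have "\<dots> \<le> e" using 1[of h] 2[of h] h by auto
      finally show "(LINT x|lborel. \<bar>f (x + h) + g (x + h) - (f x + g x)\<bar>) \<le> e" .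
    qed (use d1 d2 in auto)
  qed
next
  case (lim f s)
  show ?case
  proof (intro allI impI)
    fix e :: real assume "e > 0"
    \<comment> \<open>The approximants satisfy |s i| <= 2 |f|, hence the majorant 3 |f|.\<close>
    have "(\<lambda>i. LINT x|lborel. \<bar>s i x - f x\<bar>) \<longlonglongrightarrow> (LINT x|(lborel :: 'a measure). 0)"
    proof (rule integral_dominated_convergence[where w = "\<lambda>x. 3 * \<bar>f x\<bar>"])
      show "AE x in lborel. (\<lambda>i. \<bar>s i x - f x\<bar>) \<longlonglongrightarrow> 0"
        using lim.hyps(2) by (auto intro!: AE_I2 tendsto_rabs_zero LIM_zero)
      show "AE x in lborel. norm \<bar>s i x - f x\<bar> \<le> 3 * \<bar>f x\<bar>" for i
      proof (rule AE_I2)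
        fix x show "norm \<bar>s i x - f x\<bar> \<le> 3 * \<bar>f x\<bar>" using lim.hyps(3)[of x i] by auto
      qed
    qed (use lim.hyps in \<open>auto intro: borel_measurable_integrable\<close>)
    then have "\<forall>\<^sub>F i in sequentially. (LINT x|lborel. \<bar>s i x - f x\<bar>) < e / 3"
      using \<open>e > 0\<close> by (intro order_tendstoD) auto
    then obtain i where i: "(LINT x|lborel. \<bar>s i x - f x\<bar>) < e / 3"
      by (meson eventually_sequentially order_refl)
    obtain d where d: "d > 0" "\<And>h. norm h \<le> d \<Longrightarrow> (LINT x|lborel. \<bar>s i (x + h) - s i x\<bar>) \<le> e / 3"
      using lim.IH[of i, rule_format, of "e / 3"] \<open>e > 0\<close> by auto
    show "\<exists>d>0. \<forall>h. norm h \<le> d \<longrightarrow> (LINT x|lborel. \<bar>f (x + h) - f x\<bar>) \<le> e"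
    proof (intro exI[of _ d] conjI allI impI)
      fix h :: 'a assume h: "norm h \<le> d"
      note int = lborel_integrable_translate[OF lim.hyps(1)[of i], of h] lborel_integrable_translate[OF lim.hyps(4), of h]
        lim.hyps(1)[of i] lim.hyps(4)
      have "(LINT x|lborel. \<bar>f (x + h) - f x\<bar>)
          \<le> (LINT x|lborel. (\<bar>s i (x + h) - f (x + h)\<bar> + \<bar>s i (x + h) - s i x\<bar>) + \<bar>s i x - f x\<bar>)"
        using int by (intro integral_mono) auto
      also have "\<dots> = (LINT x|lborel. \<bar>s i (x + h) - f (x + h)\<bar>) + (LINT x|lborel. \<bar>s i (x + h) - s i x\<bar>)
          + (LINT x|lborel. \<bar>s i x - f x\<bar>)"
        using int by (subst Bochner_Integration.integral_add, (auto)[2])+ simp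
      also have "(LINT x|lborel. \<bar>s i (x + h) - f (x + h)\<bar>) = (LINT x|lborel. \<bar>s i x - f x\<bar>)"
        by (rule lborel_integral_translate)
      finally show "(LINT x|lborel. \<bar>f (x + h) - f x\<bar>) \<le> e" using d(2)[OF h] i by linarith
    qed (use d in auto)
  qed
qed

section \<open>Mollifiers and the L^p error of mollification\<close>

definition bump :: "real \<Rightarrow> 'a::euclidean_space \<Rightarrow> real" where
  "bump \<delta> x = bump_kernel 0 (\<delta>\<^sup>2 - x \<bullet> x)"

definition mollifier :: "real \<Rightarrow> 'a::euclidean_space \<Rightarrow> real" where
  "mollifier \<delta> x = bump \<delta> x / (LINT y|lborel. bump \<delta> (y::'a))"

definition conv :: "('a::euclidean_space \<Rightarrow> real) \<Rightarrow> ('a \<Rightarrow> real) \<Rightarrow> 'a \<Rightarrow> real" where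
  "conv f \<eta> x = (LINT y|lborel. f y * \<eta> (x - y))"

text \<open>The argument \<delta>^2 - |x - z|^2 has exactly the form of the generator
  \<open>kernel\<close> of \<open>bump_algebra\<close>, and the normalisation enters as a constant
  factor.\<close>

lemma mollifier_translate_smooth:
  fixes z :: "'a::euclidean_space"
  shows "smooth_fun (\<lambda>x. mollifier \<delta> (x - z))"
  unfolding mollifier_def bump_def divide_inverse
  by (intro bump_algebra_smooth bump_algebra.intros)

lemma mollifier_smooth: "smooth_fun (mollifier \<delta>)"
  using mollifier_translate_smooth[of \<delta> 0] by simp

lemma bump_nonneg: "0 \<le> bump \<delta> x"
  by (simp add: bump_def bump_kernel_def)

lemma mollifier_nonneg: "0 \<le> mollifier \<delta> x"
  unfolding mollifier_def by (intro divide_nonneg_nonneg Bochner_Integration.integral_nonneg bump_nonneg)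

lemma bump_eq_0_iff:
  assumes "\<delta> > 0" shows "bump \<delta> x = 0 \<longleftrightarrow> \<delta> \<le> norm x"
proof -
  have "x \<bullet> x < \<delta>\<^sup>2 \<longleftrightarrow> norm x < \<delta>"
    unfolding power2_norm_eq_inner[symmetric] using assms power_mono_iff[of \<delta> "norm x" 2]
    by (simp flip: not_le)
  then show ?thesis by (auto simp: bump_def bump_kernel_def)
qed

lemma mollifier_eq_0: "\<delta> > 0 \<Longrightarrow> \<delta> \<le> norm x \<Longrightarrow> mollifier \<delta> x = 0"
  by (simp add: mollifier_def bump_eq_0_iff)

lemma mollifier_commute: "mollifier \<delta> (x - y) = mollifier \<delta> (y - x)"
  by (simp add: mollifier_def bump_def inner_diff_left inner_diff_right inner_commute algebra_simps)

lemma continuous_on_bump: "continuous_on S (bump \<delta>)"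
  using smooth_fun_continuous_on[OF bump_algebra_smooth[OF bump_algebra.kernel[of 0 "\<delta>\<^sup>2" 0]]]
  unfolding bump_def by simp

lemma continuous_on_mollifier: "continuous_on S (mollifier \<delta>)"
  unfolding mollifier_def divide_inverse by (intro continuous_intros continuous_on_bump)

lemma borel_measurable_mollifier [measurable]: "mollifier \<delta> \<in> borel_measurable borel"
  by (intro borel_measurable_continuous_onI continuous_on_mollifier)

lemma integrable_continuous_compact_support:
  fixes f :: "'a::euclidean_space \<Rightarrow> 'b::{banach, second_countable_topology}"
  assumes "continuous_on UNIV f" "compact S" "\<And>x. x \<notin> S \<Longrightarrow> f x = 0"
  shows "integrable lborel f"
proof -
  have "integrable lborel (\<lambda>x. indicator S x *\<^sub>R f x)"
    using assms borel_integrable_compact[of S f] continuous_on_subset by blast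
  also have "(\<lambda>x. indicator S x *\<^sub>R f x) = f"
    using assms(3) by (auto simp: indicator_def fun_eq_iff)
  finally show ?thesis .
qed

lemma integrable_bump: "\<delta> > 0 \<Longrightarrow> integrable lborel (bump \<delta> :: 'a::euclidean_space \<Rightarrow> real)"
  by (rule integrable_continuous_compact_support[of _ "cball 0 \<delta>"])
     (auto simp: continuous_on_bump bump_eq_0_iff)

text \<open>Otherwise the nonempty open ball on which \<open>bump\<close> is positive would be a
  null set.\<close>

lemma integral_bump_pos:
  assumes "\<delta> > 0" shows "(LINT x|lborel. bump \<delta> (x::'a::euclidean_space)) > 0"
proof -
  have "(LINT x|lborel. bump \<delta> (x::'a)) \<noteq> 0"
  proof
    assume "(LINT x|lborel. bump \<delta> (x::'a)) = 0"
    then have "AE x in lborel. bump \<delta> (x::'a) = 0"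
      using integral_nonneg_eq_0_iff_AE[OF integrable_bump[OF assms]] bump_nonneg by auto
    then have "ball 0 \<delta> \<in> null_sets (lborel :: 'a measure)"
      unfolding AE_iff_null_sets[of "ball 0 \<delta>" "lborel :: 'a measure", simplified]
      by (rule AE_mp) (simp add: bump_eq_0_iff[OF assms])
    then have "negligible (ball (0::'a) \<delta>)"
      unfolding negligible_iff_null_sets by (rule null_sets_completionI)
    then show False using assms open_not_negligible[of "ball (0::'a) \<delta>"] by simp
  qed
  moreover have "(LINT x|lborel. bump \<delta> (x::'a)) \<ge> 0" by (simp add: bump_nonneg)
  ultimately show ?thesis by linarith
qed

lemma integrable_mollifier: "\<delta> > 0 \<Longrightarrow> integrable lborel (mollifier \<delta> :: 'a::euclidean_space \<Rightarrow> real)"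
  unfolding mollifier_def divide_inverse by (intro integrable_mult_left integrable_bump)

lemma integral_mollifier: "\<delta> > 0 \<Longrightarrow> (LINT x|lborel. mollifier \<delta> (x::'a::euclidean_space)) = 1"
  unfolding mollifier_def using integral_bump_pos[of \<delta>, where ?'a = 'a] by simp

lemma mollifier_bounded:
  assumes "\<delta> > 0" shows "\<exists>C. \<forall>x::'a::euclidean_space. \<bar>mollifier \<delta> x\<bar> \<le> C"
proof -
  have "compact (mollifier \<delta> ` cball (0::'a) \<delta>)"
    by (intro compact_continuous_image continuous_on_mollifier) auto
  then obtain C where C: "\<forall>x\<in>cball 0 \<delta>. \<bar>mollifier \<delta> (x::'a)\<bar> \<le> C"
    by (auto dest!: compact_imp_bounded simp: bounded_iff)
  have "\<bar>mollifier \<delta> x\<bar> \<le> max C 0" for x :: 'a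
  proof (cases "norm x \<le> \<delta>")
    case True
    then have "\<bar>mollifier \<delta> x\<bar> \<le> C" using C by simp
    then show ?thesis by simp
  next
    case False
    then show ?thesis using mollifier_eq_0[OF assms, of x] by simp
  qed
  then show ?thesis by blast
qed

lemma integrable_mult_bounded:
  fixes f :: "'a \<Rightarrow> 'b::{banach, second_countable_topology, real_normed_vector}"
  assumes "integrable M f" "g \<in> borel_measurable M" "\<And>x. \<bar>g x\<bar> \<le> C"
  shows "integrable M (\<lambda>x. g x *\<^sub>R f x)"
proof (rule Bochner_Integration.integrable_bound[where f = "\<lambda>x. C *\<^sub>R norm (f x)"])
  show "AE x in M. norm (g x *\<^sub>R f x) \<le> norm (C *\<^sub>R norm (f x))"
  proof (rule AE_I2)
    fix x show "norm (g x *\<^sub>R f x) \<le> norm (C *\<^sub>R norm (f x))"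
      using assms(3)[of x] by (auto intro!: mult_right_mono)
  qed
qed (use assms in \<open>auto intro: borel_measurable_integrable\<close>)

lemma borel_measurable_conv [measurable]:
  assumes [measurable]: "f \<in> borel_measurable borel" "\<eta> \<in> borel_measurable borel"
  shows "conv f \<eta> \<in> borel_measurable borel"
  unfolding conv_def[abs_def] by measurable

text \<open>Jensen's inequality for the power function: with \<open>c\<close> the mean of \<open>g\<close>, integrate Young's
  inequality \<open>c powr (p - 1) * g \<le> (1 - 1 / p) * c powr p + g powr p / p\<close>.\<close>

lemma integral_powr_le:
  fixes g \<rho> :: "'a \<Rightarrow> real"
  assumes p: "1 \<le> p" and \<rho>: "integrable M \<rho>" "(\<integral>x. \<rho> x \<partial>M) = 1" "\<And>x. 0 \<le> \<rho> x"
    and g: "integrable M (\<lambda>x. \<rho> x * g x)" "\<And>x. 0 \<le> g x" and [measurable]: "g \<in> borel_measurable M"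
  shows "ennreal ((\<integral>x. \<rho> x * g x \<partial>M) powr p) \<le> (\<integral>\<^sup>+x. ennreal (\<rho> x * g x powr p) \<partial>M)"
proof (cases "(\<integral>\<^sup>+x. ennreal (\<rho> x * g x powr p) \<partial>M) = \<infinity>")
  case False
  have [measurable]: "\<rho> \<in> borel_measurable M" using \<rho>(1) by auto
  have int: "integrable M (\<lambda>x. \<rho> x * g x powr p)"
    using False \<rho>(3) by (intro integrableI_nonneg) (auto simp: top.not_eq_extremum)
  define c where "c = (\<integral>x. \<rho> x * g x \<partial>M)"
  have c: "0 \<le> c" unfolding c_def using \<rho>(3) g(2) by simp
  have "c powr p = c powr (p - 1) * c"
    using c by (cases "c = 0") (auto simp: powr_diff)
  also have "\<dots> = (\<integral>x. \<rho> x * (c powr (p - 1) * g x) \<partial>M)"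
    unfolding c_def by (subst integral_mult_right_zero[symmetric]) (simp add: mult_ac)
  also have "\<dots> \<le> (\<integral>x. \<rho> x * ((1 - 1 / p) * c powr p) + (\<rho> x * g x powr p) / p \<partial>M)"
  proof (rule integral_mono)
    show "integrable M (\<lambda>x. \<rho> x * (c powr (p - 1) * g x))"
      using integrable_mult_right[OF g(1), of "c powr (p - 1)"] by (simp add: mult_ac)
    show "integrable M (\<lambda>x. \<rho> x * ((1 - 1 / p) * c powr p) + \<rho> x * g x powr p / p)"
      using \<rho>(1) int by (intro Bochner_Integration.integrable_add integrable_mult_left integrable_divide) auto
    fix x
    have "\<rho> x * (c powr (p - 1) * g x) \<le> \<rho> x * ((1 - 1 / p) * c powr p + g x powr p / p)"
      using \<rho>(3) Youngs_powr[OF p c g(2)] by (intro mult_left_mono) auto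
    then show "\<rho> x * (c powr (p - 1) * g x) \<le> \<rho> x * ((1 - 1 / p) * c powr p) + \<rho> x * g x powr p / p"
      by (simp add: distrib_left)
  qed
  also have "\<dots> = (1 - 1 / p) * c powr p + (\<integral>x. \<rho> x * g x powr p \<partial>M) / p"
    using \<rho> int by (subst Bochner_Integration.integral_add) auto
  finally have "c powr p \<le> (\<integral>x. \<rho> x * g x powr p \<partial>M)"
    using p by (simp add: field_simps)
  also have "ennreal \<dots> = (\<integral>\<^sup>+x. ennreal (\<rho> x * g x powr p) \<partial>M)"
    using int \<rho>(3) by (intro nn_integral_eq_integral[symmetric]) auto
  finally show ?thesis using ennreal_leI by (simp add: c_def)
qed simp

text \<open>Reduced to the case \<open>p = 1\<close> for \<open>F = sgn f * \<bar>f\<bar> powr p\<close> by \<open>powr_dist_le\<close>.\<close>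

lemma Lp_translation_continuous:
  fixes f :: "'a::euclidean_space \<Rightarrow> real"
  assumes p: "1 \<le> p" and [measurable]: "f \<in> borel_measurable borel"
    and int: "integrable lborel (\<lambda>x. \<bar>f x\<bar> powr p)" and e: "e > 0"
  shows "\<exists>d>0. \<forall>h. norm h \<le> d \<longrightarrow> (\<integral>\<^sup>+x. ennreal (\<bar>f (x + h) - f x\<bar> powr p) \<partial>lborel) \<le> ennreal e"
proof -
  define F where "F x = sgn (f x) * \<bar>f x\<bar> powr p" for x
  have [measurable]: "F \<in> borel_measurable borel" unfolding F_def[abs_def] by measurable
  have F: "integrable lborel F"
    by (rule Bochner_Integration.integrable_bound[OF int]) (auto simp: F_def abs_mult sgn_if)
  obtain d where d: "d > 0" "\<And>h. norm h \<le> d \<Longrightarrow> (LINT x|lborel. \<bar>F (x + h) - F x\<bar>) \<le> e / 2 powr p"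
    using L1_translation_continuous[OF F, rule_format, of "e / 2 powr p"] e by auto
  show ?thesis
  proof (intro exI[of _ d] conjI allI impI)
    fix h :: 'a assume h: "norm h \<le> d"
    have iF: "integrable lborel (\<lambda>x. 2 powr p * \<bar>F (x + h) - F x\<bar>)"
      using F lborel_integrable_translate[OF F, of h] by auto
    have "(\<integral>\<^sup>+x. ennreal (\<bar>f (x + h) - f x\<bar> powr p) \<partial>lborel) \<le> (\<integral>\<^sup>+x. ennreal (2 powr p * \<bar>F (x + h) - F x\<bar>) \<partial>lborel)"
      unfolding F_def by (intro nn_integral_mono ennreal_leI powr_dist_le p)
    also have "\<dots> = ennreal (LINT x|lborel. 2 powr p * \<bar>F (x + h) - F x\<bar>)"
      using iF by (intro nn_integral_eq_integral) auto
    also have "\<dots> \<le> ennreal e"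
      using d(2)[OF h] by (intro ennreal_leI) (simp add: field_simps)
    finally show "(\<integral>\<^sup>+x. ennreal (\<bar>f (x + h) - f x\<bar> powr p) \<partial>lborel) \<le> ennreal e" .
  qed (rule d(1))
qed

text \<open>The hypothesis on shifts bounds the L^p modulus of continuity of f at scale \<delta>.
  The difference conv f - f is an average of f y - f x against a probability density; Jensen's
  inequality moves the power inside, and after the substitution y = x + h and Fubini the inner
  integral is that modulus. With nonnegative integrals the estimate itself yields
  finiteness.\<close>

lemma conv_mollifier_dist_le:
  fixes f :: "'a::euclidean_space \<Rightarrow> real"
  assumes p: "1 \<le> p" and [measurable]: "f \<in> borel_measurable borel" and f: "integrable lborel f"
    and \<delta>: "\<delta> > 0"
    and h: "\<And>h. norm h \<le> \<delta> \<Longrightarrow> (\<integral>\<^sup>+x. ennreal (\<bar>f (x + h) - f x\<bar> powr p) \<partial>lborel) \<le> ennreal e"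
  shows "(\<integral>\<^sup>+x. ennreal (\<bar>conv f (mollifier \<delta>) x - f x\<bar> powr p) \<partial>lborel) \<le> ennreal e"
proof -
  obtain C where C: "\<And>x::'a. \<bar>mollifier \<delta> x\<bar> \<le> C" using mollifier_bounded[OF \<delta>] by blast
  have \<rho>: "integrable lborel (\<lambda>y. mollifier \<delta> (y - x))" "(LINT y|lborel. mollifier \<delta> (y - x)) = 1" for x :: 'a
    using lborel_integrable_translate[OF integrable_mollifier[OF \<delta>], of "- x"]
      lborel_integral_translate[of "mollifier \<delta>" "- x"] integral_mollifier[OF \<delta>, where ?'a = 'a] by auto
  have fy: "integrable lborel (\<lambda>y. mollifier \<delta> (y - x) * f y)" for x
    using integrable_mult_bounded[OF f, of "\<lambda>y. mollifier \<delta> (y - x)" C] C by simp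
  have pt: "ennreal (\<bar>conv f (mollifier \<delta>) x - f x\<bar> powr p)
      \<le> (\<integral>\<^sup>+y. ennreal (mollifier \<delta> (y - x) * \<bar>f y - f x\<bar> powr p) \<partial>lborel)" for x
  proof -
    have i: "integrable lborel (\<lambda>y. mollifier \<delta> (y - x) * (f y - f x))"
      using fy \<rho>(1) by (simp add: right_diff_distrib)
    then have i': "integrable lborel (\<lambda>y. mollifier \<delta> (y - x) * \<bar>f y - f x\<bar>)"
      using integrable_abs[OF i] mollifier_nonneg[of \<delta>] by (simp add: abs_mult abs_of_nonneg[OF mollifier_nonneg])
    have "conv f (mollifier \<delta>) x - f x = (LINT y|lborel. mollifier \<delta> (y - x) * (f y - f x))"
    proof -
      have "conv f (mollifier \<delta>) x = (LINT y|lborel. mollifier \<delta> (y - x) * f y)"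
        by (simp add: conv_def mollifier_commute[of \<delta> x] mult.commute)
      moreover have "(LINT y|lborel. mollifier \<delta> (y - x) * f x) = f x"
        using \<rho> by simp
      ultimately show ?thesis
        using fy \<rho>(1) by (simp add: right_diff_distrib)
    qed
    also have "\<bar>\<dots>\<bar> \<le> (LINT y|lborel. \<bar>mollifier \<delta> (y - x) * (f y - f x)\<bar>)"
      by (rule integral_abs_bound)
    also have "\<dots> = (LINT y|lborel. mollifier \<delta> (y - x) * \<bar>f y - f x\<bar>)"
      by (simp add: abs_mult abs_of_nonneg[OF mollifier_nonneg])
    finally have "\<bar>conv f (mollifier \<delta>) x - f x\<bar> powr p \<le> \<dots> powr p"
      using p by (intro powr_mono2) auto
    also have "ennreal \<dots> \<le> (\<integral>\<^sup>+y. ennreal (mollifier \<delta> (y - x) * \<bar>f y - f x\<bar> powr p) \<partial>lborel)"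
      using p \<rho> mollifier_nonneg i' by (intro integral_powr_le) auto
    finally show ?thesis by (simp add: ennreal_leI)
  qed
  have "(\<integral>\<^sup>+x. ennreal (\<bar>conv f (mollifier \<delta>) x - f x\<bar> powr p) \<partial>lborel)
      \<le> (\<integral>\<^sup>+x. \<integral>\<^sup>+y. ennreal (mollifier \<delta> (y - x) * \<bar>f y - f x\<bar> powr p) \<partial>lborel \<partial>lborel)"
    by (intro nn_integral_mono pt)
  also have "\<dots> = (\<integral>\<^sup>+x. \<integral>\<^sup>+h. ennreal (mollifier \<delta> h * \<bar>f (x + h) - f x\<bar> powr p) \<partial>lborel \<partial>lborel)"
  proof (rule nn_integral_cong)
    fix x
    show "(\<integral>\<^sup>+y. ennreal (mollifier \<delta> (y - x) * \<bar>f y - f x\<bar> powr p) \<partial>lborel)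
        = (\<integral>\<^sup>+h. ennreal (mollifier \<delta> h * \<bar>f (x + h) - f x\<bar> powr p) \<partial>lborel)"
      using lborel_nn_integral_translate[of "\<lambda>y. ennreal (mollifier \<delta> (y - x) * \<bar>f y - f x\<bar> powr p)" x]
      by (simp add: add.commute)
  qed
  also have "\<dots> = (\<integral>\<^sup>+h. \<integral>\<^sup>+x. ennreal (mollifier \<delta> h * \<bar>f (x + h) - f x\<bar> powr p) \<partial>lborel \<partial>lborel)"
    by (rule lborel_pair.Fubini'[symmetric]) measurable
  also have "\<dots> = (\<integral>\<^sup>+h. ennreal (mollifier \<delta> h) * (\<integral>\<^sup>+x. ennreal (\<bar>f (x + h) - f x\<bar> powr p) \<partial>lborel) \<partial>lborel)"
    by (intro nn_integral_cong) (simp add: ennreal_mult' mollifier_nonneg nn_integral_cmult)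
  also have "\<dots> \<le> (\<integral>\<^sup>+h. ennreal (mollifier \<delta> (h::'a)) * ennreal e \<partial>lborel)"
  proof (intro nn_integral_mono)
    fix k :: 'a
    show "ennreal (mollifier \<delta> k) * (\<integral>\<^sup>+x. ennreal (\<bar>f (x + k) - f x\<bar> powr p) \<partial>lborel)
        \<le> ennreal (mollifier \<delta> k) * ennreal e"
      using h[of k] mollifier_eq_0[OF \<delta>, of k] by (cases "norm k \<le> \<delta>") (auto intro: mult_left_mono)
  qed
  also have "\<dots> = (\<integral>\<^sup>+h. ennreal (mollifier \<delta> (h::'a)) \<partial>lborel) * ennreal e"
    by (rule nn_integral_multc) measurable
  also have "(\<integral>\<^sup>+h. ennreal (mollifier \<delta> (h::'a)) \<partial>lborel) = 1"
    using integral_mollifier[OF \<delta>, where ?'a = 'a] integrable_mollifier[OF \<delta>, where ?'a = 'a] mollifier_nonneg[of \<delta>]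
    by (subst nn_integral_eq_integral) auto
  finally show ?thesis by simp
qed

section \<open>Convergence in the mean\<close>

text \<open>Whole-space counterpart of \<open>in_Lp\<close> for Borel functions. Functions on the
  domain will be extended by 0, so that translations and convolutions act without reference to a
  domain.\<close>

definition Lp :: "real \<Rightarrow> ('a::euclidean_space \<Rightarrow> 'b::euclidean_space) \<Rightarrow> bool" where
  "Lp r X \<longleftrightarrow> X \<in> borel_measurable borel \<and> integrable lborel (\<lambda>x. norm (X x) powr r)"

text \<open>The r-th power of the distance, without the root: estimates then rest on (x + y)^r <=
  2^r (x^r + y^r) instead of the triangle inequality of the norm.\<close>

definition Lp_converges :: "real \<Rightarrow> (nat \<Rightarrow> 'a::euclidean_space \<Rightarrow> 'b::euclidean_space) \<Rightarrow> ('a \<Rightarrow> 'b) \<Rightarrow> bool" where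
  "Lp_converges r Xs X \<longleftrightarrow> (\<forall>n. Lp r (Xs n)) \<and> Lp r X \<and>
     (\<lambda>n. LINT x|lborel. norm (Xs n x - X x) powr r) \<longlonglongrightarrow> 0"

lemma Lp_measurable [measurable_dest]: "Lp r X \<Longrightarrow> X \<in> borel_measurable borel"
  by (simp add: Lp_def)

lemma Lp_integrable: "Lp r X \<Longrightarrow> integrable lborel (\<lambda>x. norm (X x) powr r)"
  by (simp add: Lp_def)

lemma Lp_bound:
  assumes "X \<in> borel_measurable borel" "integrable lborel g" "\<And>x. norm (X x) powr r \<le> g x"
  shows "Lp r X"
  unfolding Lp_def
proof
  have [measurable]: "X \<in> borel_measurable borel" by fact
  show "integrable lborel (\<lambda>x. norm (X x) powr r)"
    by (rule Bochner_Integration.integrable_bound[OF assms(2)])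
       (auto intro!: AE_I2 order_trans[OF assms(3)])
qed fact

lemma Lp_norm_le:
  fixes X :: "'a::euclidean_space \<Rightarrow> 'b::euclidean_space" and Y :: "'a \<Rightarrow> 'c::euclidean_space"
  assumes "Lp r Y" "0 \<le> r" "X \<in> borel_measurable borel" "\<And>x. norm (X x) \<le> C * norm (Y x)"
  shows "Lp r X"
proof (rule Lp_bound[where g = "\<lambda>x. \<bar>C\<bar> powr r * norm (Y x) powr r"])
  fix x
  have "norm (X x) \<le> \<bar>C\<bar> * norm (Y x)"
    using assms(4)[of x] by (meson abs_ge_self mult_right_mono norm_ge_zero order_trans)
  then have "norm (X x) powr r \<le> (\<bar>C\<bar> * norm (Y x)) powr r"
    using assms(2) by (intro powr_mono2) auto
  then show "norm (X x) powr r \<le> \<bar>C\<bar> powr r * norm (Y x) powr r"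
    by (simp add: powr_mult)
qed (use assms Lp_integrable in auto)

lemma norm_add_powr_le:
  fixes x y :: "'a::real_normed_vector"
  assumes "0 \<le> r"
  shows "norm (x + y) powr r \<le> 2 powr r * (norm x powr r + norm y powr r)"
proof -
  have "norm (x + y) powr r \<le> (norm x + norm y) powr r"
    using assms by (intro powr_mono2 norm_triangle_ineq) auto
  also have "\<dots> \<le> 2 powr r * (norm x powr r + norm y powr r)"
    using assms by (intro powr_sum_le) auto
  finally show ?thesis .
qed

lemma Lp_add:
  assumes "Lp r X" "Lp r Y" "0 \<le> r"
  shows "Lp r (\<lambda>x. X x + Y x)"
proof (rule Lp_bound[where g = "\<lambda>x. 2 powr r * (norm (X x) powr r + norm (Y x) powr r)"])
  show "(\<lambda>x. X x + Y x) \<in> borel_measurable borel"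
    using assms(1,2)[THEN Lp_measurable] by measurable
  show "integrable lborel (\<lambda>x. 2 powr r * (norm (X x) powr r + norm (Y x) powr r))"
    using assms(1,2)[THEN Lp_integrable] by auto
qed (rule norm_add_powr_le[OF assms(3)])

lemma Lp_scaleR:
  assumes "Lp r X" "0 \<le> r" "c \<in> borel_measurable borel" "\<And>x. \<bar>c x\<bar> \<le> C"
  shows "Lp r (\<lambda>x. c x *\<^sub>R X x)"
proof (rule Lp_norm_le[OF assms(1,2), where C = C])
  have [measurable]: "X \<in> borel_measurable borel" "c \<in> borel_measurable borel"
    using assms Lp_measurable by auto
  show "(\<lambda>x. c x *\<^sub>R X x) \<in> borel_measurable borel" by measurable
  show "norm (c x *\<^sub>R X x) \<le> C * norm (X x)" for x
    using assms(4)[of x] by (simp add: mult_right_mono)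
qed

lemma Lp_zero: "Lp r (\<lambda>x. 0)"
  by (simp add: Lp_def)

lemma Lp_diff:
  assumes "Lp r X" "Lp r Y" "0 \<le> r"
  shows "Lp r (\<lambda>x. X x - Y x)"
  using Lp_add[OF assms(1) Lp_scaleR[OF assms(2,3), of "\<lambda>_. - 1" 1] assms(3)] by simp

text \<open>Membership of \<open>Xs n\<close> is derived: it is \<open>X\<close> plus an error whose
  r-th power has an integrable majorant.\<close>

lemma Lp_convergesI:
  assumes "Lp r X" "0 \<le> r" "\<And>n. Xs n \<in> borel_measurable borel"
    and g: "\<And>n. integrable lborel (g n)" "(\<lambda>n. LINT x|lborel. g n x) \<longlonglongrightarrow> 0"
    and le: "\<And>n x. norm (Xs n x - X x) powr r \<le> g n x"
  shows "Lp_converges r Xs X"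
proof -
  have [measurable]: "X \<in> borel_measurable borel" "\<And>n. Xs n \<in> borel_measurable borel"
    using assms Lp_measurable by auto
  have d: "Lp r (\<lambda>x. Xs n x - X x)" for n
    by (rule Lp_bound[OF _ g(1) le]) measurable
  have "Lp r (\<lambda>x. (Xs n x - X x) + X x)" for n
    by (intro Lp_add d assms)
  moreover have "(\<lambda>n. LINT x|lborel. norm (Xs n x - X x) powr r) \<longlonglongrightarrow> 0"
  proof (rule tendsto_sandwich[OF _ _ tendsto_const g(2)])
    show "\<forall>\<^sub>F n in sequentially. (LINT x|lborel. norm (Xs n x - X x) powr r) \<le> (LINT x|lborel. g n x)"
      using Lp_integrable[OF d] g(1) le by (intro always_eventually allI integral_mono) auto
  qed auto
  ultimately show ?thesis
    using assms(1) by (simp add: Lp_converges_def)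
qed

lemma Lp_converges_norm_le:
  fixes Xs :: "nat \<Rightarrow> 'a::euclidean_space \<Rightarrow> 'b::euclidean_space" and Ys :: "nat \<Rightarrow> 'a \<Rightarrow> 'c::euclidean_space"
  assumes "Lp_converges r Ys Y" "Lp r X" "0 \<le> r" "\<And>n. Xs n \<in> borel_measurable borel"
    and le: "\<And>n x. norm (Xs n x - X x) \<le> C * norm (Ys n x - Y x)"
  shows "Lp_converges r Xs X"
proof (rule Lp_convergesI[where g = "\<lambda>n x. \<bar>C\<bar> powr r * norm (Ys n x - Y x) powr r"])
  have "Lp r (\<lambda>x. Ys n x - Y x)" for n
    using assms by (intro Lp_diff) (auto simp: Lp_converges_def)
  then show "integrable lborel (\<lambda>x. \<bar>C\<bar> powr r * norm (Ys n x - Y x) powr r)" for n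
    using Lp_integrable by auto
  show "(\<lambda>n. LINT x|lborel. \<bar>C\<bar> powr r * norm (Ys n x - Y x) powr r) \<longlonglongrightarrow> 0"
    using assms(1) tendsto_mult_right_zero by (auto simp: Lp_converges_def)
  fix n x
  have "norm (Xs n x - X x) \<le> \<bar>C\<bar> * norm (Ys n x - Y x)"
    using le[of n x] by (meson abs_ge_self mult_right_mono norm_ge_zero order_trans)
  then have "norm (Xs n x - X x) powr r \<le> (\<bar>C\<bar> * norm (Ys n x - Y x)) powr r"
    using assms by (intro powr_mono2) auto
  then show "norm (Xs n x - X x) powr r \<le> \<bar>C\<bar> powr r * norm (Ys n x - Y x) powr r"
    by (simp add: powr_mult)
qed (use assms in auto)

lemma Lp_converges_add:
  assumes "Lp_converges r Xs X" "Lp_converges r Ys Y" "0 \<le> r"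
  shows "Lp_converges r (\<lambda>n x. Xs n x + Ys n x) (\<lambda>x. X x + Y x)"
proof (rule Lp_convergesI[where g = "\<lambda>n x. 2 powr r * (norm (Xs n x - X x) powr r + norm (Ys n x - Y x) powr r)"])
  have d: "Lp r (\<lambda>x. Xs n x - X x)" "Lp r (\<lambda>x. Ys n x - Y x)" for n
    using assms by (auto intro!: Lp_diff simp: Lp_converges_def)
  show "integrable lborel (\<lambda>x. 2 powr r * (norm (Xs n x - X x) powr r + norm (Ys n x - Y x) powr r))" for n
    using d[THEN Lp_integrable] by auto
  have "(\<lambda>n. 2 powr r * ((LINT x|lborel. norm (Xs n x - X x) powr r) + (LINT x|lborel. norm (Ys n x - Y x) powr r)))
      \<longlonglongrightarrow> 2 powr r * (0 + 0)"
    using assms by (intro tendsto_intros) (auto simp: Lp_converges_def)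
  then show "(\<lambda>n. LINT x|lborel. 2 powr r * (norm (Xs n x - X x) powr r + norm (Ys n x - Y x) powr r)) \<longlonglongrightarrow> 0"
    using d[THEN Lp_integrable] by simp
  show "norm (Xs n x + Ys n x - (X x + Y x)) powr r \<le> 2 powr r * (norm (Xs n x - X x) powr r + norm (Ys n x - Y x) powr r)" for n x
    using norm_add_powr_le[OF assms(3), of "Xs n x - X x" "Ys n x - Y x"] by (simp add: algebra_simps)
  show "(\<lambda>x. Xs n x + Ys n x) \<in> borel_measurable borel" for n
    using assms by (auto simp: Lp_converges_def intro!: Lp_measurable Lp_add)
qed (use assms in \<open>auto simp: Lp_converges_def intro: Lp_add\<close>)

lemma Lp_converges_const: "Lp r X \<Longrightarrow> Lp_converges r (\<lambda>n. X) X"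
  by (simp add: Lp_converges_def)

lemma Lp_converges_sum:
  assumes "finite I" "\<And>i. i \<in> I \<Longrightarrow> Lp_converges r (\<lambda>n. Xs n i) (X i)" "0 \<le> r"
  shows "Lp_converges r (\<lambda>n x. \<Sum>i\<in>I. Xs n i x) (\<lambda>x. \<Sum>i\<in>I. X i x)"
  using assms(1,2)
proof (induction I rule: finite_induct)
  case empty
  then show ?case by (simp add: Lp_converges_const Lp_zero)
next
  case (insert i I)
  then have "Lp_converges r (\<lambda>n x. Xs n i x + (\<Sum>i\<in>I. Xs n i x)) (\<lambda>x. X i x + (\<Sum>i\<in>I. X i x))"
    by (intro Lp_converges_add assms(3)) auto
  with insert show ?case by simp
qed

lemma Lp_converges_subseq: "Lp_converges r Xs X \<Longrightarrow> strict_mono \<sigma> \<Longrightarrow> Lp_converges r (\<lambda>n. Xs (\<sigma> n)) X"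
  unfolding Lp_converges_def using LIMSEQ_subseq_LIMSEQ[of "\<lambda>n. LINT x|lborel. norm (Xs n x - X x) powr r" 0 \<sigma>]
  by (simp add: o_def)

lemma Lp_converges_AE_subseq:
  assumes "Lp_converges r Xs X" "0 < r"
  obtains \<sigma> where "strict_mono \<sigma>" "AE x in lborel. (\<lambda>n. Xs (\<sigma> n) x) \<longlonglongrightarrow> X x"
proof -
  have d: "Lp r (\<lambda>x. Xs n x - X x)" for n
    using assms by (auto intro!: Lp_diff simp: Lp_converges_def)
  have "\<exists>\<sigma>::nat\<Rightarrow>nat. strict_mono \<sigma> \<and> (AE x in lborel. (\<lambda>n. norm (Xs (\<sigma> n) x - X x) powr r) \<longlonglongrightarrow> 0)"
    using assms(1) Lp_integrable[OF d] by (intro tendsto_L1_AE_subseq) (auto simp: Lp_converges_def)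
  then obtain \<sigma> :: "nat \<Rightarrow> nat" where \<sigma>: "strict_mono \<sigma>"
    "AE x in lborel. (\<lambda>n. norm (Xs (\<sigma> n) x - X x) powr r) \<longlonglongrightarrow> 0" by blast
  have "AE x in lborel. (\<lambda>n. Xs (\<sigma> n) x) \<longlonglongrightarrow> X x"
    using \<sigma>(2)
  proof eventually_elim
    case (elim x)
    have "(\<lambda>n. (norm (Xs (\<sigma> n) x - X x) powr r) powr (1 / r)) \<longlonglongrightarrow> 0"
      using tendsto_zero_powrI[OF elim, of "\<lambda>_. 1 / r" "1 / r"] assms(2) by auto
    then have "(\<lambda>n. norm (Xs (\<sigma> n) x - X x)) \<longlonglongrightarrow> 0"
      using assms(2) by (simp add: powr_powr)
    then show ?case by (rule LIM_zero_cancel[OF tendsto_norm_zero_cancel])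
  qed
  with \<sigma>(1) that show thesis by blast
qed

text \<open>Split cs n Xs n - c X into cs n (Xs n - X), small since the coefficients are bounded,
  and (cs n - c) X, small by dominated convergence. In the chain rule the coefficients are partial
  derivatives, which converge only almost everywhere.\<close>

lemma Lp_converges_scaleR:
  assumes X: "Lp_converges r Xs X" and r: "0 < r"
    and [measurable]: "\<And>n. cs n \<in> borel_measurable borel" "c \<in> borel_measurable borel"
    and C: "\<And>n x. \<bar>cs n x\<bar> \<le> C" "\<And>x. \<bar>c x\<bar> \<le> C"
    and lim: "AE x in lborel. (\<lambda>n. cs n x) \<longlonglongrightarrow> c x"
  shows "Lp_converges r (\<lambda>n x. cs n x *\<^sub>R Xs n x) (\<lambda>x. c x *\<^sub>R X x)"
proof (rule Lp_convergesI[where g = "\<lambda>n x. 2 powr r * (C powr r * norm (Xs n x - X x) powr r + \<bar>cs n x - c x\<bar> powr r * norm (X x) powr r)"])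
  have X': "Lp r X" "\<And>n. Lp r (Xs n)" using X by (auto simp: Lp_converges_def)
  note [measurable] = Lp_measurable[OF X'(1)] Lp_measurable[OF X'(2)]
  have "0 \<le> C" using C(2)[of undefined] by linarith
  have d: "Lp r (\<lambda>x. Xs n x - X x)" for n
    using X' r by (auto intro!: Lp_diff)
  have bd: "\<bar>cs n x - c x\<bar> powr r * norm (X x) powr r \<le> (2 * C) powr r * norm (X x) powr r" for n x
    using C(1)[of n x] C(2)[of x] r by (intro mult_right_mono powr_mono2) auto
  have i: "integrable lborel (\<lambda>x. (2 * C) powr r * norm (X x) powr r)"
    using Lp_integrable[OF X'(1)] by auto
  have i2: "integrable lborel (\<lambda>x. \<bar>cs n x - c x\<bar> powr r * norm (X x) powr r)" for n
    by (rule Bochner_Integration.integrable_bound[OF i]) (use bd in \<open>auto\<close>)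
  show "integrable lborel (\<lambda>x. 2 powr r * (C powr r * norm (Xs n x - X x) powr r + \<bar>cs n x - c x\<bar> powr r * norm (X x) powr r))" for n
    using i2 Lp_integrable[OF d] by auto
  have "(\<lambda>n. LINT x|lborel. \<bar>cs n x - c x\<bar> powr r * norm (X x) powr r) \<longlonglongrightarrow> (LINT x|(lborel :: 'a measure). 0)"
  proof (rule integral_dominated_convergence[OF _ _ i])
    show "AE x in lborel. (\<lambda>n. \<bar>cs n x - c x\<bar> powr r * norm (X x) powr r) \<longlonglongrightarrow> 0"
      using lim
    proof eventually_elim
      case (elim x)
      then have "(\<lambda>n. \<bar>cs n x - c x\<bar>) \<longlonglongrightarrow> 0" by (intro tendsto_rabs_zero LIM_zero)
      then have "(\<lambda>n. \<bar>cs n x - c x\<bar> powr r) \<longlonglongrightarrow> 0"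
        using r by (intro tendsto_zero_powrI[of _ _ "\<lambda>_. r" r]) auto
      then show ?case by (rule tendsto_mult_left_zero)
    qed
  qed (use bd in auto)
  then have "(\<lambda>n. 2 powr r * (C powr r * (LINT x|lborel. norm (Xs n x - X x) powr r)
      + (LINT x|lborel. \<bar>cs n x - c x\<bar> powr r * norm (X x) powr r))) \<longlonglongrightarrow> 2 powr r * (C powr r * 0 + 0)"
    using X by (intro tendsto_intros) (auto simp: Lp_converges_def)
  then show "(\<lambda>n. LINT x|lborel. 2 powr r * (C powr r * norm (Xs n x - X x) powr r + \<bar>cs n x - c x\<bar> powr r * norm (X x) powr r)) \<longlonglongrightarrow> 0"
    using i2 Lp_integrable[OF d] by simp
  fix n x
  have "norm (cs n x *\<^sub>R Xs n x - c x *\<^sub>R X x) powr r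
      = norm (cs n x *\<^sub>R (Xs n x - X x) + (cs n x - c x) *\<^sub>R X x) powr r"
    by (simp add: algebra_simps)
  also have "\<dots> \<le> 2 powr r * (norm (cs n x *\<^sub>R (Xs n x - X x)) powr r + norm ((cs n x - c x) *\<^sub>R X x) powr r)"
    using r by (intro norm_add_powr_le) auto
  also have "\<dots> \<le> 2 powr r * (C powr r * norm (Xs n x - X x) powr r + \<bar>cs n x - c x\<bar> powr r * norm (X x) powr r)"
    using C(1)[of n x] r
    by (intro mult_left_mono add_mono) (auto simp: powr_mult intro!: mult_right_mono powr_mono2)
  finally show "norm (cs n x *\<^sub>R Xs n x - c x *\<^sub>R X x) powr r
      \<le> 2 powr r * (C powr r * norm (Xs n x - X x) powr r + \<bar>cs n x - c x\<bar> powr r * norm (X x) powr r)" .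
next
  have X': "Lp r X" "\<And>n. Lp r (Xs n)" using X by (auto simp: Lp_converges_def)
  note [measurable] = Lp_measurable[OF X'(1)] Lp_measurable[OF X'(2)]
  show "(\<lambda>x. cs n x *\<^sub>R Xs n x) \<in> borel_measurable borel" for n by measurable
  show "Lp r (\<lambda>x. c x *\<^sub>R X x)" using X' C r by (intro Lp_scaleR[where C = C]) auto
qed (use r in auto)

text \<open>Young's inequality with a free weight e, by comparing b with e a. Conjugate exponents do
  not occur, which lets r = 1 through.\<close>

lemma powr_mult_le:
  fixes a b e r :: real
  assumes "0 \<le> a" "0 \<le> b" "0 < e" "1 \<le> r"
  shows "a powr (r - 1) * b \<le> e * a powr r + e powr (1 - r) * b powr r"
proof (cases "b \<le> e * a")
  case True
  then have "a powr (r - 1) * b \<le> a powr (r - 1) * (e * a)"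
    by (intro mult_left_mono) auto
  also have "\<dots> = e * a powr r"
    using assms by (cases "a = 0") (auto simp: powr_diff)
  finally show ?thesis
    using assms by (smt (verit) mult_nonneg_nonneg powr_ge_zero)
next
  case False
  then have b: "b > 0" "a \<le> b / e" using assms by (auto simp: field_simps intro: le_less_trans[of 0 "e * a"])
  then have "a powr (r - 1) * b \<le> (b / e) powr (r - 1) * b"
    using assms by (intro mult_right_mono powr_mono2) auto
  also have "\<dots> = e powr (1 - r) * b powr r"
    using assms b by (simp add: powr_divide powr_diff)
  finally show ?thesis
    using assms by (smt (verit) mult_nonneg_nonneg powr_ge_zero)
qed

text \<open>Takes the place of Hoelder's inequality. \<open>A\<close> is a field of growth r - 1, in
  the application |grad u|^(p - 2) grad u or u^(q - 1). For r = 1 the bound forces A = 0 where g =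
  0, because 0 powr 0 = 0.\<close>

lemma Lp_pairing_integrable:
  fixes A :: "'a::euclidean_space \<Rightarrow> 'b::euclidean_space"
  assumes "Lp r X" "Lp r g" "1 \<le> r" and [measurable]: "A \<in> borel_measurable borel"
    and A: "\<And>x. norm (A x) \<le> norm (g x) powr (r - 1)"
  shows "integrable lborel (\<lambda>x. norm (A x) * norm (X x))" "integrable lborel (\<lambda>x. A x \<bullet> X x)"
proof -
  note [measurable] = Lp_measurable[OF assms(1)]
  have le: "norm (A x) * norm (X x) \<le> norm (g x) powr r + norm (X x) powr r" for x
  proof -
    have "norm (A x) * norm (X x) \<le> norm (g x) powr (r - 1) * norm (X x)"
      using A by (intro mult_right_mono) auto
    also have "\<dots> \<le> 1 * norm (g x) powr r + 1 powr (1 - r) * norm (X x) powr r"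
      using assms(3) by (intro powr_mult_le) auto
    finally show ?thesis by simp
  qed
  show *: "integrable lborel (\<lambda>x. norm (A x) * norm (X x))"
    by (rule Bochner_Integration.integrable_bound[of _ "\<lambda>x. norm (g x) powr r + norm (X x) powr r"])
       (use le assms(1,2)[THEN Lp_integrable] in auto)
  show "integrable lborel (\<lambda>x. A x \<bullet> X x)"
    by (rule Bochner_Integration.integrable_bound[OF *]) (auto simp: Cauchy_Schwarz_ineq2)
qed

text \<open>Young's inequality with weight e: first e makes the term with the fixed g small, then n
  makes the distance term small.\<close>

lemma Lp_converges_pairing:
  fixes A :: "'a::euclidean_space \<Rightarrow> 'b::euclidean_space"
  assumes X: "Lp_converges r Xs X" and g: "Lp r g" and r: "1 \<le> r" and [measurable]: "A \<in> borel_measurable borel"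
    and A: "\<And>x. norm (A x) \<le> norm (g x) powr (r - 1)"
  shows "(\<lambda>n. LINT x|lborel. A x \<bullet> Xs n x) \<longlonglongrightarrow> (LINT x|lborel. A x \<bullet> X x)"
proof (rule LIMSEQ_I)
  fix e0 :: real assume "e0 > 0"
  have X': "Lp r X" "\<And>n. Lp r (Xs n)" using X by (auto simp: Lp_converges_def)
  have d: "Lp r (\<lambda>x. Xs n x - X x)" for n
    using X' r by (auto intro!: Lp_diff)
  define I where "I = (LINT x|lborel. norm (g x) powr r)"
  have I: "0 \<le> I" by (simp add: I_def)
  \<comment> \<open>Gives e I < e0 / 2; the + 1 prevents division by 0.\<close>
  define e where "e = e0 / (2 * (I + 1))"
  have e: "e > 0" using \<open>e0 > 0\<close> I by (simp add: e_def)
  have eI: "e * I < e0 / 2 + 0" using \<open>e0 > 0\<close> I by (simp add: e_def field_simps)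
  have "(\<lambda>n. e powr (1 - r) * (LINT x|lborel. norm (Xs n x - X x) powr r)) \<longlonglongrightarrow> e powr (1 - r) * 0"
    using X by (intro tendsto_intros) (auto simp: Lp_converges_def)
  then have "\<forall>\<^sub>F n in sequentially. e powr (1 - r) * (LINT x|lborel. norm (Xs n x - X x) powr r) < e0 / 2"
    using \<open>e0 > 0\<close> by (intro order_tendstoD) auto
  then obtain N where N: "\<And>n. n \<ge> N \<Longrightarrow> e powr (1 - r) * (LINT x|lborel. norm (Xs n x - X x) powr r) < e0 / 2"
    by (auto simp: eventually_sequentially)
  show "\<exists>no. \<forall>n\<ge>no. norm ((LINT x|lborel. A x \<bullet> Xs n x) - (LINT x|lborel. A x \<bullet> X x)) < e0"
  proof (intro exI[of _ N] allI impI)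
    fix n assume "N \<le> n"
    have "(LINT x|lborel. A x \<bullet> Xs n x) - (LINT x|lborel. A x \<bullet> X x) = (LINT x|lborel. A x \<bullet> (Xs n x - X x))"
      using Lp_pairing_integrable(2)[OF X'(1) g r _ A] Lp_pairing_integrable(2)[OF X'(2) g r _ A]
      by (simp add: inner_diff_right)
    also have "norm \<dots> \<le> (LINT x|lborel. norm (A x \<bullet> (Xs n x - X x)))"
      by (rule integral_norm_bound)
    also have "\<dots> \<le> (LINT x|lborel. e * norm (g x) powr r + e powr (1 - r) * norm (Xs n x - X x) powr r)"
    proof (rule integral_mono)
      show "integrable lborel (\<lambda>x. norm (A x \<bullet> (Xs n x - X x)))"
        using Lp_pairing_integrable(2)[OF d g r _ A] by auto
      show "integrable lborel (\<lambda>x. e * norm (g x) powr r + e powr (1 - r) * norm (Xs n x - X x) powr r)"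
        using Lp_integrable[OF g] Lp_integrable[OF d] by auto
      fix x
      have "norm (A x \<bullet> (Xs n x - X x)) \<le> norm (A x) * norm (Xs n x - X x)"
        by (simp add: Cauchy_Schwarz_ineq2)
      also have "\<dots> \<le> norm (g x) powr (r - 1) * norm (Xs n x - X x)"
        using A by (intro mult_right_mono) auto
      also have "\<dots> \<le> e * norm (g x) powr r + e powr (1 - r) * norm (Xs n x - X x) powr r"
        using r e by (intro powr_mult_le) auto
      finally show "norm (A x \<bullet> (Xs n x - X x)) \<le> e * norm (g x) powr r + e powr (1 - r) * norm (Xs n x - X x) powr r" .
    qed
    also have "\<dots> = e * I + e powr (1 - r) * (LINT x|lborel. norm (Xs n x - X x) powr r)"
      using Lp_integrable[OF g] Lp_integrable[OF d] by (simp add: I_def)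
    also have "\<dots> < e0" using N[OF \<open>N \<le> n\<close>] eI by linarith
    finally show "norm ((LINT x|lborel. A x \<bullet> Xs n x) - (LINT x|lborel. A x \<bullet> X x)) < e0" .
  qed
qed

section \<open>Continuously differentiable functions and convolution\<close>

text \<open>The gradient is an explicit argument, so that classical and weak gradients are handled
  in the same form.\<close>

definition C1 :: "('a::euclidean_space \<Rightarrow> real) \<Rightarrow> ('a \<Rightarrow> 'a) \<Rightarrow> bool" where
  "C1 f F \<longleftrightarrow> (\<forall>x. (f has_derivative (\<lambda>h. F x \<bullet> h)) (at x)) \<and> continuous_on UNIV F"

definition C1c :: "'a::euclidean_space set \<Rightarrow> ('a \<Rightarrow> real) \<Rightarrow> ('a \<Rightarrow> 'a) \<Rightarrow> bool" where
  "C1c S f F \<longleftrightarrow> C1 f F \<and> compact S \<and> (\<forall>x. x \<notin> S \<longrightarrow> f x = 0)"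

lemma C1_continuous: "C1 f F \<Longrightarrow> continuous_on A f"
  unfolding C1_def by (auto intro!: continuous_at_imp_continuous_on has_derivative_continuous)

lemma C1_grad_continuous: "C1 f F \<Longrightarrow> continuous_on A F"
  unfolding C1_def using continuous_on_subset[of UNIV F A] by simp

lemma C1_measurable:
  assumes "C1 f F" shows "f \<in> borel_measurable borel" "F \<in> borel_measurable borel"
  by (rule borel_measurable_continuous_onI[OF C1_continuous[OF assms]])
    (rule borel_measurable_continuous_onI[OF C1_grad_continuous[OF assms]])

lemma gradient_unique:
  fixes A B :: "'a::euclidean_space"
  assumes "(f has_derivative (\<lambda>h. A \<bullet> h)) (at x)" "(f has_derivative (\<lambda>h. B \<bullet> h)) (at x)"
  shows "A = B"
  by (rule euclidean_eqI) (rule fun_cong[OF has_derivative_unique[OF assms]])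

lemma smooth_fun_C1: "smooth_fun f \<Longrightarrow> C1 f (grad f)"
  by (simp add: C1_def smooth_fun_has_derivative smooth_fun_continuous_on_grad)

lemma C1_grad_eq_0:
  assumes "C1 f F" "closed S" "\<And>y. y \<notin> S \<Longrightarrow> f y = 0" "x \<notin> S"
  shows "F x = 0"
proof -
  have "((\<lambda>_. 0) has_derivative (\<lambda>h. 0 \<bullet> h)) (at x)" by simp
  then have "(f has_derivative (\<lambda>h. 0 \<bullet> h)) (at x)"
    by (rule has_derivative_transform_within_open[where s = "- S"]) (use assms in auto)
  then show ?thesis using assms(1) gradient_unique[of f "F x" x 0] by (simp add: C1_def)
qed

lemma C1c_grad_eq_0: "C1c S f F \<Longrightarrow> x \<notin> S \<Longrightarrow> F x = 0"
  unfolding C1c_def using C1_grad_eq_0[of f F S x] compact_imp_closed[of S] by simp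

lemma test_fun_C1c:
  "test_fun \<Omega> \<phi> \<Longrightarrow> C1c (closure {x. \<phi> x \<noteq> 0}) \<phi> (grad \<phi>)"
  using closure_subset[of "{x. \<phi> x \<noteq> 0}"] by (auto simp: test_fun_def C1c_def smooth_fun_C1)

lemma test_funI:
  assumes "smooth_fun \<phi>" "compact S" "S \<subseteq> \<Omega>" "\<And>x. x \<notin> S \<Longrightarrow> \<phi> x = 0"
  shows "test_fun \<Omega> \<phi>"
proof -
  have "closure {x. \<phi> x \<noteq> 0} \<subseteq> S"
    using assms by (intro closure_minimal) (auto simp: compact_imp_closed)
  moreover from this have "compact (closure {x. \<phi> x \<noteq> 0})"
    using assms(2) compact_Int_closed[of S "closure {x. \<phi> x \<noteq> 0}"] by (simp add: Int_absorb1)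
  ultimately show ?thesis using assms by (auto simp: test_fun_def)
qed

lemma C1c_integrable:
  assumes "C1c S f F" shows "integrable lborel f" "integrable lborel F"
proof -
  have C: "C1 f F" "compact S" "\<And>x. x \<notin> S \<Longrightarrow> f x = 0" using assms by (auto simp: C1c_def)
  show "integrable lborel f"
    by (rule integrable_continuous_compact_support[OF C1_continuous[OF C(1)] C(2,3)])
  show "integrable lborel F"
    by (rule integrable_continuous_compact_support[OF C1_grad_continuous[OF C(1)] C(2) C1c_grad_eq_0[OF assms]])
qed

lemma C1c_Lp:
  assumes "C1c S f F" "0 < r" shows "Lp r f" "Lp r F"
proof -
  have c: "Lp r g" if "continuous_on UNIV g" "\<And>x. x \<notin> S \<Longrightarrow> g x = 0" for g :: "'a \<Rightarrow> 'b::euclidean_space"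
    unfolding Lp_def
  proof
    have "continuous_on UNIV (\<lambda>x. norm (g x) powr r)"
      using assms(2) that(1) by (intro continuous_on_powr' continuous_intros) auto
    then show "integrable lborel (\<lambda>x. norm (g x) powr r)"
      by (rule integrable_continuous_compact_support[of _ S]) (use assms that in \<open>auto simp: C1c_def\<close>)
  qed (use that in \<open>auto intro: borel_measurable_continuous_onI\<close>)
  have C: "C1 f F" "\<And>x. x \<notin> S \<Longrightarrow> f x = 0" using assms(1) by (auto simp: C1c_def)
  show "Lp r f" by (rule c[OF C1_continuous[OF C(1)] C(2)])
  show "Lp r F" by (rule c[OF C1_grad_continuous[OF C(1)] C1c_grad_eq_0[OF assms(1)]])
qed

lemma compact_cball_sum:
  fixes S :: "'a::euclidean_space set"
  assumes "compact S" shows "compact (\<Union>x\<in>S. cball x r)"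
proof -
  have "(\<Union>x\<in>S. cball x r) = {x + y | x y. x \<in> S \<and> y \<in> cball 0 r}"
  proof (intro equalityI subsetI)
    fix z assume "z \<in> (\<Union>x\<in>S. cball x r)"
    then obtain x where "x \<in> S" "dist x z \<le> r" by auto
    then show "z \<in> {x + y | x y. x \<in> S \<and> y \<in> cball 0 r}"
      by (intro CollectI exI[of _ x] exI[of _ "z - x"]) (auto simp: dist_norm norm_minus_commute)
  next
    fix z assume "z \<in> {x + y | x y. x \<in> S \<and> y \<in> cball 0 r}"
    then obtain x y where "x \<in> S" "norm y \<le> r" "z = x + y" by auto
    then show "z \<in> (\<Union>x\<in>S. cball x r)"
      by (intro UN_I[of x]) (auto simp: dist_norm)
  qed
  then show ?thesis using compact_sums[OF assms compact_cball[of 0 r]] by simp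
qed

text \<open>F is uniformly continuous on the compact 1-neighbourhood K of S, and if neither of two
  points is in S both gradients vanish; the mean value inequality on a ball of radius |h| does the
  rest. Uniformity in x allows the expansion to be integrated.\<close>

lemma C1c_uniform_differentiable:
  assumes "C1c S f F" "e > 0"
  obtains d where "d > 0" "\<And>x h. norm h < d \<Longrightarrow> \<bar>f (x + h) - f x - F x \<bullet> h\<bar> \<le> e * norm h"
proof -
  define K where "K = (\<Union>x\<in>S. cball x 1)"
  have K: "compact K" using assms compact_cball_sum by (auto simp: K_def C1c_def)
  have "uniformly_continuous_on K F"
    using assms K by (intro compact_uniformly_continuous) (auto simp: C1c_def C1_grad_continuous)
  then obtain d0 where d0: "d0 > 0" "\<And>x y. x \<in> K \<Longrightarrow> y \<in> K \<Longrightarrow> dist y x < d0 \<Longrightarrow> dist (F y) (F x) < e"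
    using assms(2) by (rule uniformly_continuous_onE) auto
  have F: "norm (F y - F x) \<le> e" if "norm (y - x) < min d0 1" for x y
  proof (cases "x \<in> S \<or> y \<in> S")
    case True
    have "x \<in> K" "y \<in> K"
    proof -
      have K1: "\<exists>z\<in>S. dist z x \<le> 1 \<and> dist z y \<le> 1"
        using True that by (force simp: dist_norm norm_minus_commute)
      then show "x \<in> K" "y \<in> K" by (auto simp: K_def)
    qed
    then show ?thesis using d0(2)[of x y] that by (simp add: dist_norm)
  next
    case False
    then show ?thesis using C1c_grad_eq_0[OF assms(1)] assms(2) by simp
  qed
  show thesis
  proof (rule that)
    show "min d0 1 > 0" using d0 by simp
    fix x h :: 'a assume h: "norm h < min d0 1"
    have "norm (f (x + h) - f x - F x \<bullet> (x + h - x)) \<le> norm (x + h - x) * e"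
    proof (rule differentiable_bound_linearization[where S = "cball x (norm h)" and f' = "\<lambda>y h. F y \<bullet> h"])
      fix t :: real assume "t \<in> {0..1}"
      then show "x + t *\<^sub>R (x + h - x) \<in> cball x (norm h)"
        by (auto simp: dist_norm mult_left_le_one_le)
    next
      fix y assume "y \<in> cball x (norm h)"
      show "(f has_derivative (\<lambda>h. F y \<bullet> h)) (at y within cball x (norm h))"
        using assms by (auto simp: C1c_def C1_def intro: has_derivative_at_withinI)
      have "norm (F y - F x) \<le> e"
        using F[of y x] \<open>y \<in> cball x (norm h)\<close> h by (auto simp: dist_norm norm_minus_commute)
      then have "norm (F y \<bullet> k - F x \<bullet> k) \<le> e * norm k" for k
        using Cauchy_Schwarz_ineq2[of "F y - F x" k] mult_right_mono[of "norm (F y - F x)" e "norm k"]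
        by (simp add: inner_diff_left)
      then show "onorm ((\<lambda>k. F y \<bullet> k) - (\<lambda>k. F x \<bullet> k)) \<le> e"
        unfolding fun_diff_def using assms(2) by (intro onorm_bound) auto
    qed auto
    then show "\<bar>f (x + h) - f x - F x \<bullet> h\<bar> \<le> e * norm h" by (simp add: mult.commute)
  qed
qed

text \<open>The integral of f (x + t h) - f x vanishes by translation invariance. By the uniform
  expansion it is also t times the integral of F . h, up to an error e t |h| V, which excludes a
  nonzero value.\<close>

lemma C1c_integral_grad:
  assumes "C1c S f F" shows "(LINT x|lborel. F x \<bullet> h) = 0"
proof (rule ccontr)
  assume nz: "(LINT x|lborel. F x \<bullet> h) \<noteq> 0"
  \<comment> \<open>Contains the supports of all translates x |-> f (x + t h) with 0 <= t <= 1, so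
    the error of the expansion is integrated over a set of finite measure.\<close>
  define K where "K = (\<Union>x\<in>S. cball x (norm h + 1))"
  have K: "compact K" using assms compact_cball_sum by (auto simp: K_def C1c_def)
  have SK: "S \<subseteq> K" by (force simp: K_def)
  have Kb: "K \<in> sets borel" using K by (rule borel_compact)
  have Kf: "emeasure lborel K < \<infinity>" using emeasure_lborel_cbox_finite K
    using emeasure_bounded_finite[OF compact_imp_bounded[OF K]] by simp
  define V where "V = measure lborel K"
  define I where "I = \<bar>LINT x|lborel. F x \<bullet> h\<bar>"
  \<comment> \<open>Makes e |h| V < I, the contradiction aimed at; + 1 since |h| V may be 0.\<close>
  define e where "e = I / (2 * (norm h * V + 1))"
  have "V \<ge> 0" "I > 0" using nz by (auto simp: V_def I_def)
  then have e: "e > 0" by (simp add: e_def add_nonneg_pos)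
  obtain d where d: "d > 0" "\<And>x h. norm h < d \<Longrightarrow> \<bar>f (x + h) - f x - F x \<bullet> h\<bar> \<le> e * norm h"
    using C1c_uniform_differentiable[OF assms e] by blast
  define t where "t = min 1 (d / (norm h + 1)) / 2"
  have t: "0 < t" "t \<le> 1" "t * norm h < d"
  proof -
    show "0 < t" "t \<le> 1" using d(1) by (auto simp: t_def min_def add_nonneg_pos divide_simps)
    have "2 * t \<le> d / (norm h + 1)" by (simp add: t_def)
    then have "2 * t * (norm h + 1) \<le> d"
      by (simp add: pos_le_divide_eq add_nonneg_pos)
    moreover have "0 \<le> t * norm h" using \<open>0 < t\<close> by simp
    ultimately show "t * norm h < d" using \<open>0 < t\<close> d(1) by (simp add: algebra_simps)
  qed
  note int = C1c_integrable[OF assms]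
  have "(LINT x|lborel. f (x + t *\<^sub>R h) - f x - F x \<bullet> (t *\<^sub>R h)) = - (t * (LINT x|lborel. F x \<bullet> h))"
    using int lborel_integrable_translate[OF int(1), of "t *\<^sub>R h"] by (simp add: lborel_integral_translate[of f])
  then have "t * I = \<bar>LINT x|lborel. f (x + t *\<^sub>R h) - f x - F x \<bullet> (t *\<^sub>R h)\<bar>"
    using t by (simp add: I_def abs_mult)
  also have "\<dots> \<le> (LINT x|lborel. \<bar>f (x + t *\<^sub>R h) - f x - F x \<bullet> (t *\<^sub>R h)\<bar>)"
    by (rule integral_abs_bound)
  also have "\<dots> \<le> (LINT x|lborel. e * (t * norm h) * indicator K x)"
  proof (rule integral_mono)
    show "integrable lborel (\<lambda>x. \<bar>f (x + t *\<^sub>R h) - f x - F x \<bullet> (t *\<^sub>R h)\<bar>)"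
      using int lborel_integrable_translate[OF int(1), of "t *\<^sub>R h"] by auto
    show "integrable lborel (\<lambda>x. e * (t * norm h) * indicator K x)"
      using Kb Kf by (intro integrable_mult_right integrable_real_indicator) auto
    fix x
    show "\<bar>f (x + t *\<^sub>R h) - f x - F x \<bullet> (t *\<^sub>R h)\<bar> \<le> e * (t * norm h) * indicator K x"
    proof (cases "x \<in> K")
      case True
      then show ?thesis using d(2)[of "t *\<^sub>R h" x] t by simp
    next
      case False
      have "x + t *\<^sub>R h \<notin> S"
      proof
        assume "x + t *\<^sub>R h \<in> S"
        moreover have "x \<in> cball (x + t *\<^sub>R h) (norm h + 1)"
          using t by (auto simp: dist_norm intro: order_trans[OF mult_left_le_one_le])
        ultimately show False using False by (auto simp: K_def)
      qed
      moreover have "x \<notin> S" using False SK by blast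
      ultimately show ?thesis
        using False assms C1c_grad_eq_0[OF assms, of x] by (simp add: C1c_def)
    qed
  qed
  also have "\<dots> = t * (e * (norm h * V))"
    using Kb Kf by (simp add: V_def)
  finally have "I \<le> e * (norm h * V)" using t by simp
  also have "\<dots> < I"
    using \<open>I > 0\<close> \<open>V \<ge> 0\<close> by (simp add: e_def divide_simps add_nonneg_pos)
  finally show False by simp
qed

lemma C1c_bounded:
  assumes "C1c S f F" obtains C where "\<And>x. \<bar>f x\<bar> \<le> C" "\<And>x. norm (F x) \<le> C" "0 \<le> C"
proof -
  have "bounded (f ` S)" "bounded (F ` S)"
    using assms C1_continuous[of f F S] C1_grad_continuous[of f F S]
    by (simp_all add: C1c_def compact_imp_bounded compact_continuous_image)
  then obtain a b where a: "\<And>x. x \<in> S \<Longrightarrow> \<bar>f x\<bar> \<le> a" and b: "\<And>x. x \<in> S \<Longrightarrow> norm (F x) \<le> b"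
    by (auto simp: bounded_iff)
  show thesis
  proof (rule that[of "max 0 (max a b)"])
    fix x
    show "\<bar>f x\<bar> \<le> max 0 (max a b)"
      using a[of x] assms by (cases "x \<in> S") (auto simp: C1c_def)
    show "norm (F x) \<le> max 0 (max a b)"
      using b[of x] C1c_grad_eq_0[OF assms, of x] by (cases "x \<in> S") auto
  qed simp
qed

lemma C1c_bounded_measurable_integrable:
  assumes "C1c S f F" "integrable lborel g"
  shows "integrable lborel (\<lambda>y. g y * f (x - y))" "integrable lborel (\<lambda>y. g y * (F (x - y) \<bullet> h))"
proof -
  obtain C where C: "\<And>x. \<bar>f x\<bar> \<le> C" "\<And>x. norm (F x) \<le> C" "0 \<le> C" using C1c_bounded[OF assms(1)] by blast
  have [measurable]: "f \<in> borel_measurable borel" "F \<in> borel_measurable borel"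
    using assms(1) C1_measurable[of f F] by (simp_all add: C1c_def)
  show "integrable lborel (\<lambda>y. g y * f (x - y))"
    using integrable_mult_bounded[OF assms(2), of "\<lambda>y. f (x - y)" C] C(1) by (simp add: mult.commute)
  have "\<bar>F z \<bullet> h\<bar> \<le> C * norm h" for z
    using Cauchy_Schwarz_ineq2[of "F z" h] mult_right_mono[OF C(2)[of z], of "norm h"] by simp
  then show "integrable lborel (\<lambda>y. g y * (F (x - y) \<bullet> h))"
    using integrable_mult_bounded[OF assms(2), of "\<lambda>y. F (x - y) \<bullet> h" "C * norm h"] by (simp add: mult.commute)
qed

text \<open>Differentiation under the integral sign: the expansion error of f is a small multiple of
  |h| uniformly in the base point, so integrating it against |g| keeps it a small multiple of
  |h|.\<close>

lemma has_derivative_conv: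
  assumes g: "integrable lborel g" and f: "C1c S f F"
  shows "(conv g f has_derivative (\<lambda>h. LINT y|lborel. g y * (F (x - y) \<bullet> h))) (at x)"
  unfolding has_derivative_at_alt
proof (intro conjI allI impI)
  note int = C1c_bounded_measurable_integrable[OF f g]
  obtain C where C: "\<And>x. norm (F x) \<le> C" "0 \<le> C" using C1c_bounded[OF f] by blast
  show "bounded_linear (\<lambda>h. LINT y|lborel. g y * (F (x - y) \<bullet> h))"
  proof (rule bounded_linear_intro)
    show "(LINT y|lborel. g y * (F (x - y) \<bullet> (h + k))) = (LINT y|lborel. g y * (F (x - y) \<bullet> h)) + (LINT y|lborel. g y * (F (x - y) \<bullet> k))" for h k
      using int by (simp add: inner_add_right distrib_left)
    show "(LINT y|lborel. g y * (F (x - y) \<bullet> (r *\<^sub>R h))) = r *\<^sub>R (LINT y|lborel. g y * (F (x - y) \<bullet> h))" for h r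
      by (simp add: mult.left_commute)
    fix h
    have "norm (LINT y|lborel. g y * (F (x - y) \<bullet> h)) \<le> (LINT y|lborel. norm (g y * (F (x - y) \<bullet> h)))"
      by (rule integral_norm_bound)
    also have "\<dots> \<le> (LINT y|lborel. \<bar>g y\<bar> * (C * norm h))"
    proof (rule integral_mono)
      fix y
      have "\<bar>F (x - y) \<bullet> h\<bar> \<le> C * norm h"
        using Cauchy_Schwarz_ineq2[of "F (x - y)" h] mult_right_mono[OF C(1)[of "x - y"], of "norm h"] by simp
      then show "norm (g y * (F (x - y) \<bullet> h)) \<le> \<bar>g y\<bar> * (C * norm h)"
        by (simp add: abs_mult mult_left_mono)
    qed (use int g in auto)
    also have "\<dots> = norm h * ((LINT y|lborel. \<bar>g y\<bar>) * C)" by simp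
    finally show "norm (LINT y|lborel. g y * (F (x - y) \<bullet> h)) \<le> norm h * ((LINT y|lborel. \<bar>g y\<bar>) * C)" .
  qed
  fix e :: real assume "e > 0"
  define I where "I = (LINT y|lborel. \<bar>g y\<bar>)"
  have I: "0 \<le> I" by (simp add: I_def)
  have "e / (I + 1) > 0" using \<open>e > 0\<close> I by simp
  then obtain d where d: "d > 0" "\<And>x h. norm h < d \<Longrightarrow> \<bar>f (x + h) - f x - F x \<bullet> h\<bar> \<le> e / (I + 1) * norm h"
    using C1c_uniform_differentiable[OF f] by blast
  show "\<exists>d>0. \<forall>z. norm (z - x) < d \<longrightarrow>
      norm (conv g f z - conv g f x - (LINT y|lborel. g y * (F (x - y) \<bullet> (z - x)))) \<le> e * norm (z - x)"
  proof (intro exI[of _ d] conjI allI impI)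
    fix z assume z: "norm (z - x) < d"
    have eq: "conv g f z - conv g f x - (LINT y|lborel. g y * (F (x - y) \<bullet> (z - x)))
        = (LINT y|lborel. g y * (f (z - y) - f (x - y) - F (x - y) \<bullet> (z - x)))"
      unfolding conv_def using int by (simp add: right_diff_distrib)
    have i: "integrable lborel (\<lambda>y. g y * (f (z - y) - f (x - y) - F (x - y) \<bullet> (z - x)))"
      using int by (simp add: right_diff_distrib)
    have "norm (LINT y|lborel. g y * (f (z - y) - f (x - y) - F (x - y) \<bullet> (z - x)))
        \<le> (LINT y|lborel. norm (g y * (f (z - y) - f (x - y) - F (x - y) \<bullet> (z - x))))"
      by (rule integral_norm_bound)
    also have "\<dots> \<le> (LINT y|lborel. \<bar>g y\<bar> * (e / (I + 1) * norm (z - x)))"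
    proof (rule integral_mono)
      fix y
      have "\<bar>f (z - y) - f (x - y) - F (x - y) \<bullet> (z - x)\<bar> \<le> e / (I + 1) * norm (z - x)"
        using d(2)[OF z, of "x - y"] by (simp add: algebra_simps)
      then show "norm (g y * (f (z - y) - f (x - y) - F (x - y) \<bullet> (z - x))) \<le> \<bar>g y\<bar> * (e / (I + 1) * norm (z - x))"
        unfolding real_norm_def abs_mult by (intro mult_left_mono) auto
    qed (use i g in auto)
    also have "\<dots> = I / (I + 1) * (e * norm (z - x))" by (simp add: I_def)
    also have "\<dots> \<le> 1 * (e * norm (z - x))"
      using I \<open>e > 0\<close> by (intro mult_right_mono) auto
    finally show "norm (conv g f z - conv g f x - (LINT y|lborel. g y * (F (x - y) \<bullet> (z - x)))) \<le> e * norm (z - x)"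
      unfolding eq by simp
  qed (rule d(1))
qed

lemma conv_smooth:
  assumes g: "integrable lborel g" and f: "smooth_fun f" "compact S" "\<And>x. x \<notin> S \<Longrightarrow> f x = 0"
  shows "smooth_fun (conv g f)"
proof (rule smooth_fun_coinduct_set)
  \<comment> \<open>Differentiating the convolution differentiates the kernel only, so the
    convolutions of this one g are closed under partial derivatives.\<close>
  let ?X = "{conv g \<eta> | \<eta>. smooth_fun \<eta> \<and> (\<forall>x. x \<notin> S \<longrightarrow> \<eta> x = 0)}"
  show "conv g f \<in> ?X" using f by blast
  fix k assume "k \<in> ?X"
  then obtain \<eta> where k: "k = conv g \<eta>" and \<eta>: "smooth_fun \<eta>" "\<And>x. x \<notin> S \<Longrightarrow> \<eta> x = 0" by blast
  have C: "C1c S \<eta> (grad \<eta>)" using \<eta> f(2) by (simp add: C1c_def smooth_fun_C1)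
  note D = has_derivative_conv[OF g C]
  show "k differentiable (at x)" for x using D by (auto simp: k differentiable_def)
  fix b :: 'a assume b: "b \<in> Basis"
  have "(\<lambda>x. frechet_derivative k (at x) b) = conv g (\<lambda>x. frechet_derivative \<eta> (at x) b)"
    unfolding k frechet_derivative_at[OF D, symmetric] frechet_derivative_eq_grad[OF \<eta>(1)] conv_def ..
  moreover have "frechet_derivative \<eta> (at x) b = 0" if "x \<notin> S" for x
    using C1c_grad_eq_0[OF C that] by (simp add: frechet_derivative_eq_grad[OF \<eta>(1)])
  ultimately show "(\<lambda>x. frechet_derivative k (at x) b) \<in> ?X"
    using smooth_funD(2)[OF \<eta>(1) b] by blast
qed

lemma conv_mollifier_smooth:
  assumes "integrable lborel g" "\<delta> > 0" shows "smooth_fun (conv g (mollifier \<delta>))"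
  by (rule conv_smooth[OF assms(1) mollifier_smooth, of "cball 0 \<delta>"]) (auto intro!: mollifier_eq_0[OF assms(2)])

section \<open>Weak gradients\<close>

text \<open>\<open>weak_grad\<close> with integrals over the whole space: the domain enters only
  through the test functions, which vanish outside it.\<close>

definition wgrad :: "'a::euclidean_space set \<Rightarrow> ('a \<Rightarrow> real) \<Rightarrow> ('a \<Rightarrow> 'a) \<Rightarrow> bool" where
  "wgrad \<Omega> u G \<longleftrightarrow> (\<forall>\<phi> b. test_fun \<Omega> \<phi> \<longrightarrow> b \<in> Basis \<longrightarrow>
     (LINT x|lborel. u x * (grad \<phi> x \<bullet> b)) = - (LINT x|lborel. (G x \<bullet> b) * \<phi> x))"

lemma grad_mollifier_reflect:
  "grad (mollifier \<delta>) (x - y) = - grad (\<lambda>z. mollifier \<delta> (z - x)) y"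
proof -
  have "((\<lambda>z. mollifier \<delta> (x - z)) has_derivative (\<lambda>h. grad (mollifier \<delta>) (x - y) \<bullet> (- h))) (at y)"
    by (rule has_derivative_compose[OF _ smooth_fun_has_derivative[OF mollifier_smooth]])
       (auto intro!: derivative_eq_intros)
  then have "((\<lambda>z. mollifier \<delta> (z - x)) has_derivative (\<lambda>h. (- grad (mollifier \<delta>) (x - y)) \<bullet> h)) (at y)"
    by (simp add: mollifier_commute)
  from gradient_unique[OF this smooth_fun_has_derivative[OF mollifier_translate_smooth]]
  show ?thesis by (metis add.inverse_inverse)
qed

lemma mollifier_C1c: "\<delta> > 0 \<Longrightarrow> C1c (cball 0 \<delta>) (mollifier \<delta>) (grad (mollifier \<delta>))"
  by (auto simp: C1c_def smooth_fun_C1 mollifier_smooth mollifier_eq_0)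

text \<open>Test the weak gradient with the mollifier centred at x, admissible when the closed ball
  lies in the domain; reflecting the argument produces the sign of the weak formulation.
  \<open>g\<close> and \<open>k\<close> agree with u and G . b on that ball only, which leaves room
  for cutting them off elsewhere to make them integrable.\<close>

lemma grad_conv_mollifier:
  assumes w: "wgrad \<Omega> u G" and \<delta>: "\<delta> > 0" and x: "cball x \<delta> \<subseteq> \<Omega>" and b: "b \<in> Basis"
    and g: "integrable lborel g" "\<And>y. y \<in> cball x \<delta> \<Longrightarrow> g y = u y"
    and k: "\<And>y. y \<in> cball x \<delta> \<Longrightarrow> k y = G y \<bullet> b"
  shows "grad (conv g (mollifier \<delta>)) x \<bullet> b = conv k (mollifier \<delta>) x"
proof -
  define \<phi> where "\<phi> z = mollifier \<delta> (z - x)" for z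
  have \<phi>: "smooth_fun \<phi>" unfolding \<phi>_def by (rule mollifier_translate_smooth)
  have \<phi>0: "\<phi> z = 0" if "z \<notin> cball x \<delta>" for z
    using that mollifier_eq_0[OF \<delta>, of "z - x"] by (simp add: \<phi>_def dist_norm norm_minus_commute)
  have "C1c (cball x \<delta>) \<phi> (grad \<phi>)"
    using \<phi> \<phi>0 by (simp add: C1c_def smooth_fun_C1)
  note g0 = C1c_grad_eq_0[OF this]
  have "test_fun \<Omega> \<phi>"
    by (rule test_funI[OF \<phi> compact_cball x \<phi>0])
  then have eq: "(LINT y|lborel. u y * (grad \<phi> y \<bullet> b)) = - (LINT y|lborel. (G y \<bullet> b) * \<phi> y)"
    using w b by (simp add: wgrad_def)
  have "grad (conv g (mollifier \<delta>)) x \<bullet> b = (LINT y|lborel. g y * (grad (mollifier \<delta>) (x - y) \<bullet> b))"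
    unfolding frechet_derivative_eq_grad[OF conv_mollifier_smooth[OF g(1) \<delta>], symmetric]
      frechet_derivative_at[OF has_derivative_conv[OF g(1) mollifier_C1c[OF \<delta>]], symmetric] ..
  also have "\<dots> = (LINT y|lborel. - (u y * (grad \<phi> y \<bullet> b)))"
  proof (rule Bochner_Integration.integral_cong[OF refl])
    fix y
    have "grad (mollifier \<delta>) (x - y) = - grad \<phi> y"
      unfolding \<phi>_def by (rule grad_mollifier_reflect)
    then show "g y * (grad (mollifier \<delta>) (x - y) \<bullet> b) = - (u y * (grad \<phi> y \<bullet> b))"
      using g(2)[of y] g0[of y] by (cases "y \<in> cball x \<delta>") auto
  qed
  also have "\<dots> = (LINT y|lborel. (G y \<bullet> b) * \<phi> y)" by (simp add: eq)
  also have "\<dots> = conv k (mollifier \<delta>) x"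
    unfolding conv_def
  proof (rule Bochner_Integration.integral_cong[OF refl])
    fix y
    have "\<phi> y = mollifier \<delta> (x - y)" by (simp add: \<phi>_def mollifier_commute)
    then show "(G y \<bullet> b) * \<phi> y = k y * mollifier \<delta> (x - y)"
      using k[of y] \<phi>0[of y] by (cases "y \<in> cball x \<delta>") auto
  qed
  finally show ?thesis .
qed

text \<open>The estimate \<open>conv_mollifier_dist_le\<close> is used twice: with a crude bound
  valid for all shifts, to see that the mollified functions are at finite distance from f, and with
  a small bound for small shifts, to get convergence.\<close>

lemma Lp_converges_conv:
  fixes f :: "'a::euclidean_space \<Rightarrow> real"
  assumes f: "Lp r f" "integrable lborel f" and r: "1 \<le> r" and \<delta>: "\<And>n. \<delta> n > 0" "\<delta> \<longlonglongrightarrow> 0"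
  shows "Lp_converges r (\<lambda>n. conv f (mollifier (\<delta> n))) f"
proof -
  have [measurable]: "f \<in> borel_measurable borel" using Lp_measurable[OF f(1)] .
  have if': "integrable lborel (\<lambda>x. \<bar>f x\<bar> powr r)" using Lp_integrable[OF f(1)] by simp
  define g where "g n x = \<bar>conv f (mollifier (\<delta> n)) x - f x\<bar> powr r" for n x
  have [measurable]: "g n \<in> borel_measurable borel" for n unfolding g_def by measurable
  have gI: "integrable lborel (g n) \<and> (LINT x|lborel. g n x) \<le> e"
    if e: "0 \<le> e" "\<And>h. norm h \<le> \<delta> n \<Longrightarrow> (\<integral>\<^sup>+x. ennreal (\<bar>f (x + h) - f x\<bar> powr r) \<partial>lborel) \<le> ennreal e" for n e
  proof -
    have le: "(\<integral>\<^sup>+x. ennreal (g n x) \<partial>lborel) \<le> ennreal e"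
      unfolding g_def using e by (intro conv_mollifier_dist_le r f \<delta>) auto
    then have i: "integrable lborel (g n)"
      by (intro integrableI_nonneg) (auto simp: g_def intro: le_less_trans)
    have "(\<integral>\<^sup>+x. ennreal (g n x) \<partial>lborel) = ennreal (LINT x|lborel. g n x)"
      by (rule nn_integral_eq_integral[OF i]) (simp add: g_def)
    with le have "ennreal (LINT x|lborel. g n x) \<le> ennreal e" by simp
    then show ?thesis using i e(1) by simp
  qed
  \<comment> \<open>Crude bound for every shift: |f (x + h)|^r and |f x|^r have the same
    integral.\<close>
  define e0 where "e0 = 2 powr r * (2 * (LINT x|lborel. \<bar>f x\<bar> powr r))"
  have "integrable lborel (g n)" for n
  proof (rule gI[THEN conjunct1])
    show "0 \<le> e0" by (simp add: e0_def)
    fix h :: 'a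
    have i: "integrable lborel (\<lambda>x. 2 powr r * (\<bar>f (x + h)\<bar> powr r + \<bar>f x\<bar> powr r))"
      using if' lborel_integrable_translate[OF if', of h] by auto
    have "(\<integral>\<^sup>+x. ennreal (\<bar>f (x + h) - f x\<bar> powr r) \<partial>lborel)
        \<le> (\<integral>\<^sup>+x. ennreal (2 powr r * (\<bar>f (x + h)\<bar> powr r + \<bar>f x\<bar> powr r)) \<partial>lborel)"
    proof (intro nn_integral_mono ennreal_leI)
      fix x show "\<bar>f (x + h) - f x\<bar> powr r \<le> 2 powr r * (\<bar>f (x + h)\<bar> powr r + \<bar>f x\<bar> powr r)"
        using norm_add_powr_le[of r "f (x + h)" "- f x"] r by simp
    qed
    also have "\<dots> = ennreal (LINT x|lborel. 2 powr r * (\<bar>f (x + h)\<bar> powr r + \<bar>f x\<bar> powr r))"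
      by (rule nn_integral_eq_integral[OF i]) auto
    also have "(LINT x|lborel. 2 powr r * (\<bar>f (x + h)\<bar> powr r + \<bar>f x\<bar> powr r)) = e0"
      using if' lborel_integrable_translate[OF if', of h] lborel_integral_translate[of "\<lambda>x. \<bar>f x\<bar> powr r" h]
      by (simp add: e0_def)
    finally show "(\<integral>\<^sup>+x. ennreal (\<bar>f (x + h) - f x\<bar> powr r) \<partial>lborel) \<le> ennreal e0" .
  qed
  moreover have "(\<lambda>n. LINT x|lborel. g n x) \<longlonglongrightarrow> 0"
  proof (rule LIMSEQ_I)
    fix e :: real assume "e > 0"
    then have "e / 2 > 0" by simp
    from Lp_translation_continuous[OF r _ if' this] obtain d where d: "d > 0"
      "\<And>h. norm h \<le> d \<Longrightarrow> (\<integral>\<^sup>+x. ennreal (\<bar>f (x + h) - f x\<bar> powr r) \<partial>lborel) \<le> ennreal (e / 2)" by auto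
    obtain N where N: "\<And>n. n \<ge> N \<Longrightarrow> \<delta> n < d"
      using order_tendstoD(2)[OF \<delta>(2) d(1)] by (auto simp: eventually_sequentially)
    show "\<exists>no. \<forall>n\<ge>no. norm ((LINT x|lborel. g n x) - 0) < e"
    proof (intro exI[of _ N] allI impI)
      fix n assume "N \<le> n"
      have "(LINT x|lborel. g n x) \<le> e / 2"
        using N[OF \<open>N \<le> n\<close>] \<open>e > 0\<close> by (intro gI[THEN conjunct2] d(2)) auto
      moreover have "0 \<le> (LINT x|lborel. g n x)" by (simp add: g_def)
      ultimately show "norm ((LINT x|lborel. g n x) - 0) < e" using \<open>e > 0\<close> by simp
    qed
  qed
  ultimately show ?thesis
    using f r by (intro Lp_convergesI[where g = g]) (auto simp: g_def)
qed

text \<open>t <= 1 + t^r puts L^r into L^1 on sets of finite measure; mollification requires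
  L^1.\<close>

lemma Lp_restrict:
  assumes "Lp r u" "1 \<le> r" "compact B"
  shows "Lp r (\<lambda>x. indicator B x *\<^sub>R u x)" "integrable lborel (\<lambda>x. indicator B x *\<^sub>R u x)"
proof -
  have B: "B \<in> sets borel" "emeasure lborel B < \<infinity>"
    using assms(3) emeasure_bounded_finite[OF compact_imp_bounded[OF assms(3)]] by (auto intro: borel_compact)
  note [measurable] = B(1) Lp_measurable[OF assms(1)]
  show "Lp r (\<lambda>x. indicator B x *\<^sub>R u x)"
    using assms by (intro Lp_scaleR[where C = 1]) (auto simp: indicator_def)
  show "integrable lborel (\<lambda>x. indicator B x *\<^sub>R u x)"
  proof (rule Bochner_Integration.integrable_bound[of _ "\<lambda>x. indicator B x + norm (u x) powr r"])
    show "integrable lborel (\<lambda>x. indicator B x + norm (u x) powr r)"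
      using B Lp_integrable[OF assms(1)] by (intro Bochner_Integration.integrable_add integrable_real_indicator) auto
    show "AE x in lborel. norm (indicat_real B x *\<^sub>R u x) \<le> norm (indicat_real B x + norm (u x) powr r)"
    proof (rule AE_I2)
      fix x
      have "norm (u x) \<le> 1 + norm (u x) powr r"
        using powr_mult_le[of 1 "norm (u x)" 1 r] assms(2) by simp
      then show "norm (indicat_real B x *\<^sub>R u x) \<le> norm (indicat_real B x + norm (u x) powr r)"
        by (auto simp: indicator_def)
    qed
  qed measurable
qed

lemma Lp_converges_restrict:
  assumes "Lp_converges r Xs X" "0 < r" "S \<in> sets borel"
  shows "Lp_converges r (\<lambda>n x. indicator S x *\<^sub>R Xs n x) (\<lambda>x. indicator S x *\<^sub>R X x)"
  by (rule Lp_converges_scaleR[OF assms(1,2), where C = 1]) (use assms(3) in \<open>auto simp: indicator_def\<close>)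

lemma compact_neighbourhood:
  fixes S :: "'a::euclidean_space set"
  assumes "compact S" "open \<Omega>" "S \<subseteq> \<Omega>"
  obtains r where "r > 0" "(\<Union>x\<in>S. cball x r) \<subseteq> \<Omega>" "compact (\<Union>x\<in>S. cball x r)"
proof -
  obtain e where e: "e > 0" "(\<Union>x\<in>S. ball x e) \<subseteq> \<Omega>"
    using compact_subset_open_imp_ball_epsilon_subset[OF assms] by blast
  have "(\<Union>x\<in>S. cball x (e / 2)) \<subseteq> (\<Union>x\<in>S. ball x e)" using e(1) by auto
  then show thesis
    using e compact_cball_sum[OF assms(1)] by (intro that[of "e / 2"]) auto
qed

text \<open>The radii are at most r, where the r-neighbourhood of S lies in the domain; convergence
  is therefore claimed only on S. The last two clauses record that averaging preserves nonnegativity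
  and the zero function: the first is used for compositions defined on {0..}, the second for the
  uniqueness of weak gradients.\<close>

lemma mollify_local:
  fixes u :: "'a::euclidean_space \<Rightarrow> real"
  assumes w: "wgrad \<Omega> u G" and u: "Lp q u" and G: "Lp p G" and q: "1 \<le> q" and p: "1 \<le> p"
    and S: "compact S" "open \<Omega>" "S \<subseteq> \<Omega>"
  obtains us Us where "\<And>n. C1 (us n) (Us n)"
    "Lp_converges q (\<lambda>n x. indicator S x *\<^sub>R us n x) (\<lambda>x. indicator S x *\<^sub>R u x)"
    "Lp_converges p (\<lambda>n x. indicator S x *\<^sub>R Us n x) (\<lambda>x. indicator S x *\<^sub>R G x)"
    "AE x in lborel. x \<in> S \<longrightarrow> (\<lambda>n. us n x) \<longlonglongrightarrow> u x"
    "(\<forall>x. 0 \<le> u x) \<longrightarrow> (\<forall>n x. 0 \<le> us n x)"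
    "(\<forall>x. u x = 0) \<longrightarrow> (\<forall>n x. us n x = 0)"
proof -
  obtain r where r: "r > 0" "(\<Union>x\<in>S. cball x r) \<subseteq> \<Omega>" "compact (\<Union>x\<in>S. cball x r)"
    using compact_neighbourhood[OF S] by blast
  define B where "B = (\<Union>x\<in>S. cball x r)"
  have SB: "S \<subseteq> B" using r(1) by (force simp: B_def)
  have cB: "compact B" using r by (simp add: B_def)
  note [measurable] = borel_compact[OF S(1)]
  define \<delta> where "\<delta> n = r / real (Suc n)" for n
  have \<delta>: "\<delta> n > 0" "\<delta> n \<le> r" for n using r(1) by (auto simp: \<delta>_def field_simps)
  have \<delta>0: "\<delta> \<longlonglongrightarrow> 0" unfolding \<delta>_def[abs_def]
    using tendsto_mult[OF tendsto_const[of r] LIMSEQ_inverse_real_of_nat] by (simp add: divide_inverse)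
  \<comment> \<open>Extension by 0 outside B: integrable on the whole space, and at points of S it
    has the same mollifications as u.\<close>
  define g where "g x = indicator B x *\<^sub>R u x" for x
  have g: "Lp q g" "integrable lborel g"
    unfolding g_def[abs_def] by (rule Lp_restrict[OF u q cB])+
  define k where "k b x = (indicator B x *\<^sub>R G x) \<bullet> b" for b x
  have k: "Lp p (k b)" "integrable lborel (k b)" for b
  proof -
    note R = Lp_restrict[OF G p cB]
    show "integrable lborel (k b)" unfolding k_def[abs_def] using R(2) by (rule integrable_inner_left)
    have [measurable]: "(\<lambda>x. indicat_real B x *\<^sub>R G x) \<in> borel_measurable borel" using Lp_measurable[OF R(1)] .
    show "Lp p (k b)"
    proof (rule Lp_norm_le[OF R(1), where C = "norm b"])
      show "norm (k b x) \<le> norm b * norm (indicat_real B x *\<^sub>R G x)" for x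
        using Cauchy_Schwarz_ineq2[of "indicat_real B x *\<^sub>R G x" b] by (simp add: k_def mult.commute)
      show "k b \<in> borel_measurable borel" unfolding k_def[abs_def] by measurable
    qed (use p in auto)
  qed
  define us where "us n = conv g (mollifier (\<delta> n))" for n
  define Us where "Us n = grad (us n)" for n
  have sm: "smooth_fun (us n)" for n unfolding us_def by (rule conv_mollifier_smooth[OF g(2) \<delta>(1)])
  have C: "C1 (us n) (Us n)" for n unfolding Us_def using sm by (rule smooth_fun_C1)
  have "Lp_converges q us g" unfolding us_def[abs_def] by (rule Lp_converges_conv[OF g q \<delta>(1) \<delta>0])
  then have L1: "Lp_converges q (\<lambda>n x. indicator S x *\<^sub>R us n x) (\<lambda>x. indicator S x *\<^sub>R g x)"
    by (rule Lp_converges_restrict) (use q S in \<open>auto intro: borel_compact\<close>)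
  have "(\<lambda>x. indicat_real S x *\<^sub>R g x) = (\<lambda>x. indicator S x *\<^sub>R u x)"
    using SB by (auto simp: g_def indicator_def fun_eq_iff)
  with L1 have L1: "Lp_converges q (\<lambda>n x. indicator S x *\<^sub>R us n x) (\<lambda>x. indicator S x *\<^sub>R u x)" by simp
  have "Lp_converges p (\<lambda>n x. \<Sum>b\<in>Basis. indicator S x *\<^sub>R (conv (k b) (mollifier (\<delta> n)) x *\<^sub>R b))
      (\<lambda>x. \<Sum>b\<in>Basis. indicator S x *\<^sub>R (k b x *\<^sub>R b))"
  proof (rule Lp_converges_sum)
    fix b :: 'a assume b: "b \<in> Basis"
    have [measurable]: "k b \<in> borel_measurable borel" using k Lp_measurable by blast
    have "Lp_converges p (\<lambda>n x. conv (k b) (mollifier (\<delta> n)) x *\<^sub>R b) (\<lambda>x. k b x *\<^sub>R b)"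
    proof (rule Lp_converges_norm_le[OF Lp_converges_conv[OF k p \<delta>(1) \<delta>0, of b], where C = 1])
      show "Lp p (\<lambda>x. k b x *\<^sub>R b)"
        using b p by (intro Lp_norm_le[OF k(1)[of b], where C = 1]) auto
    qed (use b p in \<open>auto simp flip: scaleR_left_diff_distrib\<close>)
    then show "Lp_converges p (\<lambda>n x. indicator S x *\<^sub>R (conv (k b) (mollifier (\<delta> n)) x *\<^sub>R b))
       (\<lambda>x. indicator S x *\<^sub>R (k b x *\<^sub>R b))"
      by (rule Lp_converges_restrict) (use p S in \<open>auto intro: borel_compact\<close>)
  qed (use p in auto)
  moreover have "(\<Sum>b\<in>Basis. indicator S x *\<^sub>R (conv (k b) (mollifier (\<delta> n)) x *\<^sub>R b)) = indicator S x *\<^sub>R Us n x" for n x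
  proof (cases "x \<in> S")
    case True
    have cb: "cball x (\<delta> n) \<subseteq> B" using True \<delta>(2)[of n] by (force simp: B_def)
    have "conv (k b) (mollifier (\<delta> n)) x = Us n x \<bullet> b" if "b \<in> Basis" for b
      unfolding Us_def us_def
    proof (rule grad_conv_mollifier[OF w \<delta>(1) _ that g(2), symmetric])
      show "cball x (\<delta> n) \<subseteq> \<Omega>" using cb r(2) by (auto simp: B_def)
    qed (use cb in \<open>auto simp: g_def k_def indicator_def\<close>)
    then show ?thesis using True by (simp add: euclidean_representation)
  qed simp
  moreover have "(\<Sum>b\<in>Basis. indicator S x *\<^sub>R (k b x *\<^sub>R b)) = indicator S x *\<^sub>R G x" for x
    using SB by (cases "x \<in> S") (auto simp: k_def indicator_def euclidean_representation)
  ultimately have L2: "Lp_converges p (\<lambda>n x. indicator S x *\<^sub>R Us n x) (\<lambda>x. indicator S x *\<^sub>R G x)"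
    by simp
  obtain \<sigma> where \<sigma>: "strict_mono \<sigma>"
    "AE x in lborel. (\<lambda>n. indicator S x *\<^sub>R us (\<sigma> n) x) \<longlonglongrightarrow> indicator S x *\<^sub>R u x"
    using Lp_converges_AE_subseq[OF L1] q by auto
  show thesis
  proof (rule that[of "\<lambda>n. us (\<sigma> n)" "\<lambda>n. Us (\<sigma> n)"])
    show "AE x in lborel. x \<in> S \<longrightarrow> (\<lambda>n. us (\<sigma> n) x) \<longlonglongrightarrow> u x"
      using \<sigma>(2) by eventually_elim auto
    show "(\<forall>x. 0 \<le> u x) \<longrightarrow> (\<forall>n x. 0 \<le> us (\<sigma> n) x)"
      unfolding us_def conv_def g_def
      by (auto intro!: Bochner_Integration.integral_nonneg mult_nonneg_nonneg simp: mollifier_nonneg)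
    show "(\<forall>x. u x = 0) \<longrightarrow> (\<forall>n x. us (\<sigma> n) x = 0)"
      by (simp add: us_def conv_def g_def)
  qed (use C Lp_converges_subseq[OF L1 \<sigma>(1)] Lp_converges_subseq[OF L2 \<sigma>(1)] in auto)
qed

section \<open>Test functions depending on a Sobolev function\<close>

text \<open>\<open>D\<close> contains the values of the weakly differentiable function substituted for the first argument:
  it is \<^term>\<open>{0::real..}\<close> for a supersolution and \<^term>\<open>UNIV :: real set\<close> for a difference of solutions.\<close>

locale C1_function_on =
  fixes D :: "real set" and \<Psi> Pv Ps :: "real \<Rightarrow> real \<Rightarrow> real"
  assumes convex: "convex D"
    and deriv: "\<And>v s. v \<in> D \<Longrightarrow>
      ((\<lambda>z. \<Psi> (fst z) (snd z)) has_derivative (\<lambda>z. Pv v s * fst z + Ps v s * snd z)) (at (v, s))"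
    and cont_v: "continuous_on (D \<times> UNIV) (\<lambda>z. Pv (fst z) (snd z))"
    and cont_s: "continuous_on (D \<times> UNIV) (\<lambda>z. Ps (fst z) (snd z))"
    and zero: "\<And>v. v \<in> D \<Longrightarrow> \<Psi> v 0 = 0" "\<And>v. v \<in> D \<Longrightarrow> Pv v 0 = 0"
    and locally_bounded: "\<And>M. \<exists>C. \<forall>v\<in>D. \<forall>s. \<bar>s\<bar> \<le> M \<longrightarrow> \<bar>Pv v s\<bar> \<le> C \<and> \<bar>Ps v s\<bar> \<le> C"
begin

lemma deriv_v:
  assumes "v \<in> D" shows "((\<lambda>v. \<Psi> v s) has_derivative (\<lambda>h. Pv v s * h)) (at v)"
proof -
  have P: "((\<lambda>v. (v, s)) has_derivative (\<lambda>h. (h, 0))) (at v)"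
    by (auto intro!: derivative_eq_intros)
  show ?thesis using has_derivative_compose[OF P deriv[OF assms]] by simp
qed

lemma deriv_s:
  assumes "v \<in> D" shows "((\<lambda>s. \<Psi> v s) has_derivative (\<lambda>h. Ps v s * h)) (at s)"
proof -
  have P: "((\<lambda>s. (v, s)) has_derivative (\<lambda>h. (0, h))) (at s)"
    by (auto intro!: derivative_eq_intros)
  show ?thesis using has_derivative_compose[OF P deriv[OF assms]] by simp
qed

lemma lipschitz_v:
  assumes "\<And>v. v \<in> D \<Longrightarrow> \<bar>Pv v s\<bar> \<le> C" "a \<in> D" "b \<in> D"
  shows "\<bar>\<Psi> a s - \<Psi> b s\<bar> \<le> C * \<bar>a - b\<bar>"
proof -
  have "norm (\<Psi> a s - \<Psi> b s) \<le> C * norm (a - b)"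
  proof (rule differentiable_bound[OF convex _ _ assms(2,3)])
    fix v assume v: "v \<in> D"
    show "((\<lambda>v. \<Psi> v s) has_derivative (\<lambda>h. Pv v s * h)) (at v within D)"
      using deriv_v[OF v] by (rule has_derivative_at_withinI)
    show "onorm (\<lambda>h. Pv v s * h) \<le> C"
      using assms(1)[OF v] by (intro onorm_le) (auto simp: abs_mult mult_right_mono)
  qed
  then show ?thesis by simp
qed

lemma lipschitz_s:
  assumes "\<And>s. s \<in> X \<Longrightarrow> \<bar>Ps v s\<bar> \<le> C" "v \<in> D" "convex X" "a \<in> X" "b \<in> X"
  shows "\<bar>\<Psi> v a - \<Psi> v b\<bar> \<le> C * \<bar>a - b\<bar>"
proof -
  have "norm (\<Psi> v a - \<Psi> v b) \<le> C * norm (a - b)"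
  proof (rule differentiable_bound[OF assms(3) _ _ assms(4,5)])
    fix s assume s: "s \<in> X"
    show "((\<lambda>s. \<Psi> v s) has_derivative (\<lambda>h. Ps v s * h)) (at s within X)"
      using deriv_s[OF assms(2)] by (rule has_derivative_at_withinI)
    show "onorm (\<lambda>h. Ps v s * h) \<le> C"
      using assms(1)[OF s] by (intro onorm_le) (auto simp: abs_mult mult_right_mono)
  qed
  then show ?thesis by simp
qed

lemma continuous: "continuous_on (D \<times> UNIV) (\<lambda>z. \<Psi> (fst z) (snd z))"
proof (rule continuous_at_imp_continuous_on, rule ballI)
  fix z :: "real \<times> real" assume "z \<in> D \<times> UNIV"
  then show "isCont (\<lambda>z. \<Psi> (fst z) (snd z)) z"
    using has_derivative_continuous[OF deriv[of "fst z" "snd z"]] by auto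
qed

text \<open>\<open>P\<close> is continuous only on D x UNIV, hence the passage through
  \<open>restrict_space\<close>.\<close>

lemma measurable_composition:
  fixes v \<phi> :: "'a::euclidean_space \<Rightarrow> real"
  assumes "continuous_on (D \<times> UNIV) (\<lambda>z. P (fst z) (snd z) :: real)"
    and [measurable]: "v \<in> borel_measurable borel" "\<phi> \<in> borel_measurable borel" and "\<And>x. v x \<in> D"
  shows "(\<lambda>x. P (v x) (\<phi> x)) \<in> borel_measurable borel"
proof -
  have "(\<lambda>x. (v x, \<phi> x)) \<in> borel \<rightarrow>\<^sub>M restrict_space borel (D \<times> UNIV)"
    using assms(4) by (intro measurable_restrict_space2) auto
  from measurable_compose[OF this borel_measurable_continuous_on_restrict[OF assms(1)]]
  show ?thesis by simp
qed

lemmas measurable_\<Psi> = measurable_composition[OF continuous]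
  and measurable_Pv = measurable_composition[OF cont_v]
  and measurable_Ps = measurable_composition[OF cont_s]

lemma tendsto_composition:
  assumes "continuous_on (D \<times> UNIV) (\<lambda>z. P (fst z) (snd z) :: real)"
    "\<And>n. vs n \<in> D" "v \<in> D" "vs \<longlonglongrightarrow> v" "ss \<longlonglongrightarrow> s"
  shows "(\<lambda>n::nat. P (vs n) (ss n)) \<longlonglongrightarrow> P v s"
  using continuous_on_tendsto_compose[OF assms(1), of "\<lambda>n. (vs n, ss n)" "(v, s)" sequentially] assms
  by (auto intro!: tendsto_Pair)

lemma C1_composition:
  assumes v: "C1 v V" "\<And>x. v x \<in> D" and \<phi>: "C1 \<phi> \<Phi>"
  shows "C1 (\<lambda>x. \<Psi> (v x) (\<phi> x)) (\<lambda>x. Pv (v x) (\<phi> x) *\<^sub>R V x + Ps (v x) (\<phi> x) *\<^sub>R \<Phi> x)"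
  unfolding C1_def
proof (intro conjI allI)
  fix x
  have "((\<lambda>x. (v x, \<phi> x)) has_derivative (\<lambda>h. (V x \<bullet> h, \<Phi> x \<bullet> h))) (at x)"
    using v \<phi> by (intro has_derivative_Pair) (auto simp: C1_def)
  from has_derivative_compose[OF this deriv[OF v(2)]]
  show "((\<lambda>x. \<Psi> (v x) (\<phi> x)) has_derivative
      (\<lambda>h. (Pv (v x) (\<phi> x) *\<^sub>R V x + Ps (v x) (\<phi> x) *\<^sub>R \<Phi> x) \<bullet> h)) (at x)"
    by (simp add: inner_add_left)
next
  have c: "continuous_on UNIV (\<lambda>x. P (v x) (\<phi> x))"
    if "continuous_on (D \<times> UNIV) (\<lambda>z. P (fst z) (snd z))" for P :: "real \<Rightarrow> real \<Rightarrow> real"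
    using continuous_on_compose2[OF that, of UNIV "\<lambda>x. (v x, \<phi> x)"] v(2)
      C1_continuous[OF v(1), of UNIV] C1_continuous[OF \<phi>, of UNIV]
    by (auto intro!: continuous_on_Pair)
  show "continuous_on UNIV (\<lambda>x. Pv (v x) (\<phi> x) *\<^sub>R V x + Ps (v x) (\<phi> x) *\<^sub>R \<Phi> x)"
    by (intro continuous_on_add continuous_on_scaleR c cont_v cont_s
        C1_grad_continuous[OF v(1)] C1_grad_continuous[OF \<phi>])
qed

text \<open>v is replaced by its mollifications near S; since \<Psi> a 0 = 0, the composites vanish
  outside S and are C^1 with compact support. The bound M on \<phi> confines the partial derivatives
  to a bound C, so that they act as bounded, a.e. convergent coefficients. The clause
  \<open>fs n x = \<Psi> a (\<phi> x)\<close> hands properties of \<Psi>, such as its sign, on to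
  the approximations.\<close>

lemma approximate_C1c:
  fixes v :: "'a::euclidean_space \<Rightarrow> real"
  assumes w: "wgrad \<Omega> v G" and v: "Lp q v" and G: "Lp p G" and q: "1 \<le> q" and p: "1 \<le> p"
    and \<Omega>: "open \<Omega>" and \<phi>: "C1c S \<phi> \<Phi>" "S \<subseteq> \<Omega>"
    and D: "D = UNIV \<or> D = {0..} \<and> (\<forall>x. 0 \<le> v x)"
  obtains fs Fs where "\<And>n. C1c S (fs n) (Fs n)" "\<And>n x. \<exists>a\<in>D. fs n x = \<Psi> a (\<phi> x)"
    "Lp_converges q fs (\<lambda>x. \<Psi> (v x) (\<phi> x))"
    "Lp_converges p Fs (\<lambda>x. Pv (v x) (\<phi> x) *\<^sub>R G x + Ps (v x) (\<phi> x) *\<^sub>R \<Phi> x)"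
proof -
  have S: "compact S" and \<phi>C: "C1 \<phi> \<Phi>" and \<phi>0: "\<And>x. x \<notin> S \<Longrightarrow> \<phi> x = 0"
    using \<phi> by (auto simp: C1c_def)
  note \<Phi>0 = C1c_grad_eq_0[OF \<phi>(1)]
  obtain us Us where us: "\<And>n. C1 (us n) (Us n)"
    "Lp_converges q (\<lambda>n x. indicator S x *\<^sub>R us n x) (\<lambda>x. indicator S x *\<^sub>R v x)"
    "Lp_converges p (\<lambda>n x. indicator S x *\<^sub>R Us n x) (\<lambda>x. indicator S x *\<^sub>R G x)"
    "AE x in lborel. x \<in> S \<longrightarrow> (\<lambda>n. us n x) \<longlonglongrightarrow> v x"
    "(\<forall>x. 0 \<le> v x) \<longrightarrow> (\<forall>n x. 0 \<le> us n x)"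
    by (rule mollify_local[OF w v G q p S \<Omega> \<phi>(2)]) (rule that)
  have vD: "v x \<in> D" and usD: "us n x \<in> D" for n x using D us(5) by auto
  obtain M where M: "\<And>x. \<bar>\<phi> x\<bar> \<le> M" "0 \<le> M" using C1c_bounded[OF \<phi>(1)] by metis
  obtain C where C: "\<And>v s. v \<in> D \<Longrightarrow> \<bar>s\<bar> \<le> M \<Longrightarrow> \<bar>Pv v s\<bar> \<le> C \<and> \<bar>Ps v s\<bar> \<le> C"
    using locally_bounded[of M] by blast
  have [measurable]: "\<phi> \<in> borel_measurable borel" "v \<in> borel_measurable borel" "us n \<in> borel_measurable borel" for n
    using C1_measurable[OF \<phi>C] Lp_measurable[OF v] C1_measurable[OF us(1)] by auto
  have [measurable]: "S \<in> sets borel" using S by (rule borel_compact)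
  define fs where "fs n x = \<Psi> (us n x) (\<phi> x)" for n x
  define Fs where "Fs n x = Pv (us n x) (\<phi> x) *\<^sub>R Us n x + Ps (us n x) (\<phi> x) *\<^sub>R \<Phi> x" for n x
  have fC: "C1c S (fs n) (Fs n)" for n
    using C1_composition[OF us(1)[of n] usD[of n] \<phi>C] S \<phi>0 zero(1)[OF usD]
    unfolding C1c_def fs_def[abs_def] Fs_def[abs_def] by simp
  have L1: "Lp_converges q fs (\<lambda>x. \<Psi> (v x) (\<phi> x))"
  proof (rule Lp_converges_norm_le[OF us(2), where C = C])
    have lip: "\<bar>\<Psi> (v x) (\<phi> x) - \<Psi> (v x) 0\<bar> \<le> C * \<bar>\<phi> x - 0\<bar>" for x
      using M(1)[of x] M(2) C vD by (intro lipschitz_s[where X = "{- M..M}"]) (auto simp: abs_le_iff)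
    have le: "norm (\<Psi> (v x) (\<phi> x)) \<le> C * norm (\<phi> x)" for x
      using lip[of x] zero(1)[OF vD[of x]] by simp
    have "Lp q \<phi>" using C1c_Lp(1)[OF \<phi>(1), of q] q by simp
    then show "Lp q (\<lambda>x. \<Psi> (v x) (\<phi> x))"
      by (rule Lp_norm_le[OF _ _ measurable_\<Psi> le]) (use q vD in auto)
    show "norm (fs n x - \<Psi> (v x) (\<phi> x)) \<le> C * norm (indicat_real S x *\<^sub>R us n x - indicat_real S x *\<^sub>R v x)" for n x
    proof (cases "x \<in> S")
      case True
      then show ?thesis
        using lipschitz_v[of "\<phi> x" C "us n x" "v x"] C M vD usD by (simp add: fs_def)
    next
      case False
      then show ?thesis using \<phi>0 zero(1) vD usD by (simp add: fs_def)
    qed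
    show "fs n \<in> borel_measurable borel" for n
      unfolding fs_def by (intro measurable_\<Psi> usD) auto
  qed (use q in auto)
  \<comment> \<open>The mollifications converge on S only, so both factors are cut off by the
    indicator; outside S, \<phi> = 0 and hence Pv = 0, so nothing is lost.\<close>
  have L2: "Lp_converges p (\<lambda>n x. (indicator S x * Pv (us n x) (\<phi> x)) *\<^sub>R (indicator S x *\<^sub>R Us n x))
      (\<lambda>x. (indicator S x * Pv (v x) (\<phi> x)) *\<^sub>R (indicator S x *\<^sub>R G x))"
  proof (rule Lp_converges_scaleR[OF us(3), where C = "\<bar>C\<bar>"])
    have [measurable]: "(\<lambda>x. Pv (us n x) (\<phi> x)) \<in> borel_measurable borel" "(\<lambda>x. Pv (v x) (\<phi> x)) \<in> borel_measurable borel" for n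
      by (intro measurable_Pv usD vD; measurable)+
    show "(\<lambda>x. indicator S x * Pv (us n x) (\<phi> x)) \<in> borel_measurable borel"
      "(\<lambda>x. indicator S x * Pv (v x) (\<phi> x)) \<in> borel_measurable borel" for n by measurable
    show "\<bar>indicat_real S x * Pv (us n x) (\<phi> x)\<bar> \<le> \<bar>C\<bar>" "\<bar>indicat_real S x * Pv (v x) (\<phi> x)\<bar> \<le> \<bar>C\<bar>" for n x
      using C[OF usD M(1), of n x x] C[OF vD M(1), of x x] by (auto simp: indicator_def)
    show "AE x in lborel. (\<lambda>n. indicat_real S x * Pv (us n x) (\<phi> x)) \<longlonglongrightarrow> indicat_real S x * Pv (v x) (\<phi> x)"
      using us(4)
    proof eventually_elim
      case (elim x)
      then show ?case
        using usD vD by (cases "x \<in> S") (auto intro!: tendsto_composition[OF cont_v])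
    qed
  qed (use p in auto)
  have L3: "Lp_converges p (\<lambda>n x. (indicator S x * Ps (us n x) (\<phi> x)) *\<^sub>R \<Phi> x)
      (\<lambda>x. (indicator S x * Ps (v x) (\<phi> x)) *\<^sub>R \<Phi> x)"
  proof (rule Lp_converges_scaleR[OF Lp_converges_const, where C = "\<bar>C\<bar>"])
    show "Lp p \<Phi>" using C1c_Lp(2)[OF \<phi>(1)] p by simp
    have [measurable]: "(\<lambda>x. Ps (us n x) (\<phi> x)) \<in> borel_measurable borel" "(\<lambda>x. Ps (v x) (\<phi> x)) \<in> borel_measurable borel" for n
      by (intro measurable_Ps usD vD; measurable)+
    show "(\<lambda>x. indicator S x * Ps (us n x) (\<phi> x)) \<in> borel_measurable borel"
      "(\<lambda>x. indicator S x * Ps (v x) (\<phi> x)) \<in> borel_measurable borel" for n by measurable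
    show "\<bar>indicat_real S x * Ps (us n x) (\<phi> x)\<bar> \<le> \<bar>C\<bar>" "\<bar>indicat_real S x * Ps (v x) (\<phi> x)\<bar> \<le> \<bar>C\<bar>" for n x
      using C[OF usD M(1), of n x x] C[OF vD M(1), of x x] by (auto simp: indicator_def)
    show "AE x in lborel. (\<lambda>n. indicat_real S x * Ps (us n x) (\<phi> x)) \<longlonglongrightarrow> indicat_real S x * Ps (v x) (\<phi> x)"
      using us(4)
    proof eventually_elim
      case (elim x)
      then show ?case
        using usD vD by (cases "x \<in> S") (auto intro!: tendsto_composition[OF cont_s])
    qed
  qed (use p in auto)
  have "Lp_converges p Fs (\<lambda>x. Pv (v x) (\<phi> x) *\<^sub>R G x + Ps (v x) (\<phi> x) *\<^sub>R \<Phi> x)"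
  proof -
    have "(\<lambda>n x. (indicator S x * Pv (us n x) (\<phi> x)) *\<^sub>R (indicator S x *\<^sub>R Us n x)
        + (indicator S x * Ps (us n x) (\<phi> x)) *\<^sub>R \<Phi> x) = Fs"
      using \<Phi>0 \<phi>0 zero(2)[OF usD] by (auto simp: Fs_def indicator_def fun_eq_iff)
    moreover have "(\<lambda>x. (indicator S x * Pv (v x) (\<phi> x)) *\<^sub>R (indicator S x *\<^sub>R G x)
        + (indicator S x * Ps (v x) (\<phi> x)) *\<^sub>R \<Phi> x) = (\<lambda>x. Pv (v x) (\<phi> x) *\<^sub>R G x + Ps (v x) (\<phi> x) *\<^sub>R \<Phi> x)"
      using \<Phi>0 \<phi>0 zero(2)[OF vD] by (auto simp: indicator_def fun_eq_iff)
    ultimately show ?thesis using Lp_converges_add[OF L2 L3] p by simp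
  qed
  note L = this
  have ex: "\<exists>a\<in>D. fs n x = \<Psi> a (\<phi> x)" for n x
    unfolding fs_def by (rule bexI[OF refl usD])
  show thesis by (rule that[OF fC ex L1 L])
qed

end

text \<open>f times a test function is C^1 with compact support, so the integral of its gradient is
  0; expand by the product rule. This makes \<open>grad_conv_mollifier\<close> available for C^1
  functions.\<close>

lemma C1c_wgrad:
  assumes f: "C1c S f F" shows "wgrad UNIV f F"
  unfolding wgrad_def
proof (intro allI impI)
  fix \<phi> :: "'a \<Rightarrow> real" and b :: 'a assume \<phi>: "test_fun UNIV \<phi>"
  then have \<phi>C: "C1 \<phi> (grad \<phi>)" by (simp add: test_fun_def smooth_fun_C1)
  have "C1c S (\<lambda>x. f x * \<phi> x) (\<lambda>x. f x *\<^sub>R grad \<phi> x + \<phi> x *\<^sub>R F x)"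
    unfolding C1c_def C1_def
  proof (intro conjI allI impI)
    have fd: "(f has_derivative (\<lambda>h. F x \<bullet> h)) (at x)" and \<phi>d: "(\<phi> has_derivative (\<lambda>h. grad \<phi> x \<bullet> h)) (at x)" for x
      using f \<phi>C by (auto simp: C1c_def C1_def)
    show "((\<lambda>x. f x * \<phi> x) has_derivative (\<lambda>h. (f x *\<^sub>R grad \<phi> x + \<phi> x *\<^sub>R F x) \<bullet> h)) (at x)" for x
      using has_derivative_mult[OF fd \<phi>d, of x] by (simp add: inner_add_left mult.commute)
    show "continuous_on UNIV (\<lambda>x. f x *\<^sub>R grad \<phi> x + \<phi> x *\<^sub>R F x)"
      using f \<phi>C by (intro continuous_intros) (auto simp: C1c_def C1_continuous C1_grad_continuous)
  qed (use f in \<open>auto simp: C1c_def\<close>)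
  from C1c_integral_grad[OF this, of b]
  have 0: "(LINT x|lborel. f x * (grad \<phi> x \<bullet> b) + (F x \<bullet> b) * \<phi> x) = 0"
    by (simp add: inner_add_left mult.commute)
  obtain C where C: "\<And>x. \<bar>\<phi> x\<bar> \<le> C" "\<And>x. norm (grad \<phi> x) \<le> C"
    using C1c_bounded[OF test_fun_C1c[OF \<phi>]] by metis
  note [measurable] = C1_measurable[OF \<phi>C]
  have 1: "integrable lborel (\<lambda>x. f x * (grad \<phi> x \<bullet> b))"
  proof -
    have "\<bar>grad \<phi> x \<bullet> b\<bar> \<le> C * norm b" for x
      using Cauchy_Schwarz_ineq2[of "grad \<phi> x" b] mult_right_mono[OF C(2)[of x], of "norm b"] by simp
    then show ?thesis
      using integrable_mult_bounded[OF C1c_integrable(1)[OF f], of "\<lambda>x. grad \<phi> x \<bullet> b" "C * norm b"] by (simp add: mult.commute)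
  qed
  have 2: "integrable lborel (\<lambda>x. (F x \<bullet> b) * \<phi> x)"
  proof -
    have "integrable lborel (\<lambda>x. F x \<bullet> b)"
      using C1c_integrable(2)[OF f] by (rule integrable_inner_left)
    from integrable_mult_bounded[OF this, of \<phi> C] show ?thesis using C(1) by (simp add: mult.commute)
  qed
  show "(LINT x|lborel. f x * (grad \<phi> x \<bullet> b)) = - (LINT x|lborel. (F x \<bullet> b) * \<phi> x)"
    using 0 1 2 by simp
qed

text \<open>Mollification with radius at most r keeps the support in the r-neighbourhood of S and
  preserves the sign, so inequalities for nonnegative smooth test functions pass to nonnegative C^1
  ones.\<close>

lemma approximate_test_fun:
  fixes f :: "'a::euclidean_space \<Rightarrow> real"
  assumes f: "C1c S f F" and \<Omega>: "open \<Omega>" "S \<subseteq> \<Omega>" and q: "1 \<le> q" and p: "1 \<le> p" and pos: "\<And>x. 0 \<le> f x"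
  obtains \<phi> where "\<And>n. test_fun \<Omega> (\<phi> n)" "\<And>n x. 0 \<le> \<phi> n x"
    "Lp_converges q \<phi> f" "Lp_converges p (\<lambda>n. grad (\<phi> n)) F"
proof -
  have S: "compact S" and f0: "\<And>x. x \<notin> S \<Longrightarrow> f x = 0" using f by (auto simp: C1c_def)
  obtain r where r: "r > 0" "(\<Union>x\<in>S. cball x r) \<subseteq> \<Omega>" "compact (\<Union>x\<in>S. cball x r)"
    using compact_neighbourhood[OF S \<Omega>] by blast
  define \<delta> where "\<delta> n = r / real (Suc n)" for n
  have \<delta>: "\<delta> n > 0" "\<delta> n \<le> r" for n using r(1) by (auto simp: \<delta>_def field_simps)
  have \<delta>0: "\<delta> \<longlonglongrightarrow> 0" unfolding \<delta>_def[abs_def]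
    using tendsto_mult[OF tendsto_const[of r] LIMSEQ_inverse_real_of_nat] by (simp add: divide_inverse)
  note int = C1c_integrable[OF f]
  note Lpf = C1c_Lp[OF f]
  define \<phi> where "\<phi> n = conv f (mollifier (\<delta> n))" for n
  have sm: "smooth_fun (\<phi> n)" for n unfolding \<phi>_def by (rule conv_mollifier_smooth[OF int(1) \<delta>(1)])
  show thesis
  proof (rule that)
    show "test_fun \<Omega> (\<phi> n)" for n
    proof (rule test_funI[OF sm r(3) r(2)])
      fix x assume x: "x \<notin> (\<Union>x\<in>S. cball x r)"
      have "f y * mollifier (\<delta> n) (x - y) = 0" for y
      proof (cases "y \<in> S")
        case True
        then have "r < norm (x - y)" using x by (auto simp: dist_norm norm_minus_commute)
        then show ?thesis using \<delta>[of n] by (simp add: mollifier_eq_0)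
      qed (simp add: f0)
      then have "(\<lambda>y. f y * mollifier (\<delta> n) (x - y)) = (\<lambda>_. 0)" by (rule ext)
      then show "\<phi> n x = 0" unfolding \<phi>_def conv_def by (simp only: integral_zero)
    qed
    show "0 \<le> \<phi> n x" for n x
      unfolding \<phi>_def conv_def
      by (intro Bochner_Integration.integral_nonneg mult_nonneg_nonneg pos mollifier_nonneg)
    show "Lp_converges q \<phi> f"
      unfolding \<phi>_def[abs_def] using Lpf q by (intro Lp_converges_conv int q \<delta>(1) \<delta>0) auto
    have "Lp_converges p (\<lambda>n x. \<Sum>b\<in>Basis. conv (\<lambda>x. F x \<bullet> b) (mollifier (\<delta> n)) x *\<^sub>R b) (\<lambda>x. \<Sum>b\<in>Basis. (F x \<bullet> b) *\<^sub>R b)"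
    proof (rule Lp_converges_sum)
      fix b :: 'a assume b: "b \<in> Basis"
      have F: "Lp p F" using Lpf p by auto
      note [measurable] = Lp_measurable[OF F]
      have k: "Lp p (\<lambda>x. F x \<bullet> b)"
        using Cauchy_Schwarz_ineq2[of _ b] b p by (intro Lp_norm_le[OF F, where C = 1]) auto
      show "Lp_converges p (\<lambda>n x. conv (\<lambda>x. F x \<bullet> b) (mollifier (\<delta> n)) x *\<^sub>R b) (\<lambda>x. (F x \<bullet> b) *\<^sub>R b)"
      proof (rule Lp_converges_norm_le[OF Lp_converges_conv[OF k integrable_inner_left[OF int(2)] p \<delta>(1) \<delta>0], where C = 1])
        show "Lp p (\<lambda>x. (F x \<bullet> b) *\<^sub>R b)"
          using b p by (intro Lp_norm_le[OF k, where C = 1]) auto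
      qed (use b p in \<open>auto simp flip: scaleR_left_diff_distrib\<close>)
    qed (use p in auto)
    moreover have "(\<Sum>b\<in>Basis. conv (\<lambda>x. F x \<bullet> b) (mollifier (\<delta> n)) x *\<^sub>R b) = grad (\<phi> n) x" for n x
    proof -
      have "conv (\<lambda>x. F x \<bullet> b) (mollifier (\<delta> n)) x = grad (\<phi> n) x \<bullet> b" if "b \<in> Basis" for b
        unfolding \<phi>_def by (rule grad_conv_mollifier[OF C1c_wgrad[OF f] \<delta>(1) _ that int(1), symmetric]) auto
      then show ?thesis by (simp add: euclidean_representation)
    qed
    ultimately show "Lp_converges p (\<lambda>n. grad (\<phi> n)) F"
      by (simp add: euclidean_representation)
  qed
qed

section \<open>The Picone inequality\<close>

text \<open>In the application a = |grad u| / U and b = |grad v| / V. Put k = p d^2 + m, so that c =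
  \<theta> k. Young's inequality for both mixed terms leaves (1 - 1 / p) (1 - \<theta>) k (b^p -
  a^p), which is 0 for \<theta> = 1; in general the negative part is kept as the error. Its
  coefficient is at most p (1 - \<theta>), because k <= p + 1 and (1 - 1 / p) (p + 1) <= p.\<close>

lemma picone_scalar:
  fixes a b d p \<theta> :: real
  assumes p: "1 < p" and ab: "0 \<le> a" "0 \<le> b" and d: "0 \<le> d" "d \<le> 1" and \<theta>: "0 \<le> \<theta>" "\<theta> \<le> 1"
  defines "m \<equiv> 2 * d * (1 - d)" and "c \<equiv> (p - 2) * \<theta> * d\<^sup>2 + 2 * d * \<theta>"
  shows "((1 - p) * d\<^sup>2 + c) * a powr p - m * (a powr (p - 1) * b)
    - c * (b powr (p - 1) * a) + ((p - 1) * d\<^sup>2 + m) * b powr p \<ge> - (p * (1 - \<theta>) * a powr p)"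
proof -
  define k where "k = p * d\<^sup>2 + m"
  define A where "A = a powr p"
  define B where "B = b powr p"
  have c: "c = \<theta> * k" by (simp add: c_def k_def m_def algebra_simps power2_eq_square)
  have m: "0 \<le> m" using d by (simp add: m_def)
  have k: "0 \<le> k" using p m by (simp add: k_def)
  have d2: "d\<^sup>2 \<le> 1" using d by (simp add: power_le_one)
  have m1: "m \<le> 1" using zero_le_power2[of "d - 1 / 2"] by (simp add: m_def power2_eq_square algebra_simps)
  have "p * d\<^sup>2 \<le> p * 1" using d2 p by (intro mult_left_mono) auto
  then have "k \<le> p + 1" using m1 by (simp add: k_def)
  then have "(1 - 1 / p) * k \<le> (1 - 1 / p) * (p + 1)"
    using p by (intro mult_left_mono) auto
  also have "\<dots> \<le> p" using p by (simp add: field_simps)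
  finally have kp: "(1 - 1 / p) * k \<le> p" .
  have 1: "m * (a powr (p - 1) * b) \<le> m * ((1 - 1 / p) * A + B / p)"
    unfolding A_def B_def using p ab m by (intro mult_left_mono Youngs_powr) auto
  have 2: "c * (b powr (p - 1) * a) \<le> c * ((1 - 1 / p) * B + A / p)"
    unfolding A_def B_def c using p ab k \<theta> by (intro mult_left_mono Youngs_powr) auto
  have A: "0 \<le> A" and B: "0 \<le> B" by (auto simp: A_def B_def)
  have "((1 - p) * d\<^sup>2 + c) * A - m * ((1 - 1 / p) * A + B / p) - c * ((1 - 1 / p) * B + A / p) + ((p - 1) * d\<^sup>2 + m) * B
     = (1 - 1 / p) * ((1 - \<theta>) * (k * B)) - (1 - \<theta>) * ((1 - 1 / p) * k) * A"
    using p unfolding c k_def by (simp add: field_simps)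
  also have "\<dots> \<ge> 0 - (1 - \<theta>) * p * A"
  proof (intro diff_mono)
    show "0 \<le> (1 - 1 / p) * ((1 - \<theta>) * (k * B))"
      using p \<theta> k B by simp
    show "(1 - \<theta>) * ((1 - 1 / p) * k) * A \<le> (1 - \<theta>) * p * A"
      using \<theta> A kp by (intro mult_right_mono mult_left_mono) auto
  qed
  finally show ?thesis using 1 2 unfolding A_def[symmetric] B_def[symmetric] by (simp add: mult_ac)
qed

lemma has_derivative_compose_real:
  fixes g :: "real \<Rightarrow> real"
  assumes "(f has_derivative f') (at x)" "(g has_real_derivative D) (at y)" "f x = y"
  shows "((\<lambda>z. g (f z)) has_derivative (\<lambda>h. D * f' h)) (at x)"
  using has_derivative_compose[of f f' x UNIV g "\<lambda>h. D * h"] assms by (simp add: has_field_derivative_def)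

text \<open>Squaring removes the corner of the positive part: at 0 the difference quotient is at
  most |h|.\<close>

lemma has_derivative_max_square:
  "((\<lambda>x. (max x 0)\<^sup>2) has_real_derivative 2 * max x 0) (at (x :: real))"
proof -
  consider "x < 0" | "x = 0" | "x > 0" by linarith
  then show ?thesis
  proof cases
    case 1
    have "((\<lambda>_. 0) has_real_derivative 0) (at x)" by simp
    then have "((\<lambda>x. (max x 0)\<^sup>2) has_real_derivative 0) (at x)"
      by (rule has_field_derivative_transform_within_open[where S = "{..<0}"]) (use 1 in auto)
    then show ?thesis using 1 by simp
  next
    case 2
    have "((\<lambda>h::real. (max h 0)\<^sup>2 / h) \<longlongrightarrow> 0) (at 0)"
    proof (rule Lim_null_comparison)
      show "\<forall>\<^sub>F h in at 0. norm ((max h 0)\<^sup>2 / h) \<le> \<bar>h\<bar>" for h :: real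
        by (auto simp: max_def power2_eq_square)
      show "((\<lambda>h::real. \<bar>h\<bar>) \<longlongrightarrow> 0) (at 0)" by (auto intro!: tendsto_eq_intros)
    qed
    then show ?thesis using 2 by (simp add: has_field_derivative_iff)
  next
    case 3
    have "((\<lambda>x. x\<^sup>2) has_real_derivative 2 * x) (at x)" by (auto intro!: derivative_eq_intros)
    then have "((\<lambda>x. (max x 0)\<^sup>2) has_real_derivative 2 * x) (at x)"
      by (rule has_field_derivative_transform_within_open[where S = "{0<..}"]) (use 3 in auto)
    then show ?thesis using 3 by simp
  qed
qed

text \<open>The test function for the subsolution is \<open>\<Psi> 1\<close> (where \<open>RR 1 = UU\<close>), the one for the supersolution
  is \<open>\<Psi> 0\<close> (where \<open>RR 0 = VV\<close>); \<open>s\<close> stands for \<open>(u - v)\<^sub>+\<close>, so that \<open>UU\<close> is \<open>u + \<epsilon>\<close> wherever \<open>v < u\<close>,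
  and \<open>Pv\<close>, \<open>Ps\<close> are the partial derivatives of \<open>\<Psi>\<close>.\<close>

locale picone_test =
  fixes p \<epsilon> K :: real
  assumes p: "1 < p" and \<epsilon>: "0 < \<epsilon>" and K: "0 < K"
begin

definition "VV v = v + \<epsilon>" for v
definition "UU v s = v + \<epsilon> + max s 0" for v s
definition "TT v s = K * UU v s / (K + UU v s)" for v s
text \<open>\<theta> has two roles: it is TT / UU, and it is the elasticity UU TT' / TT of the
  truncation x |-> K x / (K + x).\<close>

definition "\<theta> v s = K / (K + UU v s)" for v s
definition "dd v s = max (TT v s - VV v) 0 / TT v s" for v s
definition "RR \<sigma> v s = v + \<epsilon> + \<sigma> * max s 0" for \<sigma> v s
definition "\<Psi> \<sigma> v s = RR \<sigma> v s powr (1 - p) * TT v s powr p * (dd v s)\<^sup>2" for \<sigma> v s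
text \<open>TT^p cc / UU is the derivative of TT^p dd^2 = TT^(p - 2) (TT - VV)_+^2 in UU for fixed
  VV; the derivative in VV is - TT^p 2 dd / TT. For s > 0 a change of s moves UU but not VV, a
  change of v moves both.\<close>

definition "cc v s = (p - 2) * \<theta> v s * (dd v s)\<^sup>2 + 2 * dd v s * \<theta> v s" for v s
definition "Pv \<sigma> v s = RR \<sigma> v s powr (1 - p) * TT v s powr p *
   ((1 - p) * (dd v s)\<^sup>2 / RR \<sigma> v s + cc v s / UU v s - 2 * dd v s / TT v s)" for \<sigma> v s
definition "Ps \<sigma> v s = RR \<sigma> v s powr (1 - p) * TT v s powr p *
   ((1 - p) * \<sigma> * (dd v s)\<^sup>2 / RR \<sigma> v s + cc v s / UU v s)" for \<sigma> v s

lemma eq_0: "dd v s = 0 \<Longrightarrow> \<Psi> \<sigma> v s = 0 \<and> Pv \<sigma> v s = 0 \<and> Ps \<sigma> v s = 0"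
  by (simp add: \<Psi>_def Pv_def Ps_def cc_def)

lemma \<Psi>_nonneg: "0 \<le> \<Psi> \<sigma> v s"
  by (simp add: \<Psi>_def)

context
  fixes v s :: real
  assumes v: "0 \<le> v"
begin

lemma V_pos: "0 < VV v" "\<epsilon> \<le> VV v"
  using v \<epsilon> by (auto simp: VV_def)

lemma U_ge: "VV v \<le> UU v s" "0 < UU v s"
  using v \<epsilon> by (auto simp: VV_def UU_def)

lemma R_ge:
  assumes "0 \<le> \<sigma>" shows "\<epsilon> \<le> RR \<sigma> v s" "0 < RR \<sigma> v s"
  using v \<epsilon> assms by (auto simp: RR_def add_pos_nonneg)

lemma T_bounds: "0 < TT v s" "TT v s < UU v s" "TT v s < K"
  using U_ge K by (auto simp: TT_def field_simps)

lemma \<theta>_bounds: "0 < \<theta> v s" "\<theta> v s \<le> 1"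
  using U_ge K by (auto simp: \<theta>_def)

lemma d_bounds: "0 \<le> dd v s" "dd v s \<le> 1" "dd v s < 1"
  using T_bounds V_pos by (auto simp: dd_def field_simps max_def)

lemma d_pos: "0 < dd v s \<longleftrightarrow> VV v < TT v s"
  using T_bounds by (auto simp: dd_def zero_less_divide_iff max_def)

lemma V_eq: "0 < dd v s \<Longrightarrow> VV v = (1 - dd v s) * TT v s"
  using T_bounds d_pos by (auto simp: dd_def field_simps max_def)

text \<open>dd > 0 means VV < TT < UU, and UU exceeds VV only for s > 0.\<close>

lemma d_pos_s: "0 < dd v s \<Longrightarrow> 0 < s"
proof (rule ccontr)
  assume "0 < dd v s" "\<not> 0 < s"
  then have "VV v < UU v s" "UU v s = VV v"
    using T_bounds d_pos by (auto simp: UU_def VV_def max_def)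
  then show False by simp
qed

text \<open>Where dd > 0, each of TT, UU and RR is at least \<epsilon>, and TT < K bounds the
  prefactor by \<epsilon>^(1 - p) K^p. The bracket is at most (p + (p + 3) + 2) / \<epsilon>. The
  bound is global in v and s.\<close>

lemma bounds:
  assumes \<sigma>: "0 \<le> \<sigma>" "\<sigma> \<le> 1"
  shows "\<bar>Pv \<sigma> v s\<bar> \<le> \<epsilon> powr (1 - p) * K powr p * ((4 * p + 4) / \<epsilon>)"
  "\<bar>Ps \<sigma> v s\<bar> \<le> \<epsilon> powr (1 - p) * K powr p * ((4 * p + 4) / \<epsilon>)"
proof -
  let ?C = "\<epsilon> powr (1 - p) * K powr p * ((4 * p + 4) / \<epsilon>)"
  have "\<bar>Pv \<sigma> v s\<bar> \<le> ?C \<and> \<bar>Ps \<sigma> v s\<bar> \<le> ?C"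
  proof (cases "dd v s = 0")
    case True
    then show ?thesis using eq_0 p \<epsilon> by auto
  next
    case False
    then have d: "0 < dd v s" using d_bounds by simp
    define M where "M = RR \<sigma> v s powr (1 - p) * TT v s powr p"
    have M: "0 \<le> M" "M \<le> \<epsilon> powr (1 - p) * K powr p"
    proof -
      have "RR \<sigma> v s powr (1 - p) \<le> \<epsilon> powr (1 - p)"
        using R_ge[OF \<sigma>(1)] p \<epsilon> by (intro powr_mono2') auto
      moreover have "TT v s powr p \<le> K powr p"
        using T_bounds p by (intro powr_mono2) auto
      ultimately show "0 \<le> M" "M \<le> \<epsilon> powr (1 - p) * K powr p"
        unfolding M_def by (auto intro!: mult_mono)
    qed
    have T: "\<epsilon> \<le> TT v s" using d_pos V_pos d by simp
    have U: "\<epsilon> \<le> UU v s" using U_ge V_pos by simp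
    have d2: "(dd v s)\<^sup>2 \<le> 1" using d_bounds by (simp add: power_le_one)
    have c: "\<bar>cc v s\<bar> \<le> p + 3"
    proof -
      have "\<bar>(p - 2) * (\<theta> v s * (dd v s)\<^sup>2)\<bar> \<le> (p + 1) * 1"
        unfolding abs_mult using p d2 \<theta>_bounds by (intro mult_mono) (auto intro: mult_le_one)
      moreover have "0 \<le> dd v s * \<theta> v s" "dd v s * \<theta> v s \<le> 1"
        using d_bounds \<theta>_bounds by (auto intro: mult_le_one)
      ultimately show ?thesis by (simp add: cc_def mult.assoc)
    qed
    have frac: "\<bar>x / y\<bar> \<le> z / \<epsilon>" if "\<bar>x\<bar> \<le> z" "\<epsilon> \<le> y" for x y z :: real
      using that \<epsilon> by (simp add: frac_le)
    have e1: "\<bar>(1 - p) * (dd v s)\<^sup>2 / RR \<sigma> v s\<bar> \<le> p / \<epsilon>"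
    proof (intro frac R_ge[OF \<sigma>(1)])
      have "(p - 1) * (dd v s)\<^sup>2 \<le> p * 1" using p d2 by (intro mult_mono) auto
      then show "\<bar>(1 - p) * (dd v s)\<^sup>2\<bar> \<le> p" using p by (simp add: abs_mult)
    qed
    have e1': "\<bar>(1 - p) * \<sigma> * (dd v s)\<^sup>2 / RR \<sigma> v s\<bar> \<le> p / \<epsilon>"
    proof (intro frac R_ge[OF \<sigma>(1)])
      have "(p - 1) * (\<sigma> * (dd v s)\<^sup>2) \<le> p * 1" using p d2 \<sigma> by (intro mult_mono) (auto intro: mult_le_one)
      then show "\<bar>(1 - p) * \<sigma> * (dd v s)\<^sup>2\<bar> \<le> p" using p \<sigma> by (simp add: abs_mult mult.assoc)
    qed
    have e2: "\<bar>cc v s / UU v s\<bar> \<le> (p + 3) / \<epsilon>" by (intro frac c U)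
    have e3: "\<bar>2 * dd v s / TT v s\<bar> \<le> 2 / \<epsilon>" using d_bounds by (intro frac T) auto
    have s: "(4 * p + 4) / \<epsilon> \<ge> p / \<epsilon> + (p + 3) / \<epsilon> + 2 / \<epsilon>"
      using p \<epsilon> by (simp add: field_simps)
    have "0 \<le> 2 / \<epsilon>" using \<epsilon> by simp
    have "\<bar>(1 - p) * (dd v s)\<^sup>2 / RR \<sigma> v s + cc v s / UU v s - 2 * dd v s / TT v s\<bar> \<le> (4 * p + 4) / \<epsilon>"
      using e1 e2 e3 s by linarith
    then have "\<bar>Pv \<sigma> v s\<bar> \<le> ?C"
      unfolding Pv_def M_def[symmetric] abs_mult[of M] using M by (intro mult_mono) auto
    moreover have "\<bar>(1 - p) * \<sigma> * (dd v s)\<^sup>2 / RR \<sigma> v s + cc v s / UU v s\<bar> \<le> (4 * p + 4) / \<epsilon>"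
      using e1' e2 \<open>0 \<le> 2 / \<epsilon>\<close> s by linarith
    then have "\<bar>Ps \<sigma> v s\<bar> \<le> ?C"
      unfolding Ps_def M_def[symmetric] abs_mult[of M] using M by (intro mult_mono) auto
    ultimately show ?thesis by blast
  qed
  then show "\<bar>Pv \<sigma> v s\<bar> \<le> ?C" "\<bar>Ps \<sigma> v s\<bar> \<le> ?C" by blast+
qed

text \<open>TT <= UU makes UU^(1 - p) TT^p at most TT, and where dd > 0, TT dd = TT - VV <= s. The
  bound involves neither \<epsilon> nor K, so it is a majorant for the passage to the limit; the
  weight VV^(1 - p) of \<open>\<Psi> 0\<close> admits no such argument.\<close>

lemma \<Psi>_le: "\<Psi> 1 v s \<le> max s 0"
proof (cases "dd v s = 0")
  case False
  then have d: "0 < dd v s" using d_bounds by simp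
  have "UU v s powr (1 - p) * TT v s powr p \<le> TT v s powr (1 - p) * TT v s powr p"
    using T_bounds p by (intro mult_right_mono powr_mono2') auto
  also have "\<dots> = TT v s" using T_bounds by (simp flip: powr_add)
  finally have "\<Psi> 1 v s \<le> TT v s * (dd v s)\<^sup>2"
    unfolding \<Psi>_def RR_def UU_def by (intro mult_right_mono) auto
  also have "\<dots> \<le> TT v s * dd v s"
    using d_bounds T_bounds by (intro mult_left_mono) (auto simp: power2_eq_square mult_left_le)
  also have "\<dots> = TT v s - VV v"
    using V_eq[OF d] by (simp add: algebra_simps)
  also have "\<dots> \<le> max s 0" using T_bounds(2) by (simp add: UU_def VV_def)
  finally show ?thesis .
qed (simp add: eq_0 \<Psi>_def)

end

lemma continuous_components:
  "continuous_on ({0..} \<times> UNIV) (\<lambda>z. UU (fst z) (snd z))"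
  "continuous_on ({0..} \<times> UNIV) (\<lambda>z. VV (fst z))"
  "continuous_on ({0..} \<times> UNIV) (\<lambda>z. RR \<sigma> (fst z) (snd z))"
  "continuous_on ({0..} \<times> UNIV) (\<lambda>z. TT (fst z) (snd z))"
  "continuous_on ({0..} \<times> UNIV) (\<lambda>z. \<theta> (fst z) (snd z))"
  "continuous_on ({0..} \<times> UNIV) (\<lambda>z. dd (fst z) (snd z))"
  "continuous_on ({0..} \<times> UNIV) (\<lambda>z. cc (fst z) (snd z))"
proof -
  show U: "continuous_on ({0..} \<times> UNIV) (\<lambda>z. UU (fst z) (snd z))"
    unfolding UU_def by (intro continuous_intros)
  show V: "continuous_on ({0..} \<times> UNIV) (\<lambda>z. VV (fst z))"
    unfolding VV_def by (intro continuous_intros)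
  show "continuous_on ({0..} \<times> UNIV) (\<lambda>z. RR \<sigma> (fst z) (snd z))"
    unfolding RR_def by (intro continuous_intros)
  have nz: "K + UU v s \<noteq> 0" if "0 \<le> v" for v s
    using U_ge(2)[OF that, of s] K by simp
  show T: "continuous_on ({0..} \<times> UNIV) (\<lambda>z. TT (fst z) (snd z))"
    unfolding TT_def using nz by (intro continuous_intros U) auto
  show \<theta>: "continuous_on ({0..} \<times> UNIV) (\<lambda>z. \<theta> (fst z) (snd z))"
    unfolding \<theta>_def using nz by (intro continuous_intros U) auto
  have "TT v s \<noteq> 0" if "0 \<le> v" for v s
    using T_bounds(1)[OF that, of s] by simp
  then show d: "continuous_on ({0..} \<times> UNIV) (\<lambda>z. dd (fst z) (snd z))"
    unfolding dd_def by (intro continuous_intros T V) auto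
  show "continuous_on ({0..} \<times> UNIV) (\<lambda>z. cc (fst z) (snd z))"
    unfolding cc_def by (intro continuous_intros d \<theta>)
qed

lemma continuous_partials:
  assumes \<sigma>: "0 \<le> \<sigma>" "\<sigma> \<le> 1"
  shows "continuous_on ({0..} \<times> UNIV) (\<lambda>z. Pv \<sigma> (fst z) (snd z))"
    "continuous_on ({0..} \<times> UNIV) (\<lambda>z. Ps \<sigma> (fst z) (snd z))"
proof -
  have nz: "TT v s \<noteq> 0" "UU v s \<noteq> 0" "RR \<sigma> v s \<noteq> 0" if "0 \<le> v" for v s
    using T_bounds(1)[OF that, of s] U_ge(2)[OF that, of s] R_ge(2)[OF that \<sigma>(1), of s] by auto
  show "continuous_on ({0..} \<times> UNIV) (\<lambda>z. Pv \<sigma> (fst z) (snd z))"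
    unfolding Pv_def using nz
    by (intro continuous_intros continuous_components) auto
  show "continuous_on ({0..} \<times> UNIV) (\<lambda>z. Ps \<sigma> (fst z) (snd z))"
    unfolding Ps_def using nz
    by (intro continuous_intros continuous_components) auto
qed

text \<open>The derivative is two-sided also at v = 0, since v + \<epsilon> stays positive nearby.
  For s <= 0, TT < UU = VV, so \<Psi> vanishes in a whole neighbourhood and the corner of max s 0 is
  never met; for s > 0 every factor is smooth except the squared positive part.\<close>

lemma has_derivative_\<Psi>:
  assumes v: "0 \<le> v" and \<sigma>: "0 \<le> \<sigma>" "\<sigma> \<le> 1"
  shows "((\<lambda>z. \<Psi> \<sigma> (fst z) (snd z)) has_derivative (\<lambda>z. Pv \<sigma> v s * fst z + Ps \<sigma> v s * snd z)) (at (v, s))"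
proof (cases "s > 0")
  case False
  \<comment> \<open>TT - VV written out, so that its continuity can be read off; it is negative at
    (v, s).\<close>
  define \<rho> where "\<rho> z = K * (fst z + \<epsilon> + max (snd z) 0) / (K + (fst z + \<epsilon> + max (snd z) 0)) - (fst z + \<epsilon>)" for z :: "real \<times> real"
  have \<rho>: "\<rho> z = TT (fst z) (snd z) - VV (fst z)" for z
    by (simp add: \<rho>_def TT_def UU_def VV_def)
  have "isCont \<rho> (v, s)"
    unfolding \<rho>_def using v \<epsilon> K by (intro continuous_intros) (auto simp: add_pos_nonneg)
  moreover have "\<rho> (v, s) < 0"
    using False T_bounds(2)[OF v, of s] unfolding \<rho> by (simp add: UU_def VV_def max_def split: if_splits)
  ultimately have ev: "\<forall>\<^sub>F z in nhds (v, s). \<rho> z < 0"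
    by (intro order_tendstoD(2)[where y = "\<rho> (v, s)"]) (auto simp: isCont_def tendsto_nhds_iff)
  have "((\<lambda>_. 0) has_derivative (\<lambda>_. 0)) (at (v, s))" by simp
  then have "((\<lambda>z. \<Psi> \<sigma> (fst z) (snd z)) has_derivative (\<lambda>_. 0)) (at (v, s))"
  proof (rule has_derivative_transform_eventually)
    have "\<forall>\<^sub>F z in nhds (v, s). 0 = \<Psi> \<sigma> (fst z) (snd z)"
      using ev by eventually_elim (simp add: \<rho> \<Psi>_def dd_def)
    then show "\<forall>\<^sub>F z in at (v, s). 0 = \<Psi> \<sigma> (fst z) (snd z)" "0 = \<Psi> \<sigma> (fst (v, s)) (snd (v, s))"
      by (auto simp: eventually_nhds_conv_at)
  qed auto
  moreover have "dd v s = 0" using d_pos_s[OF v, of s] d_bounds(1)[OF v, of s] False by force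
  ultimately show ?thesis using eq_0 by simp
next
  case True
  define w where "w z = fst z + \<epsilon>" for z :: "real \<times> real"
  define u where "u z = fst z + snd z + \<epsilon>" for z :: "real \<times> real"
  define R where "R z = fst z + \<sigma> * snd z + \<epsilon>" for z :: "real \<times> real"
  define T where "T z = K * u z / (K + u z)" for z
  let ?z = "(v, s)"
  have eqs: "w ?z = VV v" "u ?z = UU v s" "R ?z = RR \<sigma> v s" "T ?z = TT v s"
    using True by (simp_all add: w_def u_def R_def T_def VV_def UU_def RR_def TT_def algebra_simps)
  note pos = U_ge(2)[OF v, of s] R_ge(2)[OF v \<sigma>(1), of s] T_bounds(1)[OF v, of s] V_pos(1)[OF v]
  have pw: "x powr (r - 1) = x powr r / x" if "0 < x" for x r :: real
    using that by (simp add: powr_diff)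
  have dw: "(w has_derivative (\<lambda>h. fst h)) (at ?z)"
    unfolding w_def by (auto intro!: derivative_eq_intros)
  have du: "(u has_derivative (\<lambda>h. fst h + snd h)) (at ?z)"
    unfolding u_def by (auto intro!: derivative_eq_intros)
  have dR: "(R has_derivative (\<lambda>h. fst h + \<sigma> * snd h)) (at ?z)"
    unfolding R_def by (auto intro!: derivative_eq_intros)
  have "((\<lambda>x. K * x / (K + x)) has_real_derivative \<theta> v s * TT v s / UU v s) (at (UU v s))"
  proof -
    have "((\<lambda>x. K * x / (K + x)) has_real_derivative K * K / ((K + UU v s) * (K + UU v s))) (at (UU v s))"
      using pos K by (auto intro!: derivative_eq_intros simp: algebra_simps)
    moreover have "\<theta> v s * TT v s / UU v s = K * K / ((K + UU v s) * (K + UU v s))"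
      using pos by (simp add: \<theta>_def TT_def)
    ultimately show ?thesis by simp
  qed
  from has_derivative_compose_real[OF du this eqs(2)]
  have dT: "(T has_derivative (\<lambda>h. \<theta> v s * TT v s / UU v s * (fst h + snd h))) (at ?z)"
    unfolding T_def .
  have "((\<lambda>x. x powr (1 - p)) has_real_derivative (1 - p) * RR \<sigma> v s powr (1 - p) / RR \<sigma> v s) (at (RR \<sigma> v s))"
    using has_real_derivative_powr[OF pos(2), of "1 - p"] unfolding pw[OF pos(2)] times_divide_eq_right .
  from has_derivative_compose_real[OF dR this eqs(3)]
  have dX: "((\<lambda>z. R z powr (1 - p)) has_derivative (\<lambda>h. (1 - p) * RR \<sigma> v s powr (1 - p) / RR \<sigma> v s * (fst h + \<sigma> * snd h))) (at ?z)" .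
  \<comment> \<open>TT^p dd^2 is treated as TT^(p - 2) (TT - VV)_+^2, which avoids differentiating
    the quotient dd.\<close>
  have "((\<lambda>x. x powr (p - 2)) has_real_derivative (p - 2) * TT v s powr (p - 2) / TT v s) (at (TT v s))"
    using has_real_derivative_powr[OF pos(3), of "p - 2"] unfolding pw[OF pos(3)] times_divide_eq_right .
  from has_derivative_compose_real[OF dT this eqs(4)]
  have dY: "((\<lambda>z. T z powr (p - 2)) has_derivative (\<lambda>h. (p - 2) * TT v s powr (p - 2) / TT v s * (\<theta> v s * TT v s / UU v s * (fst h + snd h)))) (at ?z)" .
  have dQ: "((\<lambda>z. (max (T z - w z) 0)\<^sup>2) has_derivative
      (\<lambda>h. 2 * max (TT v s - VV v) 0 * (\<theta> v s * TT v s / UU v s * (fst h + snd h) - fst h))) (at ?z)"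
    using has_derivative_compose[OF has_derivative_diff[OF dT dw] has_derivative_max_square[unfolded has_field_derivative_def]]
    by (simp add: eqs)
  have d: "max (TT v s - VV v) 0 = dd v s * TT v s"
    using pos by (simp add: dd_def)
  have Tp: "TT v s powr p = TT v s powr (p - 2) * (TT v s)\<^sup>2"
    using pos(3) by (simp add: powr_diff)
  have "((\<lambda>z. R z powr (1 - p) * (T z powr (p - 2) * (max (T z - w z) 0)\<^sup>2)) has_derivative
      (\<lambda>z. Pv \<sigma> v s * fst z + Ps \<sigma> v s * snd z)) (at ?z)"
  proof (rule has_derivative_eq_rhs[OF has_derivative_mult[OF dX has_derivative_mult[OF dY dQ]]], rule ext)
    fix h :: "real \<times> real"
    obtain a b where h: "h = (a, b)" by fastforce
    define X where "X = RR \<sigma> v s powr (1 - p)"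
    define Y where "Y = TT v s powr (p - 2)"
    show "R ?z powr (1 - p) * (T ?z powr (p - 2) * (2 * max (TT v s - VV v) 0 * (\<theta> v s * TT v s / UU v s * (fst h + snd h) - fst h)) +
          (p - 2) * TT v s powr (p - 2) / TT v s * (\<theta> v s * TT v s / UU v s * (fst h + snd h)) * (max (T ?z - w ?z) 0)\<^sup>2) +
          (1 - p) * RR \<sigma> v s powr (1 - p) / RR \<sigma> v s * (fst h + \<sigma> * snd h) * (T ?z powr (p - 2) * (max (T ?z - w ?z) 0)\<^sup>2)
        = Pv \<sigma> v s * fst h + Ps \<sigma> v s * snd h"
      unfolding eqs d h Pv_def Ps_def cc_def Tp X_def[symmetric] Y_def[symmetric]
      using pos by (simp add: field_simps power2_eq_square)
  qed
  moreover have "\<forall>\<^sub>F z in nhds ?z. R z powr (1 - p) * (T z powr (p - 2) * (max (T z - w z) 0)\<^sup>2) = \<Psi> \<sigma> (fst z) (snd z)"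
  proof -
    have "open {z :: real \<times> real. - \<epsilon> < fst z \<and> 0 < snd z}"
      by (intro open_Collect_conj open_Collect_less continuous_intros)
    moreover have "?z \<in> {z. - \<epsilon> < fst z \<and> 0 < snd z}" using v \<epsilon> True by simp
    ultimately have "\<forall>\<^sub>F z in nhds ?z. z \<in> {z. - \<epsilon> < fst z \<and> 0 < snd z}"
      by (rule eventually_nhds_in_open)
    then show ?thesis
    proof eventually_elim
      case (elim z)
      then have e: "w z = VV (fst z)" "R z = RR \<sigma> (fst z) (snd z)" "T z = TT (fst z) (snd z)" "0 < u z"
        using \<epsilon> by (simp_all add: w_def u_def R_def T_def VV_def UU_def RR_def TT_def algebra_simps)
      have "0 < T z" using e(4) K by (simp add: T_def)
      then have "max (T z - w z) 0 = dd (fst z) (snd z) * T z" "T z powr p = T z powr (p - 2) * (T z)\<^sup>2"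
        by (simp_all add: dd_def e powr_diff)
      then show ?case unfolding \<Psi>_def e by (simp add: power_mult_distrib mult_ac)
    qed
  qed
  ultimately show ?thesis
    by (auto simp: eventually_nhds_conv_at elim!: has_derivative_transform_eventually)
qed

lemma C1_function_on_\<Psi>:
  assumes \<sigma>: "0 \<le> \<sigma>" "\<sigma> \<le> 1"
  shows "C1_function_on {0..} (\<Psi> \<sigma>) (Pv \<sigma>) (Ps \<sigma>)"
proof
  show "\<Psi> \<sigma> v 0 = 0" "Pv \<sigma> v 0 = 0" if "v \<in> {0..}" for v
  proof -
    have "dd v 0 = 0" using d_pos_s[of v 0] d_bounds(1)[of v 0] that by force
    then show "\<Psi> \<sigma> v 0 = 0" "Pv \<sigma> v 0 = 0" using eq_0 by auto
  qed
  show "\<exists>C. \<forall>v\<in>{0..}. \<forall>s. \<bar>s\<bar> \<le> M \<longrightarrow> \<bar>Pv \<sigma> v s\<bar> \<le> C \<and> \<bar>Ps \<sigma> v s\<bar> \<le> C" for M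
    using bounds[OF _ \<sigma>] by (intro exI[of _ "\<epsilon> powr (1 - p) * K powr p * ((4 * p + 4) / \<epsilon>)"]) auto
qed (use has_derivative_\<Psi>[OF _ \<sigma>] continuous_partials[OF \<sigma>] in auto)

end

section \<open>Weak inequalities and the chain rule\<close>

text \<open>One locale for both inequalities: c1 = 1, c2 = \<alpha> for the subsolution, c1 = - 1,
  c2 = - \<alpha> for the supersolution. The growth conditions on A and B make both sides continuous
  under L^p and L^q convergence.\<close>

locale weak_inequality =
  fixes \<Omega> :: "'a::euclidean_space set" and p q c1 c2 :: real and A :: "'a \<Rightarrow> 'a" and B g h :: "'a \<Rightarrow> real"
  assumes \<Omega>: "open \<Omega>" and p: "1 \<le> p" and q: "1 \<le> q"
    and A: "A \<in> borel_measurable borel" "\<And>x. norm (A x) \<le> norm (g x) powr (p - 1)" "Lp p g"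
    and B: "B \<in> borel_measurable borel" "\<And>x. norm (B x) \<le> norm (h x) powr (q - 1)" "Lp q h"
    and ineq: "\<And>\<psi>. test_fun \<Omega> \<psi> \<Longrightarrow> (\<And>x. 0 \<le> \<psi> x) \<Longrightarrow>
      c1 * (LINT x|lborel. A x \<bullet> grad \<psi> x) \<le> c2 * (LINT x|lborel. B x * \<psi> x)"
begin

lemma ineq_limit:
  assumes "Lp_converges q fs f" "Lp_converges p Fs F"
    "\<And>n. c1 * (LINT x|lborel. A x \<bullet> Fs n x) \<le> c2 * (LINT x|lborel. B x * fs n x)"
  shows "c1 * (LINT x|lborel. A x \<bullet> F x) \<le> c2 * (LINT x|lborel. B x * f x)"
proof (rule LIMSEQ_le)
  show "(\<lambda>n. c1 * (LINT x|lborel. A x \<bullet> Fs n x)) \<longlonglongrightarrow> c1 * (LINT x|lborel. A x \<bullet> F x)"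
    by (intro tendsto_mult tendsto_const Lp_converges_pairing[OF assms(2) A(3) p A(1,2)])
  show "(\<lambda>n. c2 * (LINT x|lborel. B x * fs n x)) \<longlonglongrightarrow> c2 * (LINT x|lborel. B x * f x)"
    using Lp_converges_pairing[OF assms(1) B(3) q B(1,2)] by (intro tendsto_mult tendsto_const) simp
qed (use assms(3) in auto)

lemma ineq_C1c:
  assumes "C1c S f F" "S \<subseteq> \<Omega>" "\<And>x. 0 \<le> f x"
  shows "c1 * (LINT x|lborel. A x \<bullet> F x) \<le> c2 * (LINT x|lborel. B x * f x)"
proof -
  obtain \<phi> where \<phi>: "\<And>n. test_fun \<Omega> (\<phi> n)" "\<And>n x. 0 \<le> \<phi> n x"
    "Lp_converges q \<phi> f" "Lp_converges p (\<lambda>n. grad (\<phi> n)) F"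
    by (rule approximate_test_fun[OF assms(1) \<Omega> assms(2) q p assms(3)]) (rule that)
  show ?thesis by (rule ineq_limit[OF \<phi>(3,4) ineq[OF \<phi>(1,2)]])
qed

text \<open>Two nested limits. For a fixed test function \<eta> n, \<open>approximate_C1c\<close>
  yields the inequality for the composition of \<Psi> with v and \<eta> n; then \<eta> n tends to w.
  The second limit relies on the global bound C, as the \<eta> n have no common bound.\<close>

lemma ineq_composition:
  fixes v w :: "'a \<Rightarrow> real" and G H :: "'a \<Rightarrow> 'a"
  assumes \<Psi>: "C1_function_on {0..} \<Psi> Pv Ps" and pos: "\<And>a s. 0 \<le> a \<Longrightarrow> 0 \<le> \<Psi> a s"
    and C: "\<And>a s. 0 \<le> a \<Longrightarrow> \<bar>Pv a s\<bar> \<le> C" "\<And>a s. 0 \<le> a \<Longrightarrow> \<bar>Ps a s\<bar> \<le> C"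
    and v: "wgrad \<Omega> v G" "Lp q v" "Lp p G" "\<And>x. 0 \<le> v x"
    and \<phi>: "\<And>n. test_fun \<Omega> (\<phi> n)" "Lp_converges q \<phi> w" "Lp_converges p (\<lambda>n. grad (\<phi> n)) H"
  shows "Lp q (\<lambda>x. \<Psi> (v x) (w x))" "Lp p (\<lambda>x. Pv (v x) (w x) *\<^sub>R G x + Ps (v x) (w x) *\<^sub>R H x)"
    "c1 * (LINT x|lborel. A x \<bullet> (Pv (v x) (w x) *\<^sub>R G x + Ps (v x) (w x) *\<^sub>R H x))
     \<le> c2 * (LINT x|lborel. B x * \<Psi> (v x) (w x))"
proof -
  interpret C1_function_on "{0..}" \<Psi> Pv Ps by fact
  have vD: "v x \<in> {0..}" for x using v(4) by simp
  \<comment> \<open>The coefficients Pv (v x) (\<phi> n x) need pointwise convergence of \<phi> n,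
    which L^q convergence gives along a subsequence.\<close>
  obtain \<sigma> where \<sigma>: "strict_mono \<sigma>" "AE x in lborel. (\<lambda>n. \<phi> (\<sigma> n) x) \<longlonglongrightarrow> w x"
    using Lp_converges_AE_subseq[OF \<phi>(2)] q by auto
  define \<eta> where "\<eta> n = \<phi> (\<sigma> n)" for n
  have \<eta>: "test_fun \<Omega> (\<eta> n)" "Lp_converges q \<eta> w" "Lp_converges p (\<lambda>n. grad (\<eta> n)) H"
    "AE x in lborel. (\<lambda>n. \<eta> n x) \<longlonglongrightarrow> w x" for n
    using \<phi>(1) \<sigma> Lp_converges_subseq[OF \<phi>(2) \<sigma>(1)] Lp_converges_subseq[OF \<phi>(3) \<sigma>(1)]
    by (simp_all add: \<eta>_def[abs_def])
  have wL: "Lp q w" "Lp p H" using \<phi> by (auto simp: Lp_converges_def)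
  have \<eta>L: "Lp q (\<eta> n)" for n using \<eta>(2) by (auto simp: Lp_converges_def)
  note [measurable] = Lp_measurable[OF v(2)] Lp_measurable[OF v(3)] Lp_measurable[OF wL(1)]
    Lp_measurable[OF wL(2)] Lp_measurable[OF \<eta>L]
  have mP: "(\<lambda>x. Pv (v x) (k x)) \<in> borel_measurable borel" "(\<lambda>x. Ps (v x) (k x)) \<in> borel_measurable borel"
    "(\<lambda>x. \<Psi> (v x) (k x)) \<in> borel_measurable borel" if [measurable]: "k \<in> borel_measurable borel" for k
    by (rule measurable_Pv measurable_Ps measurable_\<Psi>; use vD in simp)+
  have lip: "\<bar>\<Psi> (v x) a - \<Psi> (v x) b\<bar> \<le> C * \<bar>a - b\<bar>" for x a b
    using C v(4) by (intro lipschitz_s[where X = UNIV]) auto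
  have C0: "C \<ge> 0" using C(1)[of 0 0] by linarith
  show L\<Psi>: "Lp q (\<lambda>x. \<Psi> (v x) (w x))"
  proof (rule Lp_norm_le[OF wL(1) _ mP(3), where C = C])
    show "norm (\<Psi> (v x) (w x)) \<le> C * norm (w x)" for x
      using lip[of x "w x" 0] zero(1)[OF vD[of x]] by simp
  qed (use q in auto)
  have conv_f: "Lp_converges q (\<lambda>n x. \<Psi> (v x) (\<eta> n x)) (\<lambda>x. \<Psi> (v x) (w x))"
    using lip q by (intro Lp_converges_norm_le[OF \<eta>(2) L\<Psi>, where C = C] mP) auto
  have conv_F: "Lp_converges p (\<lambda>n x. Pv (v x) (\<eta> n x) *\<^sub>R G x + Ps (v x) (\<eta> n x) *\<^sub>R grad (\<eta> n) x)
      (\<lambda>x. Pv (v x) (w x) *\<^sub>R G x + Ps (v x) (w x) *\<^sub>R H x)"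
  proof (intro Lp_converges_add)
    show "Lp_converges p (\<lambda>n x. Pv (v x) (\<eta> n x) *\<^sub>R G x) (\<lambda>x. Pv (v x) (w x) *\<^sub>R G x)"
    proof (rule Lp_converges_scaleR[OF Lp_converges_const[OF v(3)] _ _ _ _ _, where C = C])
      show "AE x in lborel. (\<lambda>n. Pv (v x) (\<eta> n x)) \<longlonglongrightarrow> Pv (v x) (w x)"
        using \<eta>(4) by eventually_elim (rule tendsto_composition[OF cont_v vD vD tendsto_const])
    qed (use p C v(4) in \<open>auto intro: mP\<close>)
    show "Lp_converges p (\<lambda>n x. Ps (v x) (\<eta> n x) *\<^sub>R grad (\<eta> n) x) (\<lambda>x. Ps (v x) (w x) *\<^sub>R H x)"
    proof (rule Lp_converges_scaleR[OF \<eta>(3) _ _ _ _ _, where C = C])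
      show "AE x in lborel. (\<lambda>n. Ps (v x) (\<eta> n x)) \<longlonglongrightarrow> Ps (v x) (w x)"
        using \<eta>(4) by eventually_elim (rule tendsto_composition[OF cont_s vD vD tendsto_const])
    qed (use p C v(4) in \<open>auto intro: mP\<close>)
  qed (use p in auto)
  then show "Lp p (\<lambda>x. Pv (v x) (w x) *\<^sub>R G x + Ps (v x) (w x) *\<^sub>R H x)"
    by (simp add: Lp_converges_def)
  show "c1 * (LINT x|lborel. A x \<bullet> (Pv (v x) (w x) *\<^sub>R G x + Ps (v x) (w x) *\<^sub>R H x))
     \<le> c2 * (LINT x|lborel. B x * \<Psi> (v x) (w x))"
  proof (rule ineq_limit[OF conv_f conv_F])
    fix n
    note t = test_fun_C1c[OF \<eta>(1)[of n]]
    define S where "S = closure {x. \<eta> n x \<noteq> 0}"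
    have S: "S \<subseteq> \<Omega>" using \<eta>(1)[of n] by (simp add: test_fun_def S_def)
    have D: "{0..} = (UNIV :: real set) \<or> {0..} = {0::real..} \<and> (\<forall>x. 0 \<le> v x)" using v(4) by simp
    obtain fs Fs where fs: "\<And>k. C1c S (fs k) (Fs k)" "\<And>k x. \<exists>a\<in>{0..}. fs k x = \<Psi> a (\<eta> n x)"
      "Lp_converges q fs (\<lambda>x. \<Psi> (v x) (\<eta> n x))"
      "Lp_converges p Fs (\<lambda>x. Pv (v x) (\<eta> n x) *\<^sub>R G x + Ps (v x) (\<eta> n x) *\<^sub>R grad (\<eta> n) x)"
      by (rule approximate_C1c[OF v(1-3) q p \<Omega> t[folded S_def] S D]) (rule that)
    have "0 \<le> fs k x" for k x using fs(2)[of k x] pos by auto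
    then show "c1 * (LINT x|lborel. A x \<bullet> (Pv (v x) (\<eta> n x) *\<^sub>R G x + Ps (v x) (\<eta> n x) *\<^sub>R grad (\<eta> n) x))
        \<le> c2 * (LINT x|lborel. B x * \<Psi> (v x) (\<eta> n x))"
      by (intro ineq_limit[OF fs(3,4)] ineq_C1c[OF fs(1) S])
  qed
qed

end

section \<open>Uniqueness, linearity and chain rule for weak gradients\<close>

lemma AE_compact_exhaustion:
  fixes \<Omega> :: "'a::euclidean_space set"
  assumes "open \<Omega>" "\<And>S. compact S \<Longrightarrow> S \<subseteq> \<Omega> \<Longrightarrow> AE x in M. x \<in> S \<longrightarrow> P x"
  shows "AE x in M. x \<in> \<Omega> \<longrightarrow> P x"
proof -
  obtain F where F: "\<And>n::nat. compact (F n)" "\<And>n. F n \<subseteq> \<Omega>" "\<Union>(range F) = \<Omega>"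
    using open_Union_compact_subsets[OF assms(1)] by metis
  have "AE x in M. \<forall>n. x \<in> F n \<longrightarrow> P x"
    unfolding AE_all_countable using assms(2) F by blast
  then show ?thesis
    by (rule AE_mp) (use F(3) in \<open>auto\<close>)
qed

text \<open>Every mollification of 0 is 0, so the mollified gradients, which converge to G in L^p on
  compact sets, vanish.\<close>

lemma wgrad_zero:
  fixes G :: "'a::euclidean_space \<Rightarrow> 'a"
  assumes \<Omega>: "open \<Omega>" and G: "Lp p G" "1 \<le> p" and w: "wgrad \<Omega> (\<lambda>x. 0) G"
  shows "AE x in lborel. x \<in> \<Omega> \<longrightarrow> G x = 0"
proof (rule AE_compact_exhaustion[OF \<Omega>])
  fix S :: "'a set" assume S: "compact S" "S \<subseteq> \<Omega>"
  obtain us Us where us: "\<And>n. C1 (us n) (Us n)"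
    "Lp_converges p (\<lambda>n x. indicator S x *\<^sub>R Us n x) (\<lambda>x. indicator S x *\<^sub>R G x)"
    "(\<forall>x::'a. (0::real) = 0) \<longrightarrow> (\<forall>n x. us n x = 0)"
    by (rule mollify_local[OF w Lp_zero[of 1] G(1) _ G(2) S(1) \<Omega> S(2)]) (rule order_refl, rule that)
  have "Us n x = 0" for n x
    by (rule C1_grad_eq_0[OF us(1), of "{}"]) (use us(3) in auto)
  then have "Lp_converges p (\<lambda>n x. 0) (\<lambda>x. indicat_real S x *\<^sub>R G x)" using us(2) by simp
  then have L: "Lp p (\<lambda>x. indicat_real S x *\<^sub>R G x)"
    and "(\<lambda>n::nat. LINT x|lborel. norm (0 - indicat_real S x *\<^sub>R G x) powr p) \<longlonglongrightarrow> 0"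
    unfolding Lp_converges_def by blast+
  then have "(LINT x|lborel. norm (indicat_real S x *\<^sub>R G x) powr p) = 0"
    using LIMSEQ_const_iff[of "LINT x|lborel. norm (indicat_real S x *\<^sub>R G x) powr p" 0] by simp
  then have "AE x in lborel. norm (indicat_real S x *\<^sub>R G x) powr p = 0"
    using integral_nonneg_eq_0_iff_AE[OF Lp_integrable[OF L]] by simp
  then show "AE x in lborel. x \<in> S \<longrightarrow> G x = 0"
    by eventually_elim auto
qed

lemma wgrad_integrable:
  fixes u :: "'a::euclidean_space \<Rightarrow> real"
  assumes "test_fun \<Omega> \<phi>" "Lp q u" "1 \<le> q"
  shows "integrable lborel (\<lambda>x. u x * (grad \<phi> x \<bullet> b))" "integrable lborel (\<lambda>x. u x * \<phi> x)"
proof -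
  define S where "S = closure {x. \<phi> x \<noteq> 0}"
  note t = test_fun_C1c[OF assms(1), folded S_def]
  have S: "compact S" and \<phi>C: "C1 \<phi> (grad \<phi>)" and \<phi>0: "\<And>x. x \<notin> S \<Longrightarrow> \<phi> x = 0" using t by (auto simp: C1c_def)
  obtain C where C: "\<And>x. \<bar>\<phi> x\<bar> \<le> C" "\<And>x. norm (grad \<phi> x) \<le> C" "0 \<le> C" using C1c_bounded[OF t] by blast
  note [measurable] = C1_measurable[OF \<phi>C]
  note i = Lp_restrict(2)[OF assms(2,3) S]
  have "\<bar>grad \<phi> x \<bullet> b\<bar> \<le> C * norm b" for x
    using Cauchy_Schwarz_ineq2[of "grad \<phi> x" b] mult_right_mono[OF C(2)[of x], of "norm b"] by simp
  then have "integrable lborel (\<lambda>x. (grad \<phi> x \<bullet> b) *\<^sub>R (indicat_real S x *\<^sub>R u x))"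
    by (intro integrable_mult_bounded[OF i]) auto
  moreover have "(\<lambda>x. (grad \<phi> x \<bullet> b) *\<^sub>R (indicat_real S x *\<^sub>R u x)) = (\<lambda>x. u x * (grad \<phi> x \<bullet> b))"
    using C1c_grad_eq_0[OF t] by (auto simp: indicator_def fun_eq_iff)
  ultimately show "integrable lborel (\<lambda>x. u x * (grad \<phi> x \<bullet> b))" by simp
  have "integrable lborel (\<lambda>x. \<phi> x *\<^sub>R (indicat_real S x *\<^sub>R u x))"
    using C(1) by (intro integrable_mult_bounded[OF i]) auto
  moreover have "(\<lambda>x. \<phi> x *\<^sub>R (indicat_real S x *\<^sub>R u x)) = (\<lambda>x. u x * \<phi> x)"
    using \<phi>0 by (auto simp: indicator_def fun_eq_iff)
  ultimately show "integrable lborel (\<lambda>x. u x * \<phi> x)" by simp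
qed

lemma Lp_inner:
  fixes G :: "'a::euclidean_space \<Rightarrow> 'b::euclidean_space"
  assumes "Lp p G" "0 \<le> p" shows "Lp p (\<lambda>x. G x \<bullet> b)"
proof (rule Lp_norm_le[OF assms, where C = "norm b"])
  note [measurable] = Lp_measurable[OF assms(1)]
  show "(\<lambda>x. G x \<bullet> b) \<in> borel_measurable borel" by measurable
  show "norm (G x \<bullet> b) \<le> norm b * norm (G x)" for x
    using Cauchy_Schwarz_ineq2[of "G x" b] by (simp add: mult.commute)
qed

lemma wgrad_diff:
  assumes w: "wgrad \<Omega> u G" "wgrad \<Omega> v H" and L: "Lp q u" "Lp q v" "Lp p G" "Lp p H" and q: "1 \<le> q" and p: "1 \<le> p"
  shows "wgrad \<Omega> (\<lambda>x. u x - v x) (\<lambda>x. G x - H x)"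
  unfolding wgrad_def
proof (intro allI impI)
  fix \<phi> :: "'a \<Rightarrow> real" and b :: 'a assume t: "test_fun \<Omega> \<phi>" and b: "b \<in> Basis"
  have i: "Lp p (\<lambda>x. G x \<bullet> b)" "Lp p (\<lambda>x. H x \<bullet> b)" using L p by (auto intro: Lp_inner)
  show "(LINT x|lborel. (u x - v x) * (grad \<phi> x \<bullet> b)) = - (LINT x|lborel. ((G x - H x) \<bullet> b) * \<phi> x)"
    using w t b wgrad_integrable[OF t L(1) q] wgrad_integrable[OF t L(2) q]
      wgrad_integrable(2)[OF t i(1) p] wgrad_integrable(2)[OF t i(2) p]
    by (simp add: wgrad_def left_diff_distrib inner_diff_left)
qed

text \<open>The composition J v s with D = UNIV: J (u) times a test function is approximated by
  compactly supported C^1 functions, whose gradients have integral 0; the limit of this identity is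
  the claim.\<close>

lemma wgrad_chain:
  fixes u :: "'a::euclidean_space \<Rightarrow> real" and J J' :: "real \<Rightarrow> real"
  assumes w: "wgrad \<Omega> u G" and L: "Lp q u" "Lp p G" and q: "1 \<le> q" and p: "1 \<le> p" and \<Omega>: "open \<Omega>"
    and J: "\<And>t. (J has_real_derivative J' t) (at t)" "continuous_on UNIV J'"
    and C: "\<And>t. \<bar>J t\<bar> \<le> C" "\<And>t. \<bar>J' t\<bar> \<le> C"
  shows "wgrad \<Omega> (\<lambda>x. J (u x)) (\<lambda>x. J' (u x) *\<^sub>R G x)"
  unfolding wgrad_def
proof (intro allI impI)
  fix \<phi> :: "'a \<Rightarrow> real" and b :: 'a assume t: "test_fun \<Omega> \<phi>" and b: "b \<in> Basis"
  define S where "S = closure {x. \<phi> x \<noteq> 0}"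
  have S: "S \<subseteq> \<Omega>" "compact S" using t by (auto simp: test_fun_def S_def)
  note tC = test_fun_C1c[OF t, folded S_def]
  have cJ: "continuous_on UNIV J" using J(1) by (auto intro!: continuous_at_imp_continuous_on DERIV_isCont)
  have C0: "0 \<le> C" using C(1)[of 0] by linarith
  interpret C1_function_on UNIV "\<lambda>v s. J v * s" "\<lambda>v s. J' v * s" "\<lambda>v s. J v"
  proof
    fix v s :: real
    have fst: "(fst has_derivative fst) (at (v, s))" and snd: "(snd has_derivative snd) (at (v, s))"
      by (auto intro: bounded_linear_imp_has_derivative bounded_linear_fst bounded_linear_snd)
    have "((\<lambda>z. J (fst z)) has_derivative (\<lambda>z. J' v * fst z)) (at (v, s))"
      using has_derivative_compose_real[OF fst J(1)[of v]] by simp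
    from has_derivative_mult[OF this snd]
    show "((\<lambda>z. J (fst z) * snd z) has_derivative (\<lambda>z. J' v * s * fst z + J v * snd z)) (at (v, s))"
      by (simp add: algebra_simps)
    show "\<exists>c. \<forall>v\<in>UNIV. \<forall>s. \<bar>s\<bar> \<le> M \<longrightarrow> \<bar>J' v * s\<bar> \<le> c \<and> \<bar>J v\<bar> \<le> c" for M
    proof (intro exI[of _ "C * \<bar>M\<bar> + C"] ballI allI impI conjI)
      fix v s :: real assume "\<bar>s\<bar> \<le> M"
      then have "\<bar>J' v * s\<bar> \<le> C * \<bar>M\<bar>" unfolding abs_mult using C(2) C0 by (intro mult_mono) auto
      then show "\<bar>J' v * s\<bar> \<le> C * \<bar>M\<bar> + C" using C0 by simp
      have "0 \<le> C * \<bar>M\<bar>" using C0 by simp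
      then show "\<bar>J v\<bar> \<le> C * \<bar>M\<bar> + C" using C(1)[of v] by linarith
    qed
  qed (auto intro!: continuous_intros continuous_on_compose2[OF cJ] continuous_on_compose2[OF J(2)])
  define F where "F x = (J' (u x) * \<phi> x) *\<^sub>R G x + J (u x) *\<^sub>R grad \<phi> x" for x
  obtain fs Fs where fs: "\<And>k. C1c S (fs k) (Fs k)" "Lp_converges p Fs F"
    by (rule approximate_C1c[OF w L q p \<Omega> tC S(1)]) (simp, rule that[unfolded F_def[abs_def]])
  \<comment> \<open>Cutting b off by \<open>indicat_real S\<close> makes the pairing continuous in
    L^p and changes nothing, as Fs n and F vanish outside S.\<close>
  have "(\<lambda>n. LINT x|lborel. (indicat_real S x *\<^sub>R b) \<bullet> Fs n x) \<longlonglongrightarrow> (LINT x|lborel. (indicat_real S x *\<^sub>R b) \<bullet> F x)"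
  proof (rule Lp_converges_pairing[OF fs(2) _ p, where g = "indicat_real S"])
    have [measurable]: "S \<in> sets borel" using S by (simp add: borel_compact)
    have "emeasure lborel S < \<infinity>" using emeasure_bounded_finite[OF compact_imp_bounded[OF S(2)]] by simp
    moreover have "norm (indicat_real S x) powr p = indicat_real S x" for x by (simp add: indicator_def)
    ultimately show "Lp p (indicat_real S)" by (simp add: Lp_def integrable_indicator_iff)
    show "(\<lambda>x. indicat_real S x *\<^sub>R b) \<in> borel_measurable borel" by measurable
    show "norm (indicat_real S x *\<^sub>R b) \<le> norm (indicat_real S x) powr (p - 1)" for x
      using b by (simp add: indicator_def)
  qed
  moreover have "(LINT x|lborel. (indicat_real S x *\<^sub>R b) \<bullet> Fs n x) = 0" for n
  proof -
    have "(\<lambda>x. (indicat_real S x *\<^sub>R b) \<bullet> Fs n x) = (\<lambda>x. Fs n x \<bullet> b)"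
      using C1c_grad_eq_0[OF fs(1)] by (auto simp: indicator_def fun_eq_iff inner_commute)
    then show ?thesis using C1c_integral_grad[OF fs(1), of n b] by simp
  qed
  ultimately have "(LINT x|lborel. (indicat_real S x *\<^sub>R b) \<bullet> F x) = 0"
    by (simp add: LIMSEQ_const_iff)
  moreover have "(\<lambda>x. (indicat_real S x *\<^sub>R b) \<bullet> F x) = (\<lambda>x. J (u x) * (grad \<phi> x \<bullet> b) + (J' (u x) *\<^sub>R G x) \<bullet> b * \<phi> x)"
    using C1c_grad_eq_0[OF tC] tC by (auto simp: indicator_def fun_eq_iff F_def inner_add_right C1c_def inner_commute algebra_simps)
  moreover have "integrable lborel (\<lambda>x. J (u x) * (grad \<phi> x \<bullet> b))"
  proof -
    note [measurable] = Lp_measurable[OF L(1)] borel_measurable_continuous_onI[OF cJ]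
    have i: "integrable lborel (\<lambda>x. grad \<phi> x \<bullet> b)"
      using C1c_integrable(2)[OF tC] by (rule integrable_inner_left)
    show ?thesis
      using integrable_mult_bounded[OF i, of "\<lambda>x. J (u x)" C] C(1) by simp
  qed
  moreover have "integrable lborel (\<lambda>x. (J' (u x) *\<^sub>R G x) \<bullet> b * \<phi> x)"
  proof (rule wgrad_integrable(2)[OF t _ p])
    note [measurable] = Lp_measurable[OF L(1)] borel_measurable_continuous_onI[OF J(2)]
    have "Lp p (\<lambda>x. J' (u x) *\<^sub>R G x)"
      using C p by (intro Lp_scaleR[OF L(2), where C = C]) auto
    then show "Lp p (\<lambda>x. (J' (u x) *\<^sub>R G x) \<bullet> b)"
      using p by (intro Lp_inner) auto
  qed
  ultimately show "(LINT x|lborel. J (u x) * (grad \<phi> x \<bullet> b)) = - (LINT x|lborel. (J' (u x) *\<^sub>R G x) \<bullet> b * \<phi> x)"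
    by simp
qed

text \<open>\<open>J (u x)\<close> only depends on the positive part of \<open>u\<close>, so it has the two weak gradients
  \<open>J' (u x) *\<^sub>R G x\<close> and \<open>J' (u x) *\<^sub>R H x\<close>, and \<open>J'\<close> is positive on the positive reals.\<close>

lemma wgrad_positive_part:
  fixes u v :: "'a::euclidean_space \<Rightarrow> real"
  assumes \<Omega>: "open \<Omega>" and q: "1 \<le> q" and p: "1 \<le> p"
    and u: "wgrad \<Omega> u G" "Lp q u" "Lp p G"
    and w: "wgrad \<Omega> (\<lambda>x. max (u x) 0) H" "Lp q (\<lambda>x. max (u x) 0)" "Lp p H"
  shows "AE x in lborel. x \<in> \<Omega> \<longrightarrow> 0 < u x \<longrightarrow> H x = G x"
proof -
  \<comment> \<open>The square makes J continuously differentiable at 0, the denominator keeps J and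
    J' bounded, as \<open>wgrad_chain\<close> demands.\<close>
  define J where "J t = (max t 0)\<^sup>2 / (1 + (max t 0)\<^sup>2)" for t :: real
  define J' where "J' t = 2 * max t 0 / (1 + (max t 0)\<^sup>2)\<^sup>2" for t :: real
  have nz: "1 + (max t 0)\<^sup>2 > 0" for t :: real by (simp add: add_pos_nonneg)
  have J: "(J has_real_derivative J' t) (at t)" for t
  proof -
    have "((\<lambda>t. 1 + (max t 0)\<^sup>2) has_real_derivative 0 + 2 * max t 0) (at t)"
      by (intro DERIV_add DERIV_const has_derivative_max_square)
    from DERIV_divide[OF has_derivative_max_square this] nz[of t]
    show ?thesis unfolding J_def J'_def by (simp add: algebra_simps power2_eq_square[of "1 + _"])
  qed
  have cJ': "continuous_on UNIV J'"
    unfolding J'_def using nz by (intro continuous_intros) (auto simp: less_imp_neq[THEN not_sym])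
  have JC: "\<bar>J t\<bar> \<le> 1" for t using nz[of t] by (simp add: J_def)
  have J'C: "\<bar>J' t\<bar> \<le> 1" for t
  proof -
    define r where "r = max t 0"
    have "2 * r \<le> 1 + r\<^sup>2" using zero_le_power2[of "r - 1"] by (simp add: power2_eq_square algebra_simps)
    also have "\<dots> \<le> (1 + r\<^sup>2)\<^sup>2" using power_increasing[of 1 2 "1 + r\<^sup>2"] by simp
    finally show ?thesis using nz[of t] by (simp add: J'_def r_def)
  qed
  have Jmax: "J (max t 0) = J t" "J' (max t 0) = J' t" for t by (simp_all add: J_def J'_def max_def)
  note c = wgrad_chain[OF _ _ _ q p \<Omega> J cJ' JC J'C]
  have c1: "wgrad \<Omega> (\<lambda>x. J (u x)) (\<lambda>x. J' (u x) *\<^sub>R G x)" by (rule c[OF u])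
  have c2: "wgrad \<Omega> (\<lambda>x. J (u x)) (\<lambda>x. J' (u x) *\<^sub>R H x)" using c[OF w] by (simp add: Jmax)
  note [measurable] = Lp_measurable[OF u(2)] borel_measurable_continuous_onI[OF cJ']
  have L: "Lp p (\<lambda>x. J' (u x) *\<^sub>R G x)" "Lp p (\<lambda>x. J' (u x) *\<^sub>R H x)"
    using J'C p by (auto intro!: Lp_scaleR[OF u(3), where C = 1] Lp_scaleR[OF w(3), where C = 1])
  have LJ: "Lp q (\<lambda>x. J (u x))"
  proof (rule Lp_norm_le[OF u(2), where C = 1])
    show "(\<lambda>x. J (u x)) \<in> borel_measurable borel" unfolding J_def by measurable
    show "norm (J (u x)) \<le> 1 * norm (u x)" for x
    proof -
      define r where "r = max (u x) 0"
      have "r \<le> 1 + r\<^sup>2" using zero_le_power2[of "r - 1"] by (simp add: power2_eq_square algebra_simps) (simp add: r_def)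
      then have "r * r \<le> r * (1 + r\<^sup>2)" by (intro mult_left_mono) (auto simp: r_def)
      then have "r\<^sup>2 / (1 + r\<^sup>2) \<le> r" using nz[of "u x"] by (simp add: r_def field_simps power2_eq_square)
      then show ?thesis using nz[of "u x"] by (simp add: J_def r_def[symmetric]) (simp add: r_def)
    qed
  qed (use q in auto)
  have LD: "Lp p (\<lambda>x. J' (u x) *\<^sub>R H x - J' (u x) *\<^sub>R G x)"
    using L p by (intro Lp_diff) auto
  \<comment> \<open>Two weak gradients of the same function: their difference is a weak gradient of
    0.\<close>
  have "wgrad \<Omega> (\<lambda>x. 0) (\<lambda>x. J' (u x) *\<^sub>R H x - J' (u x) *\<^sub>R G x)"
    using wgrad_diff[OF c2 c1 LJ LJ L(2,1) q p] by simp
  from wgrad_zero[OF \<Omega> LD p this] show ?thesis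
  proof eventually_elim
    case (elim x)
    show ?case
    proof (intro impI)
      assume "x \<in> \<Omega>" "0 < u x"
      then have "J' (u x) \<noteq> 0" using nz[of "u x"] by (simp add: J'_def)
      then show "H x = G x" using elim \<open>x \<in> \<Omega>\<close> by (simp flip: scaleR_right_diff_distrib)
    qed
  qed
qed

section \<open>The comparison principle\<close>

text \<open>For X = 0 the value is 0 also if p < 2.\<close>

abbreviation flux :: "real \<Rightarrow> 'a::euclidean_space \<Rightarrow> 'a" where
  "flux p X \<equiv> norm X powr (p - 2) *\<^sub>R X"

context picone_test
begin

lemma RR_1: "RR 1 v s = UU v s" and RR_0: "RR 0 v s = VV v"
  by (simp_all add: RR_def UU_def VV_def)

text \<open>X and Y stand for grad u and grad v. Both test gradients are written as combinations of
  X and Y; the mixed terms, with the nonnegative coefficients m and c, are estimated by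
  Cauchy-Schwarz. With a = |X| / U and b = |Y| / V what remains is TT^p times
  \<open>picone_scalar\<close>.\<close>

lemma picone_vector:
  fixes X Y :: "'a::euclidean_space"
  assumes v: "0 \<le> v"
  shows "flux p Y \<bullet> (Pv 0 v s *\<^sub>R Y + Ps 0 v s *\<^sub>R (X - Y))
    \<le> flux p X \<bullet> (Pv 1 v s *\<^sub>R Y + Ps 1 v s *\<^sub>R (X - Y))
      + p * (1 - \<theta> v s) * norm X powr p"
proof (cases "dd v s = 0")
  case True
  have "0 \<le> p * (1 - \<theta> v s) * norm X powr p"
    using p \<theta>_bounds[OF v, of s] by simp
  then show ?thesis using eq_0[OF True] by simp
next
  case False
  then have d0: "0 < dd v s" using d_bounds[OF v, of s] by simp
  define d where "d = dd v s"
  define t where "t = \<theta> v s"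
  define c where "c = cc v s"
  define m where "m = 2 * d * (1 - d)"
  define N where "N = TT v s powr p"
  define U where "U = UU v s"
  define V where "V = VV v"
  define T where "T = TT v s"
  have pos: "0 < U" "0 < V" "0 < T" "T \<le> U" "0 \<le> N"
    using U_ge[OF v, of s] V_pos[OF v] T_bounds[OF v, of s] by (auto simp: U_def V_def T_def N_def)
  have d: "0 \<le> d" "d \<le> 1" and t: "0 \<le> t" "t \<le> 1"
    using d_bounds[OF v, of s] \<theta>_bounds[OF v, of s] by (auto simp: d_def t_def)
  have c_eq: "c = (p - 2) * t * d\<^sup>2 + 2 * d * t" by (simp add: c_def cc_def d_def t_def)
  have m0: "0 \<le> m" using d by (simp add: m_def)
  \<comment> \<open>Shows c >= 0 also for p < 2, where (p - 2) t d^2 is not positive by itself;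
    Cauchy-Schwarz needs this sign.\<close>
  have "c = t * (p * d\<^sup>2 + m)" by (simp add: c_eq m_def algebra_simps power2_eq_square)
  then have c0: "0 \<le> c" using t m0 p by simp
  \<comment> \<open>From V = (1 - d) T, valid where d > 0. It gives Y its natural weight 1 / V in
    place of 1 / T.\<close>
  have Tm: "2 * d / T = m / V"
  proof -
    have V: "V = (1 - d) * T" using V_eq[OF v d0] by (simp add: d_def T_def V_def)
    with pos(2) have "1 - d \<noteq> 0" by auto
    then show ?thesis unfolding V m_def by simp
  qed
  define a where "a = norm X / U"
  define b where "b = norm Y / V"
  have ab: "0 \<le> a" "0 \<le> b" using pos by (auto simp: a_def b_def)
  have sq: "r powr (p - 2) * (r * r) = r powr p" "r powr (p - 2) * r = r powr (p - 1)" if "0 \<le> r" for r :: real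
    using that p by (cases "r = 0"; simp add: powr_diff power2_eq_square)+
  have ap: "U powr (1 - p) / U * norm X powr p = a powr p" "U powr (1 - p) * norm X powr (p - 1) = a powr (p - 1)"
    using pos by (simp_all add: a_def powr_divide powr_diff)
  have bp: "V powr (1 - p) / V * norm Y powr p = b powr p" "V powr (1 - p) * norm Y powr (p - 1) = b powr (p - 1)"
    using pos by (simp_all add: b_def powr_divide powr_diff)
  have XY: "X \<bullet> Y \<le> norm X * norm Y" by (rule norm_cauchy_schwarz)
  have F1: "Pv 1 v s *\<^sub>R Y + Ps 1 v s *\<^sub>R (X - Y)
      = (N * U powr (1 - p)) *\<^sub>R ((((1 - p) * d\<^sup>2 + c) / U) *\<^sub>R X - (m / V) *\<^sub>R Y)"
  proof -
    have 1: "Ps 1 v s = N * U powr (1 - p) * (((1 - p) * d\<^sup>2 + c) / U)"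
      by (simp add: Ps_def RR_1 N_def U_def d_def c_def add_divide_distrib)
    have 2: "Pv 1 v s = Ps 1 v s - N * U powr (1 - p) * (m / V)"
      unfolding Tm[symmetric] by (simp add: Pv_def Ps_def RR_1 N_def U_def d_def T_def algebra_simps)
    show ?thesis unfolding 2 1 by (simp add: algebra_simps)
  qed
  have F0: "Pv 0 v s *\<^sub>R Y + Ps 0 v s *\<^sub>R (X - Y)
      = (N * V powr (1 - p)) *\<^sub>R ((c / U) *\<^sub>R X + (((1 - p) * d\<^sup>2 - m) / V) *\<^sub>R Y)"
  proof -
    have 1: "Ps 0 v s = N * V powr (1 - p) * (c / U)"
      by (simp add: Ps_def RR_0 N_def U_def V_def d_def c_def)
    have 2: "Pv 0 v s = Ps 0 v s + N * V powr (1 - p) * (((1 - p) * d\<^sup>2 - m) / V)"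
      unfolding diff_divide_distrib Tm[symmetric] by (simp add: Pv_def Ps_def RR_0 N_def V_def d_def T_def algebra_simps)
    show ?thesis unfolding 2 1 by (simp add: algebra_simps)
  qed
  have L0: "flux p Y \<bullet> (Pv 0 v s *\<^sub>R Y + Ps 0 v s *\<^sub>R (X - Y))
      \<le> N * (c * (b powr (p - 1) * a) + ((1 - p) * d\<^sup>2 - m) * b powr p)"
  proof -
    have "norm Y powr (p - 2) * (V powr (1 - p) * (c / U * (X \<bullet> Y)))
        \<le> norm Y powr (p - 2) * (V powr (1 - p) * (c / U * (norm X * norm Y)))"
      using XY c0 pos by (intro mult_left_mono) auto
    also have "\<dots> = c * (V powr (1 - p) * (norm Y powr (p - 2) * norm Y) * (norm X / U))" by simp
    also have "\<dots> = c * (b powr (p - 1) * a)" using sq(2)[of "norm Y"] bp(2) by (simp add: a_def)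
    finally have 1: "norm Y powr (p - 2) * (V powr (1 - p) * (c / U * (X \<bullet> Y))) \<le> c * (b powr (p - 1) * a)" .
    have 2: "norm Y powr (p - 2) * (V powr (1 - p) * (((1 - p) * d\<^sup>2 - m) / V * (Y \<bullet> Y))) = ((1 - p) * d\<^sup>2 - m) * b powr p"
    proof -
      have XX: "Y \<bullet> Y = norm Y * norm Y" by (simp add: power2_norm_eq_inner[symmetric] power2_eq_square)
      have "norm Y powr (p - 2) * (V powr (1 - p) * (((1 - p) * d\<^sup>2 - m) / V * (Y \<bullet> Y)))
        = ((1 - p) * d\<^sup>2 - m) * (V powr (1 - p) / V * (norm Y powr (p - 2) * (norm Y * norm Y)))"
        unfolding XX by (simp add: mult_ac)
      then show ?thesis unfolding sq(1)[OF norm_ge_zero] bp(1) .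
    qed
    have "flux p Y \<bullet> (Pv 0 v s *\<^sub>R Y + Ps 0 v s *\<^sub>R (X - Y))
      = N * (norm Y powr (p - 2) * (V powr (1 - p) * (c / U * (X \<bullet> Y)))
        + norm Y powr (p - 2) * (V powr (1 - p) * (((1 - p) * d\<^sup>2 - m) / V * (Y \<bullet> Y))))"
      unfolding F0 by (simp add: inner_add_right inner_commute algebra_simps)
    then show ?thesis using 1 2 pos(5) by (simp add: mult_left_mono)
  qed
  have L1: "flux p X \<bullet> (Pv 1 v s *\<^sub>R Y + Ps 1 v s *\<^sub>R (X - Y))
      \<ge> N * (((1 - p) * d\<^sup>2 + c) * a powr p - m * (a powr (p - 1) * b))"
  proof -
    have "norm X powr (p - 2) * (U powr (1 - p) * (m / V * (X \<bullet> Y)))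
        \<le> norm X powr (p - 2) * (U powr (1 - p) * (m / V * (norm X * norm Y)))"
      using XY m0 pos by (intro mult_left_mono) auto
    also have "\<dots> = m * (U powr (1 - p) * (norm X powr (p - 2) * norm X) * (norm Y / V))" by simp
    also have "\<dots> = m * (a powr (p - 1) * b)" using sq(2)[of "norm X"] ap(2) by (simp add: b_def)
    finally have 1: "norm X powr (p - 2) * (U powr (1 - p) * (m / V * (X \<bullet> Y))) \<le> m * (a powr (p - 1) * b)" .
    have 2: "norm X powr (p - 2) * (U powr (1 - p) * (((1 - p) * d\<^sup>2 + c) / U * (X \<bullet> X))) = ((1 - p) * d\<^sup>2 + c) * a powr p"
    proof -
      have XX: "X \<bullet> X = norm X * norm X" by (simp add: power2_norm_eq_inner[symmetric] power2_eq_square)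
      have "norm X powr (p - 2) * (U powr (1 - p) * (((1 - p) * d\<^sup>2 + c) / U * (X \<bullet> X)))
        = ((1 - p) * d\<^sup>2 + c) * (U powr (1 - p) / U * (norm X powr (p - 2) * (norm X * norm X)))"
        unfolding XX by (simp add: mult_ac)
      then show ?thesis unfolding sq(1)[OF norm_ge_zero] ap(1) .
    qed
    have "flux p X \<bullet> (Pv 1 v s *\<^sub>R Y + Ps 1 v s *\<^sub>R (X - Y))
      = N * (norm X powr (p - 2) * (U powr (1 - p) * (((1 - p) * d\<^sup>2 + c) / U * (X \<bullet> X)))
        - norm X powr (p - 2) * (U powr (1 - p) * (m / V * (X \<bullet> Y))))"
      unfolding F1 by (simp add: inner_diff_right algebra_simps)
    then show ?thesis using 1 2 pos(5) by (simp add: mult_left_mono)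
  qed
  \<comment> \<open>T <= U turns the error into a multiple of |X|^p, which is integrable uniformly
    in the truncation.\<close>
  have "N * a powr p = (T / U * norm X) powr p"
    using pos unfolding a_def N_def T_def[symmetric] by (simp add: powr_mult powr_divide)
  also have "\<dots> \<le> norm X powr p"
    using mult_left_le_one_le[of "norm X" "T / U"] pos p by (intro powr_mono2) auto
  finally have "(p * (1 - t)) * (N * a powr p) \<le> (p * (1 - t)) * norm X powr p"
    using p t by (intro mult_left_mono) auto
  moreover have "N * - (p * (1 - t) * a powr p) \<le> N * (((1 - p) * d\<^sup>2 + c) * a powr p - m * (a powr (p - 1) * b)
    - c * (b powr (p - 1) * a) + ((p - 1) * d\<^sup>2 + m) * b powr p)"
    using picone_scalar[OF p ab d t] pos(5) unfolding m_def[symmetric] c_eq[symmetric]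
    by (intro mult_left_mono) auto
  ultimately show ?thesis
    using L0 L1 unfolding t_def[symmetric] by (simp add: algebra_simps)
qed

end

text \<open>The situation after passing to Borel representatives: u and v are nonnegative
  everywhere, and u = 0 outside the domain puts {v < u} inside it. \<phi> and H are the data of (u -
  v)_+ as a member of X_0.\<close>

locale sub_super_pair =
  fixes \<Omega> :: "'a::euclidean_space set" and \<alpha> p q :: real and u v :: "'a \<Rightarrow> real"
    and Gu Gv H :: "'a \<Rightarrow> 'a" and \<phi> :: "nat \<Rightarrow> 'a \<Rightarrow> real"
  assumes \<alpha>: "0 < \<alpha>" and q: "1 \<le> q" and qp: "q < p" and \<Omega>: "open \<Omega>"
    and nonneg: "\<And>x. 0 \<le> u x" "\<And>x. 0 \<le> v x" and outside: "\<And>x. x \<notin> \<Omega> \<Longrightarrow> u x = 0"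
    and v_pos: "AE x in lborel. x \<in> \<Omega> \<longrightarrow> 0 < v x"
    and u: "wgrad \<Omega> u Gu" "Lp q u" "Lp p Gu"
    and v: "wgrad \<Omega> v Gv" "Lp q v" "Lp p Gv"
    and w: "wgrad \<Omega> (\<lambda>x. max (u x - v x) 0) H"
    and \<phi>: "\<And>n. test_fun \<Omega> (\<phi> n)" "Lp_converges q \<phi> (\<lambda>x. max (u x - v x) 0)"
      "Lp_converges p (\<lambda>n. grad (\<phi> n)) H"
    and sub: "\<And>\<psi>. test_fun \<Omega> \<psi> \<Longrightarrow> (\<And>x. 0 \<le> \<psi> x) \<Longrightarrow>
      (LINT x|lborel. flux p (Gu x) \<bullet> grad \<psi> x)
      \<le> \<alpha> * (LINT x|lborel. u x powr (q - 1) * \<psi> x)"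
    and super: "\<And>\<psi>. test_fun \<Omega> \<psi> \<Longrightarrow> (\<And>x. 0 \<le> \<psi> x) \<Longrightarrow>
      \<alpha> * (LINT x|lborel. v x powr (q - 1) * \<psi> x)
      \<le> (LINT x|lborel. flux p (Gv x) \<bullet> grad \<psi> x)"
begin

abbreviation "ww x \<equiv> max (u x - v x) 0"

lemma p: "1 < p" using q qp by simp

lemma norm_flux_le: "norm (flux p (X::'a)) \<le> norm (norm X) powr (p - 1)"
  using p by (cases "X = 0") (simp_all add: powr_diff power2_eq_square)

lemma Lp_norm_grad: "Lp p (\<lambda>x. norm (Gu x))" "Lp p (\<lambda>x. norm (Gv x))"
  using Lp_measurable[OF u(3)] Lp_measurable[OF v(3)] Lp_integrable[OF u(3)] Lp_integrable[OF v(3)]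
  by (auto simp: Lp_def)

text \<open>H is given only as some weak gradient of (u - v)_+; it is identified where the pointwise
  Picone inequality will be used.\<close>

lemma H_eq: "AE x in lborel. v x < u x \<longrightarrow> H x = Gu x - Gv x"
proof -
  have L: "Lp q (\<lambda>x. u x - v x)" "Lp p (\<lambda>x. Gu x - Gv x)" using u v q p by (auto intro!: Lp_diff)
  have "Lp q ww" "Lp p H" using \<phi> by (auto simp: Lp_converges_def)
  then have "AE x in lborel. x \<in> \<Omega> \<longrightarrow> 0 < u x - v x \<longrightarrow> H x = Gu x - Gv x"
    using p by (intro wgrad_positive_part[OF \<Omega> q _ wgrad_diff[OF u(1) v(1) u(2) v(2) u(3) v(3) q] L w]) auto
  then show ?thesis
  proof eventually_elim
    case (elim x)
    then show ?case using outside[of x] nonneg[of x] by (cases "x \<in> \<Omega>") auto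
  qed
qed

text \<open>The supersolution inequality, the pointwise Picone inequality and the subsolution
  inequality, chained in this order. Integrability holds because the compositions lie in L^q and
  their gradients in L^p.\<close>

lemma energy_estimate:
  assumes "0 < \<epsilon>" "0 < K"
  shows "integrable lborel (\<lambda>x. u x powr (q - 1) * picone_test.\<Psi> p \<epsilon> K 1 (v x) (ww x))"
    "integrable lborel (\<lambda>x. v x powr (q - 1) * picone_test.\<Psi> p \<epsilon> K 0 (v x) (ww x))"
    "\<alpha> * (LINT x|lborel. v x powr (q - 1) * picone_test.\<Psi> p \<epsilon> K 0 (v x) (ww x))
      \<le> \<alpha> * (LINT x|lborel. u x powr (q - 1) * picone_test.\<Psi> p \<epsilon> K 1 (v x) (ww x))
        + (LINT x|lborel. p * (1 - picone_test.\<theta> \<epsilon> K (v x) (ww x)) * norm (Gu x) powr p)"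
proof -
  interpret picone_test p \<epsilon> K using p assms by unfold_locales
  note [measurable] = Lp_measurable[OF u(2)] Lp_measurable[OF u(3)] Lp_measurable[OF v(2)] Lp_measurable[OF v(3)]
  interpret U: weak_inequality \<Omega> p q 1 \<alpha> "\<lambda>x. flux p (Gu x)" "\<lambda>x. u x powr (q - 1)" "\<lambda>x. norm (Gu x)" u
    using \<Omega> p q sub nonneg norm_flux_le Lp_norm_grad u(2) by unfold_locales auto
  interpret V: weak_inequality \<Omega> p q "- 1" "- \<alpha>" "\<lambda>x. flux p (Gv x)" "\<lambda>x. v x powr (q - 1)" "\<lambda>x. norm (Gv x)" v
    using \<Omega> p q super nonneg norm_flux_le Lp_norm_grad v(2) by unfold_locales auto
  note C1 = U.ineq_composition[OF C1_function_on_\<Psi>[of 1] \<Psi>_nonneg bounds[of _ 1] v nonneg(2) \<phi>, simplified]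
  note C0 = V.ineq_composition[OF C1_function_on_\<Psi>[of 0] \<Psi>_nonneg bounds[of _ 0] v nonneg(2) \<phi>, simplified]
  have Lw: "Lp q ww" using \<phi> by (auto simp: Lp_converges_def)
  note [measurable] = Lp_measurable[OF Lw]
  show "integrable lborel (\<lambda>x. u x powr (q - 1) * \<Psi> 1 (v x) (ww x))"
    using Lp_pairing_integrable(2)[OF C1(1) u(2) q U.B(1) U.B(2)] by simp
  show "integrable lborel (\<lambda>x. v x powr (q - 1) * \<Psi> 0 (v x) (ww x))"
    using Lp_pairing_integrable(2)[OF C0(1) v(2) q V.B(1) V.B(2)] by simp
  have i1: "integrable lborel (\<lambda>x. flux p (Gu x) \<bullet> (Pv 1 (v x) (ww x) *\<^sub>R Gv x + Ps 1 (v x) (ww x) *\<^sub>R H x))"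
    using p by (intro Lp_pairing_integrable(2)[OF C1(2) U.A(3) _ U.A(1,2)]) auto
  have i0: "integrable lborel (\<lambda>x. flux p (Gv x) \<bullet> (Pv 0 (v x) (ww x) *\<^sub>R Gv x + Ps 0 (v x) (ww x) *\<^sub>R H x))"
    using p by (intro Lp_pairing_integrable(2)[OF C0(2) V.A(3) _ V.A(1,2)]) auto
  have i2: "integrable lborel (\<lambda>x. p * (1 - \<theta> (v x) (ww x)) * norm (Gu x) powr p)"
  proof (rule Bochner_Integration.integrable_bound[of _ "\<lambda>x. p * norm (Gu x) powr p"])
    show "integrable lborel (\<lambda>x. p * norm (Gu x) powr p)" using Lp_integrable[OF u(3)] by simp
    show "AE x in lborel. norm (p * (1 - \<theta> (v x) (ww x)) * norm (Gu x) powr p) \<le> norm (p * norm (Gu x) powr p)"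
    proof (rule AE_I2)
      fix x
      have "0 \<le> 1 - \<theta> (v x) (ww x)" "1 - \<theta> (v x) (ww x) \<le> 1"
        using \<theta>_bounds[OF nonneg(2)[of x], of "ww x"] by auto
      then show "norm (p * (1 - \<theta> (v x) (ww x)) * norm (Gu x) powr p) \<le> norm (p * norm (Gu x) powr p)"
        using p by (simp add: abs_mult mult_left_le mult_right_mono)
    qed
  qed (simp add: \<theta>_def UU_def)
  have "(LINT x|lborel. flux p (Gv x) \<bullet> (Pv 0 (v x) (ww x) *\<^sub>R Gv x + Ps 0 (v x) (ww x) *\<^sub>R H x))
      \<le> (LINT x|lborel. flux p (Gu x) \<bullet> (Pv 1 (v x) (ww x) *\<^sub>R Gv x + Ps 1 (v x) (ww x) *\<^sub>R H x)
        + p * (1 - \<theta> (v x) (ww x)) * norm (Gu x) powr p)"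
  proof (rule integral_mono_AE[OF i0 Bochner_Integration.integrable_add[OF i1 i2]])
    show "AE x in lborel. flux p (Gv x) \<bullet> (Pv 0 (v x) (ww x) *\<^sub>R Gv x + Ps 0 (v x) (ww x) *\<^sub>R H x)
       \<le> flux p (Gu x) \<bullet> (Pv 1 (v x) (ww x) *\<^sub>R Gv x + Ps 1 (v x) (ww x) *\<^sub>R H x)
        + p * (1 - \<theta> (v x) (ww x)) * norm (Gu x) powr p"
      using H_eq
    proof eventually_elim
      case (elim x)
      show ?case
      proof (cases "v x < u x")
        case True
        then show ?thesis
          using elim picone_vector[OF nonneg(2)[of x], of "Gv x" "ww x" "Gu x"] by simp
      next
        case False
        \<comment> \<open>Where v >= u the partial derivatives vanish, so the unidentified values of
          H do not enter.\<close>
        then have "dd (v x) (ww x) = 0"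
          using d_pos_s[OF nonneg(2)[of x], of "ww x"] d_bounds(1)[OF nonneg(2)[of x], of "ww x"] by force
        then have "Pv \<sigma> (v x) (ww x) = 0" "Ps \<sigma> (v x) (ww x) = 0" for \<sigma> using eq_0 by auto
        then show ?thesis using p \<theta>_bounds[OF nonneg(2)[of x], of "ww x"] by simp
      qed
    qed
  qed
  also have "\<dots> = (LINT x|lborel. flux p (Gu x) \<bullet> (Pv 1 (v x) (ww x) *\<^sub>R Gv x + Ps 1 (v x) (ww x) *\<^sub>R H x))
        + (LINT x|lborel. p * (1 - \<theta> (v x) (ww x)) * norm (Gu x) powr p)"
    by (rule Bochner_Integration.integral_add[OF i1 i2])
  finally show "\<alpha> * (LINT x|lborel. v x powr (q - 1) * \<Psi> 0 (v x) (ww x))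
      \<le> \<alpha> * (LINT x|lborel. u x powr (q - 1) * \<Psi> 1 (v x) (ww x))
        + (LINT x|lborel. p * (1 - \<theta> (v x) (ww x)) * norm (Gu x) powr p)"
    using C1(3) C0(3) by simp
qed

text \<open>The limit is taken along \<open>\<epsilon> = 1 / (k + 1)\<close>, \<open>K = k + 1\<close>; then \<open>\<theta> = 1 / (1 + \<epsilon> * UU)\<close>.\<close>

lemma theta_tendsto:
  assumes "0 \<le> b" "0 \<le> s"
  shows "(\<lambda>k. picone_test.\<theta> (inverse (real (Suc k))) (real (Suc k)) b s) \<longlonglongrightarrow> 1"
proof -
  have eq: "picone_test.\<theta> (inverse (real (Suc k))) (real (Suc k)) b s
      = 1 / (1 + inverse (real (Suc k)) * (b + inverse (real (Suc k)) + s))" for k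
  proof -
    interpret picone_test p "inverse (real (Suc k))" "real (Suc k)" using p by unfold_locales auto
    have "real (Suc k) + (b + inverse (real (Suc k)) + s) = real (Suc k) * (1 + inverse (real (Suc k)) * (b + inverse (real (Suc k)) + s))"
      by (simp only: distrib_left mult.assoc[symmetric]) simp
    then show ?thesis using assms by (simp add: \<theta>_def UU_def max_absorb1 del: of_nat_Suc)
  qed
  have "(\<lambda>k. 1 / (1 + inverse (real (Suc k)) * (b + inverse (real (Suc k)) + s))) \<longlonglongrightarrow> 1 / (1 + 0 * (b + 0 + s))"
    by (intro tendsto_intros LIMSEQ_inverse_real_of_nat) auto
  then show ?thesis unfolding eq by simp
qed

text \<open>Pointwise limit of the test functions on {v < u}: TT tends to u and RR to v + \<sigma>
  (u - v), so the weight is v^(1 - p) for \<sigma> = 0 and u^(1 - p) for \<sigma> = 1.\<close>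

definition limit_test :: "real \<Rightarrow> 'a \<Rightarrow> real" where
  "limit_test \<sigma> x = (if v x < u x then (v x + \<sigma> * (u x - v x)) powr (1 - p) * u x powr p * ((u x - v x) / u x)\<^sup>2 else 0)"

lemma test_tendsto:
  assumes pos: "v x < u x \<Longrightarrow> 0 < v x" and \<sigma>: "0 \<le> \<sigma>"
  shows "(\<lambda>k. picone_test.\<Psi> p (inverse (real (Suc k))) (real (Suc k)) \<sigma> (v x) (ww x)) \<longlonglongrightarrow> limit_test \<sigma> x"
proof (cases "v x < u x")
  case False
  have "picone_test.\<Psi> p (inverse (real (Suc k))) (real (Suc k)) \<sigma> (v x) (ww x) = 0" for k
  proof -
    interpret picone_test p "inverse (real (Suc k))" "real (Suc k)" using p by unfold_locales auto
    show ?thesis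
      using False eq_0 d_pos_s[OF nonneg(2)[of x], of "ww x"] d_bounds(1)[OF nonneg(2)[of x], of "ww x"] by force
  qed
  then show ?thesis using False by (simp add: limit_test_def)
next
  case True
  define a where "a = u x"
  define b where "b = v x"
  have ab: "0 < b" "b < a" using True pos by (auto simp: a_def b_def)
  define \<epsilon> where "\<epsilon> k = inverse (real (Suc k))" for k
  define t where "t k = picone_test.\<theta> (\<epsilon> k) (real (Suc k)) b (a - b)" for k
  have t: "t \<longlonglongrightarrow> 1" unfolding t_def \<epsilon>_def using ab by (intro theta_tendsto) auto
  have \<epsilon>: "\<epsilon> \<longlonglongrightarrow> 0" unfolding \<epsilon>_def[abs_def] by (rule LIMSEQ_inverse_real_of_nat)
  \<comment> \<open>TT = \<theta> UU, so all limits reduce to those of \<theta> and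
    \<epsilon>.\<close>
  have eq: "picone_test.\<Psi> p (\<epsilon> k) (real (Suc k)) \<sigma> b (a - b)
      = (b + \<epsilon> k + \<sigma> * (a - b)) powr (1 - p) * (t k * (a + \<epsilon> k)) powr p
        * (max (t k * (a + \<epsilon> k) - (b + \<epsilon> k)) 0 / (t k * (a + \<epsilon> k)))\<^sup>2" for k
  proof -
    interpret picone_test p "\<epsilon> k" "real (Suc k)" using p by unfold_locales (auto simp: \<epsilon>_def)
    have "TT b (a - b) = t k * (a + \<epsilon> k)"
      using ab by (simp add: TT_def t_def \<theta>_def UU_def max_absorb1 algebra_simps del: of_nat_Suc)
    then show ?thesis
      using ab by (simp add: \<Psi>_def dd_def RR_def VV_def max_absorb1 del: of_nat_Suc)
  qed
  have r: "0 < b + 0 + \<sigma> * (a - b)" using ab \<sigma> by (intro add_pos_nonneg) auto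
  have "(\<lambda>k. (b + \<epsilon> k + \<sigma> * (a - b)) powr (1 - p) * (t k * (a + \<epsilon> k)) powr p
        * (max (t k * (a + \<epsilon> k) - (b + \<epsilon> k)) 0 / (t k * (a + \<epsilon> k)))\<^sup>2)
     \<longlonglongrightarrow> (b + 0 + \<sigma> * (a - b)) powr (1 - p) * (1 * (a + 0)) powr p * (max (1 * (a + 0) - (b + 0)) 0 / (1 * (a + 0)))\<^sup>2"
    using r ab by (intro tendsto_intros t \<epsilon>) auto
  then have "(\<lambda>k. picone_test.\<Psi> p (\<epsilon> k) (real (Suc k)) \<sigma> b (a - b)) \<longlonglongrightarrow> (b + \<sigma> * (a - b)) powr (1 - p) * a powr p * ((a - b) / a)\<^sup>2"
    unfolding eq using ab by (simp add: max_absorb1)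
  then show ?thesis
    using True by (simp add: limit_test_def a_def b_def \<epsilon>_def max_absorb1)
qed

text \<open>For the subsolution, u^(q - 1) (u - v)_+ is an integrable majorant. For the
  supersolution v^(1 - p) may be large where v is small, and integrability of the limit is itself a
  consequence of Fatou's lemma; it is what allows the two limits to be subtracted.\<close>

theorem comparison: "AE x in lborel. u x \<le> v x"
proof -
  define \<epsilon> where "\<epsilon> k = inverse (real (Suc k))" for k
  define K where "K k = real (Suc k)" for k
  define \<Psi> where "\<Psi> \<sigma> k x = picone_test.\<Psi> p (\<epsilon> k) (K k) \<sigma> (v x) (ww x)" for \<sigma> k x
  define t where "t k x = picone_test.\<theta> (\<epsilon> k) (K k) (v x) (ww x)" for k x
  have PT: "picone_test p (\<epsilon> k) (K k)" for k using p by unfold_locales (auto simp: \<epsilon>_def K_def)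
  have \<Psi>0: "0 \<le> \<Psi> \<sigma> k x" for \<sigma> k x unfolding \<Psi>_def by (rule picone_test.\<Psi>_nonneg[OF PT])
  have \<Psi>1: "\<Psi> 1 k x \<le> ww x" for k x
    unfolding \<Psi>_def using picone_test.\<Psi>_le[OF PT nonneg(2), of k x "ww x"] by simp
  note est = energy_estimate[of "\<epsilon> k" "K k" for k, folded \<Psi>_def t_def]
  have e: "0 < \<epsilon> k" "0 < K k" for k by (auto simp: \<epsilon>_def K_def)
  note int1 = est(1)[OF e] and int0 = est(2)[OF e] and le = est(3)[OF e]
  have pos: "AE x in lborel. v x < u x \<longrightarrow> 0 < v x"
    using v_pos
  proof eventually_elim
    case (elim x)
    then show ?case using outside[of x] nonneg(2)[of x] by (cases "x \<in> \<Omega>") auto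
  qed
  have lim: "AE x in lborel. (\<lambda>k. \<Psi> \<sigma> k x) \<longlonglongrightarrow> limit_test \<sigma> x" if "0 \<le> \<sigma>" for \<sigma>
    using pos unfolding \<Psi>_def \<epsilon>_def K_def by eventually_elim (rule test_tendsto; use that in simp)
  note [measurable] = Lp_measurable[OF u(2)] Lp_measurable[OF v(2)] Lp_measurable[OF u(3)]
  have Lm [measurable]: "limit_test \<sigma> \<in> borel_measurable borel" for \<sigma>
    unfolding limit_test_def[abs_def] by measurable
  have L0: "0 \<le> limit_test \<sigma> x" for \<sigma> x by (simp add: limit_test_def)
  have Lw: "Lp q ww" using \<phi> by (auto simp: Lp_converges_def)
  have dom: "integrable lborel (\<lambda>x. u x powr (q - 1) * ww x)"
    using Lp_pairing_integrable(2)[OF Lw u(2) q, of "\<lambda>x. u x powr (q - 1)"] nonneg(1) by simp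
  define I where "I = (LINT x|lborel. u x powr (q - 1) * limit_test 1 x)"
  have lim_bound: "AE x in lborel. norm (u x powr (q - 1) * \<Psi> 1 k x) \<le> u x powr (q - 1) * ww x" for k
    using \<Psi>0[of 1 k] \<Psi>1[of k] by (intro AE_I2) (simp add: abs_mult mult_left_mono)
  have lim1: "AE x in lborel. (\<lambda>k. u x powr (q - 1) * \<Psi> 1 k x) \<longlonglongrightarrow> u x powr (q - 1) * limit_test 1 x"
    using lim[of 1] by (auto elim!: eventually_mono intro: tendsto_mult_left)
  have I: "(\<lambda>k. LINT x|lborel. u x powr (q - 1) * \<Psi> 1 k x) \<longlonglongrightarrow> I"
    unfolding I_def
    by (rule integral_dominated_convergence[OF _ _ dom lim1 lim_bound]) (use int1 in \<open>auto dest: borel_measurable_integrable\<close>)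
  have int1': "integrable lborel (\<lambda>x. u x powr (q - 1) * limit_test 1 x)"
    by (rule integrable_dominated_convergence[OF _ _ dom lim1 lim_bound]) (use int1 in \<open>auto dest: borel_measurable_integrable\<close>)
  have err: "(\<lambda>k. LINT x|lborel. p * (1 - t k x) * norm (Gu x) powr p) \<longlonglongrightarrow> (LINT x|(lborel :: 'a measure). 0)"
  proof (rule integral_dominated_convergence[where w = "\<lambda>x. p * norm (Gu x) powr p"])
    show "integrable lborel (\<lambda>x. p * norm (Gu x) powr p)" using Lp_integrable[OF u(3)] by simp
    show "AE x in lborel. (\<lambda>k. p * (1 - t k x) * norm (Gu x) powr p) \<longlonglongrightarrow> 0"
    proof (rule AE_I2)
      fix x
      have "(\<lambda>k. t k x) \<longlonglongrightarrow> 1"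
        unfolding t_def \<epsilon>_def K_def using nonneg(2)[of x] by (intro theta_tendsto) auto
      then have "(\<lambda>k. p * (1 - t k x) * norm (Gu x) powr p) \<longlonglongrightarrow> p * (1 - 1) * norm (Gu x) powr p"
        by (intro tendsto_intros)
      then show "(\<lambda>k. p * (1 - t k x) * norm (Gu x) powr p) \<longlonglongrightarrow> 0" by simp
    qed
    show "AE x in lborel. norm (p * (1 - t k x) * norm (Gu x) powr p) \<le> p * norm (Gu x) powr p" for k
    proof (rule AE_I2)
      fix x
      have "0 \<le> 1 - t k x" "1 - t k x \<le> 1"
        using picone_test.\<theta>_bounds[OF PT nonneg(2), of k x "ww x"] by (auto simp: t_def)
      then show "norm (p * (1 - t k x) * norm (Gu x) powr p) \<le> p * norm (Gu x) powr p"
        using p by (simp add: abs_mult mult_left_le mult_right_mono)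
    qed
    show "(\<lambda>x. p * (1 - t k x) * norm (Gu x) powr p) \<in> borel_measurable lborel" for k
      unfolding t_def picone_test.\<theta>_def[OF PT] picone_test.UU_def[OF PT] by measurable
  qed simp
  \<comment> \<open>The right-hand side of \<open>energy_estimate\<close> divided by \<alpha>; it
    tends to I because the truncation error tends to 0.\<close>
  define c where "c k = (LINT x|lborel. u x powr (q - 1) * \<Psi> 1 k x) + (LINT x|lborel. p * (1 - t k x) * norm (Gu x) powr p) / \<alpha>" for k
  have "c \<longlonglongrightarrow> I + 0 / \<alpha>"
    unfolding c_def[abs_def] using I err \<alpha> by (intro tendsto_intros) auto
  then have c: "(\<lambda>k. ennreal (c k)) \<longlonglongrightarrow> ennreal I" by (intro tendsto_ennrealI) simp
  have ak: "(\<integral>\<^sup>+x. ennreal (v x powr (q - 1) * \<Psi> 0 k x) \<partial>lborel) \<le> ennreal (c k)" for k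
  proof -
    have "(LINT x|lborel. v x powr (q - 1) * \<Psi> 0 k x) \<le> c k"
      using le[of k] \<alpha> by (simp add: c_def field_simps)
    then show ?thesis
      using \<Psi>0 by (subst nn_integral_eq_integral[OF int0]) (auto intro: ennreal_leI)
  qed
  have "(\<integral>\<^sup>+x. ennreal (v x powr (q - 1) * limit_test 0 x) \<partial>lborel)
      = (\<integral>\<^sup>+x. liminf (\<lambda>k. ennreal (v x powr (q - 1) * \<Psi> 0 k x)) \<partial>lborel)"
  proof (rule nn_integral_cong_AE)
    show "AE x in lborel. ennreal (v x powr (q - 1) * limit_test 0 x) = liminf (\<lambda>k. ennreal (v x powr (q - 1) * \<Psi> 0 k x))"
      using lim[OF order_refl]
    proof eventually_elim
      case (elim x)
      then have "(\<lambda>k. ennreal (v x powr (q - 1) * \<Psi> 0 k x)) \<longlonglongrightarrow> ennreal (v x powr (q - 1) * limit_test 0 x)"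
        by (intro tendsto_ennrealI tendsto_mult_left)
      from lim_imp_Liminf[OF _ this] show ?case by simp
    qed
  qed
  also have "\<dots> \<le> liminf (\<lambda>k. \<integral>\<^sup>+x. ennreal (v x powr (q - 1) * \<Psi> 0 k x) \<partial>lborel)"
    using int0 by (intro nn_integral_liminf) (auto dest: borel_measurable_integrable)
  also have "\<dots> \<le> liminf (\<lambda>k. ennreal (c k))"
    using ak by (intro Liminf_mono) auto
  also have "\<dots> = ennreal I" using lim_imp_Liminf[OF _ c] by simp
  finally have bound: "(\<integral>\<^sup>+x. ennreal (v x powr (q - 1) * limit_test 0 x) \<partial>lborel) \<le> ennreal I" .
  have int0': "integrable lborel (\<lambda>x. v x powr (q - 1) * limit_test 0 x)"
    using bound L0 by (intro integrableI_nonneg) (auto intro: le_less_trans)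
  have "ennreal (LINT x|lborel. v x powr (q - 1) * limit_test 0 x) \<le> ennreal I"
    using bound L0 by (subst nn_integral_eq_integral[OF int0', symmetric]) auto
  moreover have "0 \<le> I" unfolding I_def using L0 by simp
  ultimately have "(LINT x|lborel. v x powr (q - 1) * limit_test 0 x) \<le> I" by simp
  define \<Delta> where "\<Delta> x = v x powr (q - 1) * limit_test 0 x - u x powr (q - 1) * limit_test 1 x" for x
  \<comment> \<open>\<Delta> is v^(q - p) - u^(q - p) times the positive factor Q; q < p makes the
    power strictly decreasing on the positive reals.\<close>
  have \<Delta>_pos: "0 < \<Delta> x" if "0 < v x" "v x < u x" for x
  proof -
    define Q where "Q = u x powr p * ((u x - v x) / u x)\<^sup>2"
    have Q: "0 < Q" using that by (simp add: Q_def)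
    have "u x powr (q - p) < v x powr (q - p)"
      using that qp by (intro powr_less_mono2_neg) auto
    then have "0 < (v x powr (q - p) - u x powr (q - p)) * Q" using Q by simp
    also have "\<dots> = \<Delta> x"
    proof -
      have "y powr (q - p) = y powr (q - 1) * y powr (1 - p)" for y :: real
        by (simp flip: powr_add)
      then show ?thesis
        using that by (simp add: \<Delta>_def limit_test_def Q_def left_diff_distrib mult.assoc)
    qed
    finally show ?thesis .
  qed
  have \<Delta>_nonneg: "AE x in lborel. 0 \<le> \<Delta> x"
    using pos
  proof eventually_elim
    case (elim x)
    then show ?case using \<Delta>_pos[of x] by (cases "v x < u x") (auto simp: \<Delta>_def limit_test_def)
  qed
  have i\<Delta>: "integrable lborel \<Delta>" unfolding \<Delta>_def[abs_def] using int0' int1' by simp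
  have "(LINT x|lborel. \<Delta> x) \<le> 0"
    using \<open>(LINT x|lborel. v x powr (q - 1) * limit_test 0 x) \<le> I\<close> int0' int1' by (simp add: \<Delta>_def I_def)
  then have "(LINT x|lborel. \<Delta> x) = 0"
    using integral_nonneg_AE[OF \<Delta>_nonneg] by simp
  then have "AE x in lborel. \<Delta> x = 0"
    using integral_nonneg_eq_0_iff_AE[OF i\<Delta> \<Delta>_nonneg] by simp
  then show ?thesis
    using pos
  proof eventually_elim
    case (elim x)
    then show ?case using \<Delta>_pos[of x] by (cases "v x < u x") auto
  qed
qed

end

section \<open>Borel representatives\<close>

lemma borel_measurable_lebesgue_cong_AE:
  fixes f g :: "'a::euclidean_space \<Rightarrow> 'b::topological_space"
  assumes f: "f \<in> borel_measurable lebesgue" and ae: "AE x in lebesgue. f x = g x"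
  shows "g \<in> borel_measurable lebesgue"
proof (rule measurableI)
  fix A :: "'b set" assume A: "A \<in> sets borel"
  show "g -` A \<inter> space lebesgue \<in> sets lebesgue"
  proof (rule completion.in_sets_AE)
    show "AE x in lebesgue. x \<in> f -` A \<inter> space lebesgue \<longleftrightarrow> x \<in> g -` A \<inter> space lebesgue"
      using ae by eventually_elim auto
  qed (use measurable_sets[OF f A] in auto)
qed simp

text \<open>Completeness of \<open>lebesgue\<close> transfers measurability from the Borel function
  f' to the cut-off f, which agrees with it almost everywhere; this settles both claims without
  separate measurability of f.\<close>

lemma lebesgue_set_integral_eq:
  fixes f :: "'a::euclidean_space \<Rightarrow> real"
  assumes f': "f' \<in> borel_measurable borel" and ae: "AE x in lborel. indicat_real \<Omega> x *\<^sub>R f x = f' x"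
  shows "set_integrable lebesgue \<Omega> f \<longleftrightarrow> integrable lborel f'"
    "(LINT x:\<Omega>|lebesgue. f x) = (LINT x|lborel. f' x)"
proof -
  have m': "f' \<in> borel_measurable lborel" using f' by simp
  then have m: "f' \<in> borel_measurable lebesgue" by (rule measurable_completion)
  have ae': "AE x in lebesgue. f' x = indicat_real \<Omega> x *\<^sub>R f x"
    using AE_completion[OF ae] by eventually_elim simp
  note mf = borel_measurable_lebesgue_cong_AE[OF m ae']
  show "set_integrable lebesgue \<Omega> f \<longleftrightarrow> integrable lborel f'"
    unfolding set_integrable_def integrable_completion[OF m', symmetric]
    by (rule integrable_cong_AE[OF mf m]) (use ae' in \<open>auto elim: eventually_mono\<close>)
  show "(LINT x:\<Omega>|lebesgue. f x) = (LINT x|lborel. f' x)"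
    unfolding set_lebesgue_integral_def integral_completion[OF m', symmetric]
    by (rule integral_cong_AE[OF mf m]) (use ae' in \<open>auto elim: eventually_mono\<close>)
qed

text \<open>Componentwise, through Borel versions of real functions; the final indicator restores
  exact vanishing outside the domain.\<close>

lemma borel_representative:
  fixes f :: "'a::euclidean_space \<Rightarrow> 'b::euclidean_space"
  assumes f: "set_borel_measurable lebesgue \<Omega> f" and \<Omega>: "\<Omega> \<in> sets borel"
  obtains f' where "f' \<in> borel_measurable borel" "\<And>x. x \<notin> \<Omega> \<Longrightarrow> f' x = 0"
    "AE x in lborel. x \<in> \<Omega> \<longrightarrow> f' x = f x"
proof -
  have "\<forall>b. \<exists>k\<in>borel_measurable lborel. AE x in lborel. (indicat_real \<Omega> x *\<^sub>R f x) \<bullet> b = k x"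
  proof
    fix b :: 'b
    have "(\<lambda>x. (indicat_real \<Omega> x *\<^sub>R f x) \<bullet> b) \<in> borel_measurable lebesgue"
      using f unfolding set_borel_measurable_def by (rule borel_measurable_inner) simp
    then show "\<exists>k\<in>borel_measurable lborel. AE x in lborel. (indicat_real \<Omega> x *\<^sub>R f x) \<bullet> b = k x"
      by (rule completion_ex_borel_measurable_real)
  qed
  then obtain k where k: "\<And>b. k b \<in> borel_measurable lborel"
    "\<And>b. AE x in lborel. (indicat_real \<Omega> x *\<^sub>R f x) \<bullet> b = k b x" by metis
  define f' where "f' x = indicat_real \<Omega> x *\<^sub>R (\<Sum>b\<in>Basis. k b x *\<^sub>R b)" for x
  show thesis
  proof (rule that[of f'])
    have [measurable]: "k b \<in> borel_measurable borel" "\<Omega> \<in> sets borel" for b using k(1) \<Omega> by auto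
    show "f' \<in> borel_measurable borel" unfolding f'_def[abs_def] by measurable
    show "x \<notin> \<Omega> \<Longrightarrow> f' x = 0" for x by (simp add: f'_def)
    have "AE x in lborel. \<forall>b\<in>Basis. (indicat_real \<Omega> x *\<^sub>R f x) \<bullet> b = k b x"
      using k(2) by (intro AE_finite_allI) auto
    then show "AE x in lborel. x \<in> \<Omega> \<longrightarrow> f' x = f x"
    proof eventually_elim
      case (elim x)
      show ?case
      proof
        assume x: "x \<in> \<Omega>"
        then have "f' x = (\<Sum>b\<in>Basis. (f x \<bullet> b) *\<^sub>R b)" using elim by (simp add: f'_def)
        then show "f' x = f x" by (simp add: euclidean_representation)
      qed
    qed
  qed
qed

lemma in_Lp_representative:
  fixes f :: "'a::euclidean_space \<Rightarrow> 'b::euclidean_space"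
  assumes f: "in_Lp r \<Omega> f" and \<Omega>: "open \<Omega>"
  obtains f' where "Lp r f'" "\<And>x. x \<notin> \<Omega> \<Longrightarrow> f' x = 0" "AE x in lborel. x \<in> \<Omega> \<longrightarrow> f' x = f x"
proof -
  obtain f' where f': "f' \<in> borel_measurable borel" "\<And>x. x \<notin> \<Omega> \<Longrightarrow> f' x = 0"
    "AE x in lborel. x \<in> \<Omega> \<longrightarrow> f' x = f x"
    using borel_representative[of \<Omega> f] f \<Omega> by (auto simp: in_Lp_def)
  have "integrable lborel (\<lambda>x. norm (f' x) powr r) \<longleftrightarrow> set_integrable lebesgue \<Omega> (\<lambda>x. norm (f x) powr r)"
  proof (rule lebesgue_set_integral_eq(1)[symmetric])
    note [measurable] = f'(1)
    show "(\<lambda>x. norm (f' x) powr r) \<in> borel_measurable borel" by measurable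
    show "AE x in lborel. indicat_real \<Omega> x *\<^sub>R (norm (f x) powr r) = norm (f' x) powr r"
      using f'(3)
    proof eventually_elim
      case (elim x)
      then show ?case using f'(2)[of x] by (cases "x \<in> \<Omega>") auto
    qed
  qed
  then show thesis using f f' by (intro that[of f']) (auto simp: in_Lp_def Lp_def)
qed

lemma test_fun_outside:
  assumes "test_fun \<Omega> \<psi>" "x \<notin> \<Omega>" shows "\<psi> x = 0" "grad \<psi> x = 0"
proof -
  have x: "x \<notin> closure {x. \<psi> x \<noteq> 0}" using assms by (auto simp: test_fun_def)
  then show "\<psi> x = 0" using closure_subset[of "{x. \<psi> x \<noteq> 0}"] by auto
  show "grad \<psi> x = 0" by (rule C1c_grad_eq_0[OF test_fun_C1c[OF assms(1)] x])
qed

lemma test_fun_measurable: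
  assumes "test_fun \<Omega> \<psi>" shows "\<psi> \<in> borel_measurable borel" "grad \<psi> \<in> borel_measurable borel"
  using C1_measurable[OF smooth_fun_C1, of \<psi>] assms by (auto simp: test_fun_def)

lemma wgrad_representative:
  assumes w: "weak_grad \<Omega> u G"
    and u': "u' \<in> borel_measurable borel" "AE x in lborel. x \<in> \<Omega> \<longrightarrow> u' x = u x"
    and G': "G' \<in> borel_measurable borel" "AE x in lborel. x \<in> \<Omega> \<longrightarrow> G' x = G x"
  shows "wgrad \<Omega> u' G'"
  unfolding wgrad_def
proof (intro allI impI)
  fix \<phi> :: "'a \<Rightarrow> real" and b :: 'a assume t: "test_fun \<Omega> \<phi>" and b: "b \<in> Basis"
  note [measurable] = u'(1) G'(1) test_fun_measurable[OF t]
  have sm: "smooth_fun \<phi>" using t by (simp add: test_fun_def)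
  have "(LINT x:\<Omega>|lebesgue. u x * frechet_derivative \<phi> (at x) b) = (LINT x|lborel. u' x * (grad \<phi> x \<bullet> b))"
  proof (rule lebesgue_set_integral_eq(2))
    show "AE x in lborel. indicat_real \<Omega> x *\<^sub>R (u x * frechet_derivative \<phi> (at x) b) = u' x * (grad \<phi> x \<bullet> b)"
      using u'(2)
    proof eventually_elim
      case (elim x)
      then show ?case
        using test_fun_outside[OF t, of x] by (cases "x \<in> \<Omega>") (auto simp: frechet_derivative_eq_grad[OF sm])
    qed
  qed measurable
  moreover have "(LINT x:\<Omega>|lebesgue. (G x \<bullet> b) * \<phi> x) = (LINT x|lborel. (G' x \<bullet> b) * \<phi> x)"
  proof (rule lebesgue_set_integral_eq(2))
    show "AE x in lborel. indicat_real \<Omega> x *\<^sub>R ((G x \<bullet> b) * \<phi> x) = (G' x \<bullet> b) * \<phi> x"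
      using G'(2)
    proof eventually_elim
      case (elim x)
      then show ?case
        using test_fun_outside[OF t, of x] by (cases "x \<in> \<Omega>") auto
    qed
  qed measurable
  ultimately show "(LINT x|lborel. u' x * (grad \<phi> x \<bullet> b)) = - (LINT x|lborel. (G' x \<bullet> b) * \<phi> x)"
    using w t b by (simp add: weak_grad_def)
qed

text \<open>Truncation at 0 changes the representative of u on a null set only and turns
  nonnegativity almost everywhere into nonnegativity everywhere, as the range {0..} for the first
  argument of the test functions requires.\<close>

lemma X_grad_representative:
  assumes X: "X_grad q p \<Omega> u G" and \<Omega>: "open \<Omega>" and q: "0 \<le> q"
    and pos: "AE x in lebesgue. x \<in> \<Omega> \<longrightarrow> 0 \<le> u x"
  obtains u' G' where "Lp q u'" "Lp p G'" "wgrad \<Omega> u' G'" "\<And>x. x \<notin> \<Omega> \<Longrightarrow> u' x = 0" "\<And>x. 0 \<le> u' x"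
    "AE x in lborel. x \<in> \<Omega> \<longrightarrow> u' x = u x" "AE x in lborel. x \<in> \<Omega> \<longrightarrow> G' x = G x"
proof -
  have X': "in_Lp q \<Omega> u" "in_Lp p \<Omega> G" "weak_grad \<Omega> u G" using X by (auto simp: X_grad_def)
  obtain f where f: "Lp q f" "\<And>x. x \<notin> \<Omega> \<Longrightarrow> f x = 0" "AE x in lborel. x \<in> \<Omega> \<longrightarrow> f x = u x"
    using in_Lp_representative[OF X'(1) \<Omega>] by blast
  obtain G' where G': "Lp p G'" "\<And>x. x \<notin> \<Omega> \<Longrightarrow> G' x = 0" "AE x in lborel. x \<in> \<Omega> \<longrightarrow> G' x = G x"
    using in_Lp_representative[OF X'(2) \<Omega>] by blast
  note [measurable] = Lp_measurable[OF f(1)]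
  define u' where "u' x = max (f x) 0" for x
  have m: "u' \<in> borel_measurable borel" unfolding u'_def[abs_def] by measurable
  have L: "Lp q u'"
    by (rule Lp_norm_le[OF f(1) q m, of 1]) (simp add: u'_def)
  have ae: "AE x in lborel. x \<in> \<Omega> \<longrightarrow> u' x = u x"
    using f(3) pos[unfolded AE_completion_iff] by eventually_elim (auto simp: u'_def)
  show thesis
    by (rule that[OF L G'(1) wgrad_representative[OF X'(3) m ae Lp_measurable[OF G'(1)] G'(3)] _ _ ae G'(3)])
       (simp_all add: u'_def f(2))
qed

lemma flux_integral_eq:
  assumes t: "test_fun \<Omega> \<psi>" and G': "G' \<in> borel_measurable borel" "AE x in lborel. x \<in> \<Omega> \<longrightarrow> G' x = G x"
  shows "(LINT x:\<Omega>|lebesgue. flux p (G x) \<bullet> grad \<psi> x)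
    = (LINT x|lborel. flux p (G' x) \<bullet> grad \<psi> x)"
proof (rule lebesgue_set_integral_eq(2))
  note [measurable] = G'(1) test_fun_measurable[OF t]
  show "(\<lambda>x. flux p (G' x) \<bullet> grad \<psi> x) \<in> borel_measurable borel" by measurable
  show "AE x in lborel. indicat_real \<Omega> x *\<^sub>R (flux p (G x) \<bullet> grad \<psi> x)
      = flux p (G' x) \<bullet> grad \<psi> x"
    using G'(2)
  proof eventually_elim
    case (elim x)
    then show ?case using test_fun_outside[OF t, of x] by (cases "x \<in> \<Omega>") auto
  qed
qed

text \<open>Positivity gives sgn = 1, so \<open>qpow\<close> is the plain power; for q = 1 it is 1,
  in accordance with u powr 0 = 1 for u > 0. Outside the domain \<psi> = 0.\<close>

lemma reaction_integral_eq:
  assumes t: "test_fun \<Omega> \<psi>" and u': "u' \<in> borel_measurable borel" "AE x in lborel. x \<in> \<Omega> \<longrightarrow> u' x = u x"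
    and pos: "AE x in lebesgue. x \<in> \<Omega> \<longrightarrow> 0 < u x"
  shows "(LINT x:\<Omega>|lebesgue. qpow q (u x) * \<psi> x) = (LINT x|lborel. u' x powr (q - 1) * \<psi> x)"
proof (rule lebesgue_set_integral_eq(2))
  note [measurable] = u'(1) test_fun_measurable[OF t]
  show "(\<lambda>x. u' x powr (q - 1) * \<psi> x) \<in> borel_measurable borel" by measurable
  show "AE x in lborel. indicat_real \<Omega> x *\<^sub>R (qpow q (u x) * \<psi> x) = u' x powr (q - 1) * \<psi> x"
    using u'(2) pos[unfolded AE_completion_iff]
  proof eventually_elim
    case (elim x)
    then show ?case using test_fun_outside[OF t, of x] by (cases "x \<in> \<Omega>") (auto simp: qpow_def)
  qed
qed

lemma Lp_norm_tendsto_0D: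
  fixes f :: "nat \<Rightarrow> 'a::euclidean_space \<Rightarrow> 'b::euclidean_space"
  assumes "(\<lambda>n. Lp_norm r \<Omega> (f n)) \<longlonglongrightarrow> 0" "0 < r"
  shows "(\<lambda>n. LINT x:\<Omega>|lebesgue. norm (f n x) powr r) \<longlonglongrightarrow> 0"
proof -
  have "(\<lambda>n. Lp_norm r \<Omega> (f n) powr r) \<longlonglongrightarrow> 0"
    using assms by (intro tendsto_zero_powrI[of _ _ "\<lambda>_. r" r]) (auto simp: Lp_norm_def)
  moreover have "0 \<le> (LINT x:\<Omega>|lebesgue. norm (f n x) powr r)" for n
    unfolding set_lebesgue_integral_def by (intro Bochner_Integration.integral_nonneg) simp
  ultimately show ?thesis using assms(2) by (simp add: Lp_norm_def powr_powr)
qed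

lemma Lp_converges_representative:
  fixes f :: "nat \<Rightarrow> 'a::euclidean_space \<Rightarrow> 'b::euclidean_space"
  assumes f: "\<And>n. Lp r (f n)" "\<And>n x. x \<notin> \<Omega> \<Longrightarrow> f n x = 0"
    and g': "Lp r g'" "\<And>x. x \<notin> \<Omega> \<Longrightarrow> g' x = 0" "AE x in lborel. x \<in> \<Omega> \<longrightarrow> g' x = g x"
    and lim: "(\<lambda>n. Lp_norm r \<Omega> (\<lambda>x. f n x - g x)) \<longlonglongrightarrow> 0" and r: "0 < r"
  shows "Lp_converges r f g'"
proof -
  have "(LINT x:\<Omega>|lebesgue. norm (f n x - g x) powr r) = (LINT x|lborel. norm (f n x - g' x) powr r)" for n
  proof (rule lebesgue_set_integral_eq(2))
    note [measurable] = Lp_measurable[OF f(1)] Lp_measurable[OF g'(1)]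
    show "(\<lambda>x. norm (f n x - g' x) powr r) \<in> borel_measurable borel" by measurable
    show "AE x in lborel. indicat_real \<Omega> x *\<^sub>R (norm (f n x - g x) powr r) = norm (f n x - g' x) powr r"
      using g'(3)
    proof eventually_elim
      case (elim x)
      then show ?case using f(2)[of x n] g'(2)[of x] by (cases "x \<in> \<Omega>") auto
    qed
  qed
  with Lp_norm_tendsto_0D[OF lim r] show ?thesis
    using f(1) g'(1) by (simp add: Lp_converges_def)
qed

theorem theorem4p1:
  fixes \<Omega> :: "'a::euclidean_space set" and u v :: "'a \<Rightarrow> real"
    and \<alpha> q p :: real
  assumes "\<alpha> > 0" and "1 \<le> q" and "q < p"
    and "open \<Omega>" and "connected \<Omega>"
    and "Xqp q p \<Omega> u" and "Xqp q p \<Omega> v"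
    and "AE x in lebesgue. x \<in> \<Omega> \<longrightarrow> u x > 0"
    and "AE x in lebesgue. x \<in> \<Omega> \<longrightarrow> v x > 0"
    and "weak_subsol \<alpha> q p \<Omega> u" and "weak_supersol \<alpha> q p \<Omega> v"
    and "Xqp0 q p \<Omega> (\<lambda>x. max (u x - v x) 0)"
  shows "AE x in lebesgue. x \<in> \<Omega> \<longrightarrow> v x \<ge> u x"
proof -
  have q: "0 \<le> q" "0 < q" and p: "0 < p" using assms(2,3) by auto
  have pos: "AE x in lebesgue. x \<in> \<Omega> \<longrightarrow> 0 \<le> u x" "AE x in lebesgue. x \<in> \<Omega> \<longrightarrow> 0 \<le> v x"
  proof -
    show "AE x in lebesgue. x \<in> \<Omega> \<longrightarrow> 0 \<le> u x" using assms(8) by eventually_elim auto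
    show "AE x in lebesgue. x \<in> \<Omega> \<longrightarrow> 0 \<le> v x" using assms(9) by eventually_elim auto
  qed
  obtain Gu where Gu: "X_grad q p \<Omega> u Gu"
    "\<And>\<psi>. test_fun \<Omega> \<psi> \<Longrightarrow> \<forall>x. 0 \<le> \<psi> x \<Longrightarrow>
      (LINT x:\<Omega>|lebesgue. flux p (Gu x) \<bullet> grad \<psi> x)
        \<le> \<alpha> * (LINT x:\<Omega>|lebesgue. qpow q (u x) * \<psi> x)"
    using assms(10) unfolding weak_subsol_def by blast
  obtain Gv where Gv: "X_grad q p \<Omega> v Gv"
    "\<And>\<psi>. test_fun \<Omega> \<psi> \<Longrightarrow> \<forall>x. 0 \<le> \<psi> x \<Longrightarrow>
      (LINT x:\<Omega>|lebesgue. flux p (Gv x) \<bullet> grad \<psi> x)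
        \<ge> \<alpha> * (LINT x:\<Omega>|lebesgue. qpow q (v x) * \<psi> x)"
    using assms(11) unfolding weak_supersol_def by blast
  obtain H \<phi> where H: "X_grad q p \<Omega> (\<lambda>x. max (u x - v x) 0) H" and \<phi>: "\<And>n. test_fun \<Omega> (\<phi> n)"
    and lim: "(\<lambda>n. Lp_norm q \<Omega> (\<lambda>x. \<phi> n x - max (u x - v x) 0) + Lp_norm p \<Omega> (\<lambda>x. grad (\<phi> n) x - H x)) \<longlonglongrightarrow> 0"
    using assms(12) unfolding Xqp0_def by blast
  obtain u' Gu' where u': "Lp q u'" "Lp p Gu'" "wgrad \<Omega> u' Gu'" "\<And>x. x \<notin> \<Omega> \<Longrightarrow> u' x = 0" "\<And>x. 0 \<le> u' x"
    "AE x in lborel. x \<in> \<Omega> \<longrightarrow> u' x = u x" "AE x in lborel. x \<in> \<Omega> \<longrightarrow> Gu' x = Gu x"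
    by (rule X_grad_representative[OF Gu(1) assms(4) q(1) pos(1)]) (rule that)
  obtain v' Gv' where v': "Lp q v'" "Lp p Gv'" "wgrad \<Omega> v' Gv'" "\<And>x. x \<notin> \<Omega> \<Longrightarrow> v' x = 0" "\<And>x. 0 \<le> v' x"
    "AE x in lborel. x \<in> \<Omega> \<longrightarrow> v' x = v x" "AE x in lborel. x \<in> \<Omega> \<longrightarrow> Gv' x = Gv x"
    by (rule X_grad_representative[OF Gv(1) assms(4) q(1) pos(2)]) (rule that)
  have H': "in_Lp p \<Omega> H" "weak_grad \<Omega> (\<lambda>x. max (u x - v x) 0) H" using H by (auto simp: X_grad_def)
  obtain H' where H'': "Lp p H'" "\<And>x. x \<notin> \<Omega> \<Longrightarrow> H' x = 0" "AE x in lborel. x \<in> \<Omega> \<longrightarrow> H' x = H x"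
    by (rule in_Lp_representative[OF H'(1) assms(4)]) (rule that)
  define w' where "w' x = max (u' x - v' x) 0" for x
  note [measurable] = Lp_measurable[OF u'(1)] Lp_measurable[OF v'(1)]
  have wm: "w' \<in> borel_measurable borel" unfolding w'_def[abs_def] by measurable
  have wL: "Lp q w'"
    by (rule Lp_norm_le[OF Lp_diff[OF u'(1) v'(1) q(1)] q(1) wm, of 1]) (simp add: w'_def)
  have w0: "w' x = 0" if "x \<notin> \<Omega>" for x using that u'(4) v'(4) by (simp add: w'_def)
  have w_ae: "AE x in lborel. x \<in> \<Omega> \<longrightarrow> w' x = max (u x - v x) 0"
    using u'(6) v'(6) by eventually_elim (simp add: w'_def)
  have nn: "0 \<le> Lp_norm q \<Omega> f" "0 \<le> Lp_norm p \<Omega> F" for f :: "'a \<Rightarrow> real" and F :: "'a \<Rightarrow> 'a"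
    by (simp_all add: Lp_norm_def)
  \<comment> \<open>Both summands of the X_0 distance are nonnegative, so each tends to 0
    separately.\<close>
  have lim1: "(\<lambda>n. Lp_norm q \<Omega> (\<lambda>x. \<phi> n x - max (u x - v x) 0)) \<longlonglongrightarrow> 0"
    by (rule tendsto_sandwich[OF _ _ tendsto_const lim]) (auto simp: nn)
  have lim2: "(\<lambda>n. Lp_norm p \<Omega> (\<lambda>x. grad (\<phi> n) x - H x)) \<longlonglongrightarrow> 0"
    by (rule tendsto_sandwich[OF _ _ tendsto_const lim]) (auto simp: nn)
  have \<phi>L: "Lp q (\<phi> n)" "Lp p (grad (\<phi> n))" for n
    using C1c_Lp[OF test_fun_C1c[OF \<phi>[of n]]] q p by auto
  interpret sub_super_pair \<Omega> \<alpha> p q u' v' Gu' Gv' H' \<phi>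
  proof
    show "AE x in lborel. x \<in> \<Omega> \<longrightarrow> 0 < v' x"
      using v'(6) assms(9)[unfolded AE_completion_iff] by eventually_elim auto
    show "wgrad \<Omega> (\<lambda>x. max (u' x - v' x) 0) H'"
      using wgrad_representative[OF H'(2) wm w_ae Lp_measurable[OF H''(1)] H''(3)] by (simp add: w'_def[abs_def])
    show "Lp_converges q \<phi> (\<lambda>x. max (u' x - v' x) 0)"
      using Lp_converges_representative[OF \<phi>L(1) test_fun_outside(1)[OF \<phi>] wL w0 w_ae lim1 q(2)] by (simp add: w'_def[abs_def])
    show "Lp_converges p (\<lambda>n. grad (\<phi> n)) H'"
      by (rule Lp_converges_representative[OF \<phi>L(2) test_fun_outside(2)[OF \<phi>] H'' lim2 p])
    fix \<psi> :: "'a \<Rightarrow> real" assume \<psi>: "test_fun \<Omega> \<psi>" "\<And>x. 0 \<le> \<psi> x"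
    show "(LINT x|lborel. flux p (Gu' x) \<bullet> grad \<psi> x) \<le> \<alpha> * (LINT x|lborel. u' x powr (q - 1) * \<psi> x)"
      using Gu(2)[OF \<psi>(1)] \<psi>(2) flux_integral_eq[OF \<psi>(1) Lp_measurable[OF u'(2)] u'(7), of p]
        reaction_integral_eq[OF \<psi>(1) Lp_measurable[OF u'(1)] u'(6) assms(8), of q] by simp
    show "\<alpha> * (LINT x|lborel. v' x powr (q - 1) * \<psi> x) \<le> (LINT x|lborel. flux p (Gv' x) \<bullet> grad \<psi> x)"
      using Gv(2)[OF \<psi>(1)] \<psi>(2) flux_integral_eq[OF \<psi>(1) Lp_measurable[OF v'(2)] v'(7), of p]
        reaction_integral_eq[OF \<psi>(1) Lp_measurable[OF v'(1)] v'(6) assms(9), of q] by simp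
  qed (use assms u' v' \<phi> in auto)
  have "AE x in lborel. x \<in> \<Omega> \<longrightarrow> u x \<le> v x"
    using comparison u'(6) v'(6) by eventually_elim auto
  then show ?thesis by (rule AE_completion)
qed

end
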